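(* Let $n\geq 2$ and let $F\in \mathbb{Z}[x_1,\ldots,x_n]$ be an absolutely irreducible form of degree $d$, defining the hypersurface $X:F=0$ in $\mathbb{P}^{n-1}$. Let $B_1,\ldots,B_n\geq 1$, $\mathbf{B}=(B_1,\ldots,B_n)$ and $V=\prod_{i=1}^n B_i$. Then $$ N_1(F;\mathbf{B})\ll V^{(n-2)/n}(\log \|F\|V)^{(n-2)(2n^2+n+3)/3}, $$ and, for every $\varepsilon>0$ and $B\geq 1$, $$ N_1(F;B)=O(B^{n-2+\varepsilon}). $$ Here the implied constants depend at most on $d$, $n$ and $\varepsilon$.
   Context: A vector $\mathbf{x}\in\mathbb{Z}^n$ is primitive if $\mathrm{h.c.f.}(x_1,\ldots,x_n)=1$; $Z^n$ denotes the set of primitive vectors. $\|F\|$ is the maximum modulus of the coefficients of $F$. $N_1(F;\mathbf{B})$ is the number of $\mathbf{x}\in Z^n$ with $F(\mathbf{x})=0$ and $|x_i|\leq B_i$ for $1\leq i\leq n$, such that the point $[\mathbf{x}]$ does not lie on any line contained in $X$. $N_1(F;B)$ denotes $N_1(F;\mathbf{B})$ with $B_i=B$ for all $i$. Irreducible means absolutely (geometrically) irreducible.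
   Formalization: The factor log ‖F‖V is read as max(1, log(‖F‖V)); with the plain logarithm the first bound fails when ‖F‖V is 1 or close to 1 (e.g. x₁²+x₂²−x₃² with all B_i=1: right side 0, count 8). *)

theory Defs
  imports
    Complex_Main
    "HOL-Library.FuncSet"
    "HOL-Library.Poly_Mapping"
    "HOL-Computational_Algebra.Factorial_Ring"
begin

text \<open>A polynomial assigns a coefficient to each exponent vector, with finite support;
  multiplication on \<^typ>\<open>(nat \<Rightarrow>\<^sub>0 nat) \<Rightarrow>\<^sub>0 'a\<close> is convolution. The variables of
  $R[x_1,\ldots,x_n]$ are indexed by $0,\ldots,n-1$.\<close>

type_synonym 'a mpol = "(nat \<Rightarrow>\<^sub>0 nat) \<Rightarrow>\<^sub>0 'a"

definition mpol_eval :: "'a::comm_semiring_1 mpol \<Rightarrow> (nat \<Rightarrow> 'a) \<Rightarrow> 'a" where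
  "mpol_eval P x =
     (\<Sum>m\<in>Poly_Mapping.keys P. Poly_Mapping.lookup P m *
        (\<Prod>i\<in>Poly_Mapping.keys m. x i ^ Poly_Mapping.lookup m i))"

definition form :: "nat \<Rightarrow> nat \<Rightarrow> 'a::zero mpol \<Rightarrow> bool" where
  "form n d P \<longleftrightarrow>
     (\<forall>m\<in>Poly_Mapping.keys P. Poly_Mapping.keys m \<subseteq> {..<n} \<and>
        (\<Sum>i\<in>Poly_Mapping.keys m. Poly_Mapping.lookup m i) = d)"

definition complex_mpol :: "int mpol \<Rightarrow> complex mpol" where
  "complex_mpol F = Poly_Mapping.map of_int F"

text \<open>Irreducibility is taken in the ring of complex polynomials in countably many variables.
  For a polynomial in the first \<open>n\<close> variables this is irreducibility in
  $\mathbb{C}[x_1,\ldots,x_n]$: the degree in each variable is additive on products, so every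
  factor again involves only those variables, and the units of both rings are the nonzero
  constants.\<close>

definition absolutely_irreducible :: "int mpol \<Rightarrow> bool" where
  "absolutely_irreducible F \<longleftrightarrow> irreducible (complex_mpol F)"

text \<open>Only meaningful for nonzero \<open>F\<close>.\<close>

definition height :: "int mpol \<Rightarrow> int" where
  "height F = Max ((\<lambda>m. \<bar>Poly_Mapping.lookup F m\<bar>) ` Poly_Mapping.keys F)"

definition vectors :: "nat \<Rightarrow> (nat \<Rightarrow> 'a) set" where
  "vectors n = {..<n} \<rightarrow>\<^sub>E UNIV"

definition primitive_vectors :: "nat \<Rightarrow> (nat \<Rightarrow> int) set" where
  "primitive_vectors n = {x \<in> vectors n. Gcd (x ` {..<n}) = 1}"

text \<open>Subsets of $\mathbb{P}^{n-1}(\mathbb{C})$ are represented by their affine cones (with the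
  origin): the hypersurface by the zero set of \<open>F\<close> in $\mathbb{C}^n$, a line by a
  two-dimensional linear subspace. Lines need not be defined over $\mathbb{Q}$.\<close>

definition hypersurface :: "nat \<Rightarrow> int mpol \<Rightarrow> (nat \<Rightarrow> complex) set" where
  "hypersurface n F = {z \<in> vectors n. mpol_eval (complex_mpol F) z = 0}"

definition is_line :: "nat \<Rightarrow> (nat \<Rightarrow> complex) set \<Rightarrow> bool" where
  "is_line n L \<longleftrightarrow>
     (\<exists>u\<in>vectors n. \<exists>v\<in>vectors n.
        (\<forall>s t. (\<forall>i<n. s * u i + t * v i = 0) \<longrightarrow> s = 0 \<and> t = 0) \<and>
        L = {z \<in> vectors n. \<exists>s t. \<forall>i<n. z i = s * u i + t * v i})"

definition complex_vector :: "nat \<Rightarrow> (nat \<Rightarrow> int) \<Rightarrow> nat \<Rightarrow> complex" where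
  "complex_vector n x = (\<lambda>i\<in>{..<n}. of_int (x i))"

definition N1 :: "nat \<Rightarrow> int mpol \<Rightarrow> (nat \<Rightarrow> real) \<Rightarrow> nat" where
  "N1 n F B = card {x \<in> primitive_vectors n.
     mpol_eval F x = 0 \<and> (\<forall>i<n. \<bar>real_of_int (x i)\<bar> \<le> B i) \<and>
     \<not> (\<exists>L. is_line n L \<and> L \<subseteq> hypersurface n F \<and> complex_vector n x \<in> L)}"

text \<open>The logarithm in the bound is bounded below by 1, as usual in such estimates. With the
  plain logarithm the bound fails when $\|F\|V$ is equal or close to 1: for
  $F = x_1^2 + x_2^2 - x_3^2$ and $B_1 = B_2 = B_3 = 1$ the right-hand side would be 0, but the
  count is 8.\<close>

definition log1 :: "real \<Rightarrow> real" where
  "log1 x = max 1 (ln x)"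

end

theory Submission
  imports
    Defs
    "Jordan_Normal_Form.Determinant"
    "HOL-Number_Theory.Cong"
begin

text \<open>The bound is proved for a set \<open>S\<close> of points in coordinates of rank \<open>r\<close>, by induction on \<open>r\<close>,
  with \<open>V\<close> an upper bound for the \<open>r \<times> r\<close> determinants of the points, so that no geometry of numbers
  is needed. By Siegel's lemma \<open>S\<close> lies on a form of degree \<open>d\<close> whose coefficients are bounded by a
  power of a bound \<open>E\<close> for the coordinates of the points; it replaces \<open>F\<close>. Taking iterated
  directional derivatives, each point is a nonsingular zero of one of at most \<open>d\<close> forms, also modulo
  some prime \<open>p \<ll> (log E)\<^sup>2\<close>.

  Fix \<open>p\<close> and split the points into projective classes modulo \<open>p\<^sup>k\<close>. By Hensel's lemma there are at most
  \<open>p\<^bsup>k(r-2)+1\<^esup>\<close> classes in each affine chart, and every determinant of points from one class is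
  divisible by \<open>p\<^bsup>kr\<^esup>\<close>: one factor \<open>p\<^sup>k\<close> for each congruence and one more since the points lie on the
  tangent hyperplane modulo \<open>p\<^bsup>2k\<^esup>\<close>. Let \<open>k\<close> be maximal such that the class of a point has full rank;
  then \<open>p\<^bsup>kr\<^esup> \<le> V\<close>, and the class modulo \<open>p\<^bsup>k+1\<^esup>\<close> lies in a hyperplane, where the induction hypothesis
  applies with \<open>V / p\<^bsup>kr\<^esup>\<close> in place of \<open>V\<close>. Using the powers of one prime, instead of several primes,
  loses only one constant depending on \<open>d\<close> in each dimension. In rank 2 there are at most \<open>d\<close> points,
  since no line through a point of \<open>S\<close> lies in the hypersurface.\<close>

section \<open>Homogeneous polynomial functions\<close>

text \<open>With \<open>q = p ^ (k * r)\<close> there are at most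
  \<open>p ^ (r - 1) * q powr ((r - 2) / r)\<close> classes modulo \<open>p ^ (k + 1)\<close> in a
  chart, and by induction each holds about \<open>(V / q) powr ((r - 3) / (r - 1))\<close> points.
  As \<open>(r - 3) / (r - 1) \<le> (r - 2) / r\<close> and \<open>q \<le> V\<close>, the product is
  largest at \<open>q = V\<close>, where the exponent of \<open>V\<close> is
  \<open>(r - 2) / r\<close>. So all levels \<open>k\<close> obey the same bound, and only their
  number, O(log E), is lost. The two forms have different roles. The small form supplies derivatives
  and primes within one step of the induction; its coefficients make the size of \<open>p\<close>
  independent of \<open>F\<close>, but it may contain lines through the points. The absence of lines
  is therefore recorded for \<open>F\<close>, and it is \<open>F\<close> that is restricted to
  hyperplanes. The determinants are controlled on a set \<open>A\<close> that may be larger than the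
  set \<open>S\<close> to be counted: \<open>S\<close> may fail to span, and a hyperplane containing
  \<open>S\<close> has to be spanned by points of \<open>A\<close> for the induction hypothesis to
  apply to it.\<close>

text \<open>Forms are handled as functions, since they get restricted to sublattices over and over. The set
  \<open>K\<close> constrains the coefficients of the (noncommutative) expansion.\<close>

primrec hform ::
  "'a::comm_ring_1 set \<Rightarrow> nat \<Rightarrow> nat \<Rightarrow> ((nat \<Rightarrow> 'a) \<Rightarrow> 'a) \<Rightarrow> bool" where
  "hform K r 0 F \<longleftrightarrow> (\<exists>c\<in>K. F = (\<lambda>_. c))"
| "hform K r (Suc d) F \<longleftrightarrow>
     (\<exists>G. (\<forall>i<r. hform K r d (G i)) \<and> F = (\<lambda>x. \<Sum>i<r. x i * G i x))"

section \<open>Closure properties of forms and their behaviour under scaling\<close>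

lemma hform_cong:
  assumes "hform K r d F" "\<And>i. i < r \<Longrightarrow> x i = y i"
  shows "F x = F y"
  using assms(1)
proof (induction d arbitrary: F)
  case (Suc d)
  then obtain G where G: "\<forall>i<r. hform K r d (G i)" "F = (\<lambda>x. \<Sum>i<r. x i * G i x)"
    by auto
  then have "G i x = G i y" if "i < r" for i using Suc.IH that by blast
  then show ?case unfolding G(2) using assms(2) by (intro sum.cong) auto
qed auto

lemma hform_scale:
  assumes "hform K r d F"
  shows "F (\<lambda>i. c * x i) = c ^ d * F x"
  using assms
proof (induction d arbitrary: F)
  case (Suc d)
  then obtain G where G: "\<forall>i<r. hform K r d (G i)" "F = (\<lambda>x. \<Sum>i<r. x i * G i x)"
    by auto
  then have "G i (\<lambda>i. c * x i) = c ^ d * G i x" if "i < r" for i using Suc.IH that by blast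
  then show ?case unfolding G(2) by (auto simp: sum_distrib_left algebra_simps intro!: sum.cong)
qed auto

lemma hform_add:
  assumes "hform K r d F" "hform K' r d F'" "\<And>a b. a \<in> K \<Longrightarrow> b \<in> K' \<Longrightarrow> a + b \<in> K''"
  shows "hform K'' r d (\<lambda>x. F x + F' x)"
  using assms(1,2)
proof (induction d arbitrary: F F')
  case 0
  then show ?case using assms(3) by force
next
  case (Suc d)
  then obtain G where G: "\<forall>i<r. hform K r d (G i)" "F = (\<lambda>x. \<Sum>i<r. x i * G i x)"
    by auto
  from Suc obtain G' where G': "\<forall>i<r. hform K' r d (G' i)" "F' = (\<lambda>x. \<Sum>i<r. x i * G' i x)"
    by auto
  have "\<forall>i<r. hform K'' r d (\<lambda>x. G i x + G' i x)" using Suc.IH G G' by blast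
  then show ?case unfolding hform.simps G(2) G'(2)
    by (intro exI[of _ "\<lambda>i x. G i x + G' i x"]) (auto simp: algebra_simps sum.distrib)
qed

lemma hform_cmult:
  assumes "hform K r d F" "\<And>a. a \<in> K \<Longrightarrow> c * a \<in> K'"
  shows "hform K' r d (\<lambda>x. c * F x)"
  using assms(1)
proof (induction d arbitrary: F)
  case 0
  then show ?case using assms(2) by force
next
  case (Suc d)
  then obtain G where G: "\<forall>i<r. hform K r d (G i)" "F = (\<lambda>x. \<Sum>i<r. x i * G i x)"
    by auto
  have "\<forall>i<r. hform K' r d (\<lambda>x. c * G i x)" using Suc.IH G by blast
  then show ?case unfolding hform.simps G(2)
    by (intro exI[of _ "\<lambda>i x. c * G i x"]) (auto simp: sum_distrib_left algebra_simps)
qed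

lemma hform_zero: "0 \<in> K \<Longrightarrow> hform K r d (\<lambda>_. 0)"
proof (induction d)
  case (Suc d)
  then show ?case by (auto intro!: exI[of _ "\<lambda>_ _. 0"])
qed auto

lemma hform_sum:
  assumes "\<And>i. i \<in> I \<Longrightarrow> hform UNIV r d (F i)"
  shows "hform UNIV r d (\<lambda>x. \<Sum>i\<in>I. F i x)"
  using assms
proof (induction I rule: infinite_finite_induct)
  case (insert i I)
  then show ?case by (auto intro!: hform_add[where K = UNIV and K' = UNIV])
qed (auto intro: hform_zero)

lemma hform_times_var:
  assumes "i < r" "hform UNIV r d F"
  shows "hform UNIV r (Suc d) (\<lambda>x. x i * F x)"
proof -
  have "hform UNIV r d ((\<lambda>j. if j = i then F else (\<lambda>_. 0)) j)" for j
    using assms(2) hform_zero[of UNIV] by auto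
  moreover have "x i * F x = (\<Sum>j<r. x j * (if j = i then F else (\<lambda>_. 0)) x)" for x
  proof -
    have "(\<Sum>j<r. x j * (if j = i then F else (\<lambda>_. 0)) x) = (\<Sum>j<r. if j = i then x j * F x else 0)"
      by (intro sum.cong) auto
    also have "\<dots> = x i * F x" using assms(1) by (subst sum.delta) auto
    finally show ?thesis by simp
  qed
  ultimately show ?thesis unfolding hform.simps
    by (intro exI[of _ "\<lambda>j. if j = i then F else (\<lambda>_. 0)"]) auto
qed

lemma hform_mult:
  assumes "hform UNIV r d F" "hform UNIV r e F'"
  shows "hform UNIV r (d + e) (\<lambda>x. F x * F' x)"
  using assms(1)
proof (induction d arbitrary: F)
  case 0
  then show ?case using assms(2) by (auto intro!: hform_cmult)
next
  case (Suc d)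
  then obtain G where G: "\<forall>i<r. hform UNIV r d (G i)" "F = (\<lambda>x. \<Sum>i<r. x i * G i x)"
    by auto
  have "\<forall>i<r. hform UNIV r (d + e) (\<lambda>x. G i x * F' x)" using Suc.IH G by blast
  then show ?case unfolding add_Suc hform.simps G(2)
    by (intro exI[of _ "\<lambda>i x. G i x * F' x"]) (auto simp: sum_distrib_left sum_distrib_right algebra_simps)
qed

lemma hform_prod:
  assumes "finite I" "\<And>i. i \<in> I \<Longrightarrow> hform UNIV r (d i) (F i)"
  shows "hform UNIV r (\<Sum>i\<in>I. d i) (\<lambda>x. \<Prod>i\<in>I. F i x)"
  using assms by (induction I rule: finite_induct) (auto intro!: hform_mult)

lemma hform_var_power: "i < r \<Longrightarrow> hform UNIV r d (\<lambda>x. x i ^ d)"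
proof (induction d)
  case (Suc d)
  then show ?case using hform_times_var[of i r d "\<lambda>x. x i ^ d"] by (simp add: power_Suc)
qed auto

lemma hform_subst:
  assumes "hform UNIV r d F"
  shows "hform UNIV s d (\<lambda>u. F (\<lambda>i. \<Sum>j<s. u j * v j i))"
  using assms
proof (induction d arbitrary: F)
  case (Suc d)
  then obtain G where G: "\<forall>i<r. hform UNIV r d (G i)" "F = (\<lambda>x. \<Sum>i<r. x i * G i x)"
    by auto
  let ?G = "\<lambda>i u. G i (\<lambda>i. \<Sum>j<s. u j * v j i)"
  have "\<forall>i<r. hform UNIV s d (?G i)" using Suc.IH G by blast
  then have "hform UNIV s (Suc d) (\<lambda>u. \<Sum>i<r. (\<Sum>j<s. u j * v j i) * ?G i u)"
    by (auto simp: sum_distrib_right mult.assoc intro!: hform_sum hform_times_var hform_cmult[where K = UNIV]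
        simp del: hform.simps)
  then show ?case unfolding G(2) .
qed auto

text \<open>The coefficient of the pure power of \<open>t\<close> is recorded because it shows, in
  rank 2, that the dehomogenized polynomial is nonzero.\<close>

lemma hform_binary:
  assumes "hform UNIV r d F"
  obtains c where "\<And>s t. F (\<lambda>i. s * x i + t * y i) = (\<Sum>j\<le>d. c j * s ^ (d - j) * t ^ j)" "c d = F y"
proof -
  have "\<exists>c. \<forall>s t. F (\<lambda>i. s * x i + t * y i) = (\<Sum>j\<le>d. c j * s ^ (d - j) * t ^ j)"
    using assms
  proof (induction d arbitrary: F)
    case (Suc d)
    then obtain G where G: "\<forall>i<r. hform UNIV r d (G i)" "F = (\<lambda>x. \<Sum>i<r. x i * G i x)"
      by auto
    then have "\<forall>i<r. \<exists>c. \<forall>s t. G i (\<lambda>i. s * x i + t * y i) = (\<Sum>j\<le>d. c j * s ^ (d - j) * t ^ j)"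
      using Suc.IH by blast
    then obtain c where c: "\<And>i s t. i < r \<Longrightarrow>
        G i (\<lambda>i. s * x i + t * y i) = (\<Sum>j\<le>d. c i j * s ^ (d - j) * t ^ j)" by metis
    define a where "a j = (\<Sum>i<r. x i * c i j)" for j
    define b where "b j = (\<Sum>i<r. y i * c i j)" for j
    \<comment> \<open>Multiplying by \<open>s * x i\<close> keeps the exponent of \<open>t\<close>,
      multiplying by \<open>t * y i\<close> raises it by one; the zeros stand for the missing
      coefficients at the two ends.\<close>
    define e where "e j = (if j \<le> d then a j else 0) + (if j = 0 then 0 else b (j - 1))" for j
    have "F (\<lambda>i. s * x i + t * y i) = (\<Sum>j\<le>Suc d. e j * s ^ (Suc d - j) * t ^ j)" for s t
    proof -
      have "F (\<lambda>i. s * x i + t * y i) = (\<Sum>i<r. (s * x i + t * y i) * (\<Sum>j\<le>d. c i j * s ^ (d - j) * t ^ j))"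
        unfolding G(2) using c by (auto intro!: sum.cong)
      also have "\<dots> = (\<Sum>i<r. \<Sum>j\<le>d. x i * c i j * s ^ (Suc d - j) * t ^ j)
          + (\<Sum>i<r. \<Sum>j\<le>d. y i * c i j * s ^ (d - j) * t ^ Suc j)"
        unfolding sum.distrib[symmetric] sum_distrib_left
        by (intro sum.cong refl) (auto simp: Suc_diff_le algebra_simps)
      also have "\<dots> = (\<Sum>j\<le>d. a j * s ^ (Suc d - j) * t ^ j) + (\<Sum>j\<le>d. b j * s ^ (d - j) * t ^ Suc j)"
        unfolding a_def b_def sum_distrib_right by (subst sum.swap, subst (2) sum.swap) simp
      also have "(\<Sum>j\<le>d. a j * s ^ (Suc d - j) * t ^ j)
          = (\<Sum>j\<le>Suc d. (if j \<le> d then a j else 0) * s ^ (Suc d - j) * t ^ j)"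
        by (auto intro!: sum.cong)
      also have "(\<Sum>j\<le>d. b j * s ^ (d - j) * t ^ Suc j)
          = (\<Sum>j\<le>Suc d. (if j = 0 then 0 else b (j - 1)) * s ^ (Suc d - j) * t ^ j)"
        by (subst sum.atMost_Suc_shift) simp
      finally show ?thesis unfolding e_def sum.distrib[symmetric] by (simp add: algebra_simps del: sum.atMost_Suc)
    qed
    then show ?case by blast
  next
    case 0
    then obtain a where "F = (\<lambda>_. a)" by auto
    then show ?case by (intro exI[of _ "\<lambda>_. a"]) auto
  qed
  then obtain c where c: "\<And>s t. F (\<lambda>i. s * x i + t * y i) = (\<Sum>j\<le>d. c j * s ^ (d - j) * t ^ j)" by blast
  \<comment> \<open>At \<open>s = 0\<close>, \<open>t = 1\<close> only the term \<open>j = d\<close>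
    survives, since \<open>0 ^ 0 = 1\<close>.\<close>
  have "F y = (\<Sum>j\<le>d. c j * 0 ^ (d - j))" using c[of 0 1] by simp
  also have "\<dots> = (\<Sum>j\<le>d. if j = d then c j else 0)"
    by (intro sum.cong) (auto simp: power_0_left)
  finally have "c d = F y" by simp
  with c that show ?thesis by blast
qed

text \<open>The coordinates are moved into the grid one at a time: along a coordinate axis
  \<open>F\<close> is a polynomial of degree at most \<open>d\<close> that is nonzero at the current
  point, so it has a nonzero value among \<open>d + 1\<close> consecutive integers. The point found
  serves as direction of differentiation, and its size does not depend on the box.\<close>

lemma hform_grid:
  fixes F :: "(nat \<Rightarrow> int) \<Rightarrow> int"
  assumes F: "hform UNIV r d F" and x: "F x \<noteq> 0"
  obtains z where "F z \<noteq> 0" "\<And>i. i < r \<Longrightarrow> 0 \<le> z i \<and> z i \<le> int d"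
proof -
  have "\<exists>z. F z \<noteq> 0 \<and> (\<forall>i<m. 0 \<le> z i \<and> z i \<le> int d)" if "m \<le> r" for m
    using that
  proof (induction m)
    case 0
    then show ?case using x by auto
  next
    case (Suc m)
    then obtain z where z: "F z \<noteq> 0" "\<forall>i<m. 0 \<le> z i \<and> z i \<le> int d" by auto
    define e :: "nat \<Rightarrow> int" where "e i = (if i = m then 1 else 0)" for i
    obtain c where c: "\<And>s t. F (\<lambda>i. s * z i + t * e i) = (\<Sum>j\<le>d. c j * s ^ (d - j) * t ^ j)"
      using hform_binary[OF F] by metis
    define q where "q = (\<Sum>j\<le>d. monom (c j) j)"
    have q: "poly q t = F (\<lambda>i. z i + t * e i)" for t
      using c[of 1 t] by (simp add: q_def poly_sum poly_monom)
    have "q \<noteq> 0" using q[of 0] z(1) by auto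
    have "degree q \<le> d" unfolding q_def by (intro degree_sum_le) (auto intro: order.trans[OF degree_monom_le])
    have "\<exists>t\<in>{-z m..int d - z m}. poly q t \<noteq> 0"
    proof (rule ccontr)
      assume "\<not> ?thesis"
      then have "{-z m..int d - z m} \<subseteq> {t. poly q t = 0}" by auto
      then have "card {-z m..int d - z m} \<le> card {t. poly q t = 0}"
        using poly_roots_finite[OF \<open>q \<noteq> 0\<close>] by (intro card_mono)
      also have "\<dots> \<le> degree q" using card_poly_roots_bound[OF \<open>q \<noteq> 0\<close>] by simp
      finally show False using \<open>degree q \<le> d\<close> by simp
    qed
    then obtain t where "t \<in> {-z m..int d - z m}" "F (\<lambda>i. z i + t * e i) \<noteq> 0" using q by auto
    then show ?case using z(2) by (intro exI[of _ "\<lambda>i. z i + t * e i"]) (auto simp: e_def less_Suc_eq)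
  qed
  from this[of r] show ?thesis using that by blast
qed

lemma hform_bound:
  fixes F :: "(nat \<Rightarrow> int) \<Rightarrow> int"
  assumes "hform {-K..K} r d F" "\<And>i. i < r \<Longrightarrow> \<bar>x i\<bar> \<le> X"
  shows "\<bar>F x\<bar> \<le> int r ^ d * K * X ^ d"
  using assms(1)
proof (induction d arbitrary: F)
  case (Suc d)
  then obtain G where G: "\<forall>i<r. hform {-K..K} r d (G i)" "F = (\<lambda>x. \<Sum>i<r. x i * G i x)"
    by auto
  have "\<bar>x i * G i x\<bar> \<le> X * (int r ^ d * K * X ^ d)" if "i < r" for i
    unfolding abs_mult using assms(2)[of i] Suc.IH[of "G i"] G(1) that
    by (intro mult_mono) (auto intro: order.trans[OF abs_ge_zero])
  then have "(\<Sum>i<r. \<bar>x i * G i x\<bar>) \<le> (\<Sum>i<r. X * (int r ^ d * K * X ^ d))"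
    by (intro sum_mono) auto
  also have "\<dots> = int r ^ Suc d * K * X ^ Suc d" by simp
  finally show ?case unfolding G(2) using sum_abs[of "\<lambda>i. x i * G i x" "{..<r}"] by linarith
qed auto

text \<open>The \<open>P i\<close> are the partial derivatives, built from the recursive expansion
  by the product rule, so that their coefficient bound comes with the construction. Besides degree
  and coefficients, Euler's identity and the expansion modulo \<open>s^2\<close> are all that is
  used of them later.\<close>

lemma hform_derivative:
  fixes F :: "(nat \<Rightarrow> int) \<Rightarrow> int"
  assumes "hform {-K..K} r d F" "0 \<le> K"
  obtains P where "\<And>i. i < r \<Longrightarrow> hform {-(int d * K)..int d * K} r (d - 1) (P i)"
    "\<And>x. (\<Sum>i<r. x i * P i x) = int d * F x"
    "\<And>x h s. s\<^sup>2 dvd F (\<lambda>i. x i + s * h i) - F x - s * (\<Sum>i<r. h i * P i x)"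
proof -
  have "\<exists>P. (\<forall>i<r. hform {-(int d * K)..int d * K} r (d - 1) (P i)) \<and>
    (\<forall>x. (\<Sum>i<r. x i * P i x) = int d * F x) \<and>
    (\<forall>x h s. s\<^sup>2 dvd F (\<lambda>i. x i + s * h i) - F x - s * (\<Sum>i<r. h i * P i x))"
    using assms(1)
  proof (induction d arbitrary: F)
    case 0
    then show ?case by (intro exI[of _ "\<lambda>_ _. 0"]) auto
  next
    case (Suc d)
    then obtain G where G: "\<forall>i<r. hform {-K..K} r d (G i)" "F = (\<lambda>x. \<Sum>i<r. x i * G i x)"
      by auto
    define good where "good F P \<longleftrightarrow> (\<forall>i<r. hform {-(int d * K)..int d * K} r (d - 1) (P i)) \<and>
      (\<forall>x. (\<Sum>i<r. x i * P i x) = int d * F x) \<and>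
      (\<forall>x h s. s\<^sup>2 dvd F (\<lambda>i. x i + s * h i) - F x - s * (\<Sum>i<r. h i * P i x))"
      for F :: "(nat \<Rightarrow> int) \<Rightarrow> int" and P
    have "\<forall>j<r. \<exists>P. good (G j) P"
      using Suc.IH G(1) unfolding good_def by blast
    then obtain Q where "\<And>j. j < r \<Longrightarrow> good (G j) (Q j)" by metis
    then have Q: "\<And>i j. j < r \<Longrightarrow> i < r \<Longrightarrow> hform {-(int d * K)..int d * K} r (d - 1) (Q j i)"
      "\<And>j x. j < r \<Longrightarrow> (\<Sum>i<r. x i * Q j i x) = int d * G j x"
      "\<And>j x h s. j < r \<Longrightarrow> s\<^sup>2 dvd G j (\<lambda>i. x i + s * h i) - G j x - s * (\<Sum>i<r. h i * Q j i x)"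
      unfolding good_def by blast+
    define P where "P i x = G i x + (\<Sum>j<r. x j * Q j i x)" for i x
    have "hform {-(int (Suc d) * K)..int (Suc d) * K} r d (P i)" if "i < r" for i
    proof (cases d)
      \<comment> \<open>Here \<open>d - 1\<close> is truncated to \<open>0\<close>, so the second
        summand of \<open>P i\<close> has the wrong degree; it vanishes because the coefficients of
        \<open>Q j i\<close> are bounded by \<open>0 * K\<close>.\<close>
      case 0
      then have "Q j i = (\<lambda>_. 0)" if "j < r" for j using Q(1)[OF that \<open>i < r\<close>] by auto
      then have "P i = G i" unfolding P_def by auto
      then show ?thesis using G(1) that 0 by auto
    next
      case (Suc d')
      have "hform {-(int d * K)..int d * K} r d (\<lambda>x. \<Sum>j<r. x j * Q j i x)"
        unfolding Suc hform.simps using Q(1)[OF _ that] Suc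
        by (intro exI[of _ "\<lambda>j. Q j i"]) auto
      then show ?thesis unfolding P_def using G(1) that
        by (intro hform_add) (auto simp: algebra_simps)
    qed
    moreover have "(\<Sum>i<r. x i * P i x) = int (Suc d) * F x" for x
    proof -
      have "(\<Sum>i<r. x i * P i x) = F x + (\<Sum>i<r. \<Sum>j<r. x j * (x i * Q j i x))"
        unfolding P_def G(2) by (simp add: algebra_simps sum.distrib sum_distrib_left)
      also have "(\<Sum>i<r. \<Sum>j<r. x j * (x i * Q j i x)) = (\<Sum>j<r. x j * (\<Sum>i<r. x i * Q j i x))"
        by (subst sum.swap) (simp add: sum_distrib_left)
      also have "\<dots> = int d * F x"
        unfolding G(2) sum_distrib_left[of "int d"] using Q(2) by (intro sum.cong) auto
      finally show ?thesis by (simp add: algebra_simps)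
    qed
    moreover have "s\<^sup>2 dvd F (\<lambda>i. x i + s * h i) - F x - s * (\<Sum>i<r. h i * P i x)" for x h s
    proof -
      have "\<exists>R. G j (\<lambda>i. x i + s * h i) = G j x + s * (\<Sum>i<r. h i * Q j i x) + s\<^sup>2 * R"
        if j: "j < r" for j
      proof -
        obtain R where "G j (\<lambda>i. x i + s * h i) - G j x - s * (\<Sum>i<r. h i * Q j i x) = s\<^sup>2 * R"
          using Q(3)[OF j] by (rule dvdE)
        then show ?thesis by (intro exI[of _ R]) linarith
      qed
      then obtain R where R: "\<And>j. j < r \<Longrightarrow>
          G j (\<lambda>i. x i + s * h i) = G j x + s * (\<Sum>i<r. h i * Q j i x) + s\<^sup>2 * R j"
        by metis
      define D where "D j = (\<Sum>i<r. h i * Q j i x)" for j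
      have sw: "(\<Sum>i<r. h i * P i x) = (\<Sum>j<r. h j * G j x + x j * D j)"
      proof -
        have "(\<Sum>j<r. x j * D j) = (\<Sum>i<r. \<Sum>j<r. x j * (h i * Q j i x))"
          unfolding D_def sum_distrib_left by (rule sum.swap)
        then show ?thesis unfolding P_def by (simp add: algebra_simps sum.distrib sum_distrib_left)
      qed
      have "F (\<lambda>i. x i + s * h i) = (\<Sum>j<r. (x j + s * h j) * (G j x + s * D j + s\<^sup>2 * R j))"
        unfolding G(2) D_def using R by (intro sum.cong) auto
      also have "\<dots> = F x + s * (\<Sum>i<r. h i * P i x)
          + s\<^sup>2 * (\<Sum>j<r. (x j + s * h j) * R j + h j * D j)"
        unfolding sw G(2) sum_distrib_left sum.distrib[symmetric]
        by (intro sum.cong) (auto simp: algebra_simps power2_eq_square)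
      finally show ?thesis by simp
    qed
    ultimately show ?case by (intro exI[of _ P]) auto
  qed
  then show ?thesis using that by blast
qed

section \<open>From polynomials to forms as functions\<close>

lemma hform_mpol_eval:
  assumes "form n d P"
  shows "hform UNIV n d (mpol_eval P)"
proof -
  have "hform UNIV n d (\<lambda>x. Poly_Mapping.lookup P m *
      (\<Prod>i\<in>Poly_Mapping.keys m. x i ^ Poly_Mapping.lookup m i))"
    if "m \<in> Poly_Mapping.keys P" for m
  proof -
    have m: "Poly_Mapping.keys m \<subseteq> {..<n}" "(\<Sum>i\<in>Poly_Mapping.keys m. Poly_Mapping.lookup m i) = d"
      using assms that by (auto simp: form_def)
    have "hform UNIV n (\<Sum>i\<in>Poly_Mapping.keys m. Poly_Mapping.lookup m i)
        (\<lambda>x. \<Prod>i\<in>Poly_Mapping.keys m. x i ^ Poly_Mapping.lookup m i)"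
      using m(1) by (intro hform_prod hform_var_power) auto
    then have "hform UNIV n d (\<lambda>x. \<Prod>i\<in>Poly_Mapping.keys m. x i ^ Poly_Mapping.lookup m i)"
      unfolding m(2) .
    then show ?thesis by (rule hform_cmult) auto
  qed
  then show ?thesis unfolding mpol_eval_def[abs_def] by (rule hform_sum)
qed

section \<open>Small primes and small solutions of linear equations\<close>

text \<open>The second factor is $\int_0^1 x^a (1 - x)^b\, dx$.\<close>

lemma Lcm_harmonic_triangle:
  assumes "a + b + 1 \<le> n"
  shows "real (Lcm {1..n}) * (fact a * fact b / fact (a + b + 1)) \<in> \<int>"
  using assms
proof (induction b arbitrary: a)
  case 0
  have "a + 1 dvd Lcm {1..n}" using 0 by (intro dvd_Lcm) auto
  then obtain k where "Lcm {1..n} = (a + 1) * k" by (rule dvdE)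
  then have k: "real (Lcm {1..n}) = (real a + 1) * real k"
    by (simp add: algebra_simps)
  have "fact (a + 0 + 1) = (real a + 1) * fact a" by simp
  moreover have "(real a + 1) * real k * (f * 1 / ((real a + 1) * f)) = real k" if "f \<noteq> 0" for f
    using that by simp
  ultimately have "(real a + 1) * real k * (fact a * fact 0 / fact (a + 0 + 1)) = real k"
    unfolding fact_0 by (simp only: fact_nonzero not_False_eq_True)
  then show ?case unfolding k by simp
next
  case (Suc b)
  let ?L = "\<lambda>a b. (fact a * fact b / fact (a + b + 1) :: real)"
  \<comment> \<open>Under the integral sign this is
    \<open>x^a (1 - x)^(b + 1) = x^a (1 - x)^b - x^(a + 1) (1 - x)^b\<close>.\<close>
  have "?L a (Suc b) = ?L a b - ?L (Suc a) b"
  proof -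
    have aux: "A * ((y + 1) * B) / (M * N) = A * B / N - ((x + 1) * A) * B / (M * N)"
      if M: "M = x + y + 2" "M \<noteq> 0" and N: "N \<noteq> 0" for A B M N x y :: real
    proof -
      have "A * B / N = M * (A * B) / (M * N)" using M(2) N by simp
      also have "\<dots> - ((x + 1) * A) * B / (M * N) = (M * (A * B) - ((x + 1) * A) * B) / (M * N)"
        by (rule diff_divide_distrib[symmetric])
      also have "M * (A * B) - ((x + 1) * A) * B = A * ((y + 1) * B)"
        unfolding M(1) by (simp add: algebra_simps)
      finally show ?thesis by simp
    qed
    have e: "fact (a + Suc b + 1) = (real a + real b + 2) * fact (a + b + 1)"
      "fact (Suc a + b + 1) = (real a + real b + 2) * fact (a + b + 1)"
      "fact (Suc a) = (real a + 1) * fact a" "fact (Suc b) = (real b + 1) * fact b"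
      by (simp_all add: algebra_simps)
    have "real a + real b + 2 \<noteq> 0" "fact (a + b + 1) \<noteq> (0::real)"
      using of_nat_0_le_iff[of a, where 'a = real] of_nat_0_le_iff[of b, where 'a = real]
      by (linarith, simp)
    then show ?thesis unfolding e by (intro aux refl)
  qed
  then have "real (Lcm {1..n}) * ?L a (Suc b) =
      real (Lcm {1..n}) * ?L a b - real (Lcm {1..n}) * ?L (Suc a) b"
    by (simp add: right_diff_distrib)
  also have "\<dots> \<in> \<int>" using Suc.IH[of a] Suc.IH[of "Suc a"] Suc.prems by (intro Ints_diff) auto
  finally show ?case .
qed

text \<open>Nair's argument: the least common multiple times the integral of
  \<open>x^m (1 - x)^m\<close> is a positive integer, while \<open>x (1 - x) \<le> 1/4\<close> makes
  the integral at most \<open>4^(-m)\<close>. The induction on factorials takes the place of that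
  estimate.\<close>

lemma Lcm_lower_bound: "4 ^ m \<le> Lcm {1..2 * m + 1 :: nat}"
proof -
  have "(4 ^ m :: real) * (fact m * fact m) \<le> fact (2 * m + 1)"
  proof (induction m)
    case (Suc m)
    have "(4 ^ Suc m :: real) * (fact (Suc m) * fact (Suc m)) =
        (4 * (real m + 1)\<^sup>2) * (4 ^ m * (fact m * fact m))"
      by (simp add: power2_eq_square algebra_simps)
    also have "\<dots> \<le> ((2 * real m + 3) * (2 * real m + 2)) * fact (2 * m + 1)"
      using Suc by (rule mult_mono[rotated]) (simp_all add: power2_eq_square algebra_simps)
    also have "\<dots> = fact (2 * Suc m + 1)" by (simp add: algebra_simps)
    finally show ?case .
  qed auto
  then have "(4 ^ m :: real) * (fact m * fact m) / fact (m + m + 1) \<le> 1"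
    unfolding mult_2 by (subst divide_le_eq_1_pos) auto
  then have 1: "(4 ^ m :: real) * (fact m * fact m / fact (m + m + 1)) \<le> 1"
    unfolding times_divide_eq_right .
  let ?x = "real (Lcm {1..2 * m + 1}) * (fact m * fact m / fact (m + m + 1))"
  have int: "?x \<in> \<int>" by (rule Lcm_harmonic_triangle) auto
  have "Lcm {1..2 * m + 1 :: nat} \<noteq> 0" by (subst Lcm_0_iff) auto
  then have "0 < Lcm {1..2 * m + 1 :: nat}" by blast
  then have pos: "0 < ?x" by (intro mult_pos_pos divide_pos_pos fact_gt_zero) (simp only: of_nat_0_less_iff)
  have "1 \<le> ?x" using Ints_nonzero_abs_ge1[OF int] pos by linarith
  with 1 have "(4 ^ m :: real) * (fact m * fact m / fact (m + m + 1)) \<le> ?x" by linarith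
  then have "(4 ^ m :: real) \<le> real (Lcm {1..2 * m + 1})"
    by (rule mult_right_le_imp_le) simp
  then have "real (4 ^ m) \<le> real (Lcm {1..2 * m + 1})" by simp
  then show ?thesis by (simp only: of_nat_le_iff)
qed

text \<open>Counted with multiplicity, \<open>i\<close> has fewer than \<open>k\<close> prime
  factors, and each of them divides \<open>m\<close>.\<close>

lemma dvd_power_of_prime_divisors:
  fixes i m :: nat
  assumes "0 < i" "i < 2 ^ k" "\<And>p. prime p \<Longrightarrow> p dvd i \<Longrightarrow> p dvd m"
  shows "i dvd m ^ k"
  using assms
proof (induction k arbitrary: i)
  case (Suc k)
  show ?case
  proof (cases "i = 1")
    case False
    then obtain p where p: "prime p" "p dvd i" using prime_factor_nat by blast
    then obtain j where j: "i = p * j" by auto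
    have "2 \<le> p" using p(1) by (rule prime_ge_2_nat)
    then have "2 * j \<le> i" unfolding j by simp
    then have "j < 2 ^ k" using Suc.prems(2) by simp
    then have "j dvd m ^ k" using Suc.prems j by (intro Suc.IH) auto
    then show ?thesis unfolding j power_Suc using Suc.prems(3)[OF p] by (rule mult_dvd_mono[rotated])
  qed auto
qed auto

lemma two_square_less_power: "2 * s\<^sup>2 + 1 < (2::nat) ^ (s + 3)"
proof (induction s)
  case (Suc s)
  have "2 * s < (2::nat) ^ (s + 2)"
    by (induction s) auto
  then show ?case using Suc by (simp add: power2_eq_square power_add algebra_simps)
qed auto

text \<open>If \<open>M\<close> were divisible by all primes up to \<open>N = 2 * s^2 + 1\<close>,
  then every positive \<open>i \<le> N\<close> would divide \<open>M ^ (s + 3)\<close>, hence so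
  would their least common multiple, which is at least \<open>4 ^ (s^2)\<close>. For
  \<open>s\<close> slightly above \<open>4 * c * ln E\<close> this contradicts the size of
  \<open>M\<close>. Stronger prime number estimates would save only powers of
  \<open>ln E\<close>.\<close>

lemma small_prime_not_dvd:
  "\<exists>C\<ge>0. \<forall>E\<ge>3. \<forall>M::nat. 0 < M \<longrightarrow> real M \<le> E ^ c \<longrightarrow>
     (\<exists>p. prime p \<and> \<not> p dvd M \<and> real p \<le> C * (ln E)\<^sup>2)"
proof (intro exI[of _ "3 * (4 * real c + 3)\<^sup>2"] conjI allI impI)
  fix E :: real and M :: nat
  assume E: "3 \<le> E" and M: "0 < M" "real M \<le> E ^ c"
  have lnE: "1 \<le> ln E" using E exp_le by (subst ln_ge_iff) auto
  \<comment> \<open>The factor \<open>4\<close> pays for \<open>s + 3 \<le> 4 * s\<close>.\<close>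
  define s where "s = nat \<lceil>4 * real c * ln E\<rceil> + 1"
  have s: "4 * real c * ln E < real s" "real s \<le> (4 * real c + 3) * ln E" "1 \<le> s"
  proof -
    have "0 \<le> 4 * real c * ln E" using lnE by simp
    then show "4 * real c * ln E < real s" unfolding s_def by linarith
    have "real s \<le> 4 * real c * ln E + 2" unfolding s_def using \<open>0 \<le> _\<close> by linarith
    then show "real s \<le> (4 * real c + 3) * ln E" using lnE by (simp add: algebra_simps)
  qed (simp add: s_def)
  have "\<exists>p. prime p \<and> \<not> p dvd M \<and> p \<le> 2 * s\<^sup>2 + 1"
  proof (rule ccontr)
    assume no: "\<not> ?thesis"
    have "i dvd M ^ (s + 3)" if "i \<in> {1..2 * s\<^sup>2 + 1}" for i
    proof (rule dvd_power_of_prime_divisors)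
      show "i < 2 ^ (s + 3)" using that two_square_less_power[of s] by simp
      show "p dvd M" if "prime p" "p dvd i" for p
        using no that \<open>i \<in> _\<close> dvd_imp_le[OF that(2)] by auto
    qed (use that in auto)
    then have "Lcm {1..2 * s\<^sup>2 + 1} dvd M ^ (s + 3)" by (rule Lcm_least)
    then have "4 ^ s\<^sup>2 \<le> M ^ (s + 3)" using M(1) Lcm_lower_bound[of "s\<^sup>2"]
      by (meson dvd_imp_le order.trans zero_less_power)
    then have "(4::real) ^ s\<^sup>2 \<le> real M ^ (s + 3)"
      by (metis of_nat_le_iff of_nat_numeral of_nat_power)
    also have "\<dots> \<le> (E ^ c) ^ (s + 3)" using M by (intro power_mono) auto
    finally have "ln ((4::real) ^ s\<^sup>2) \<le> ln ((E ^ c) ^ (s + 3))" using E by (subst ln_le_cancel_iff) auto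
    then have "real (s\<^sup>2) * ln 4 \<le> real (s + 3) * (real c * ln E)" using E by (simp add: ln_realpow)
    also have "\<dots> \<le> real (4 * s) * (real c * ln E)" using s(3) lnE by (intro mult_right_mono) auto
    also have "\<dots> = real s * (4 * real c * ln E)" by simp
    also have "\<dots> < real s * real s" using s by (intro mult_strict_left_mono) auto
    finally have "real (s\<^sup>2) * ln 4 < real (s\<^sup>2) * 1" by (simp add: power2_eq_square)
    moreover have "(1::real) \<le> ln 4" using exp_le by (subst ln_ge_iff) auto
    then have "real (s\<^sup>2) * 1 \<le> real (s\<^sup>2) * ln 4" by (intro mult_left_mono) auto
    ultimately show False by linarith
  qed
  then obtain p where p: "prime p" "\<not> p dvd M" "p \<le> 2 * s\<^sup>2 + 1" by blast
  have "real p \<le> real (2 * s\<^sup>2 + 1)" using p(3) by (simp only: of_nat_le_iff)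
  also have "\<dots> \<le> 3 * (real s)\<^sup>2" using s(3) by simp
  also have "\<dots> \<le> 3 * ((4 * real c + 3) * ln E)\<^sup>2" using s(2) by (intro mult_left_mono power_mono) auto
  finally have "real p \<le> 3 * (4 * real c + 3)\<^sup>2 * (ln E)\<^sup>2" by (simp add: power_mult_distrib)
  with p show "\<exists>p. prime p \<and> \<not> p dvd M \<and> real p \<le> 3 * (4 * real c + 3)\<^sup>2 * (ln E)\<^sup>2" by blast
qed auto

text \<open>Siegel's lemma by elimination. The additional functional \<open>l\<close> is carried along so that the small
  form obtained in \<open>small_form\<close> is nonzero as a function, at a prescribed point.\<close>

lemma small_solution:
  "\<exists>c::nat. \<forall>(Q::int) W (I::'a set) a l g. 2 \<le> Q \<longrightarrow> finite W \<longrightarrow> card (W::'b set) = m \<longrightarrow>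
     (\<forall>i\<in>I. \<forall>w\<in>W. \<bar>a i w\<bar> \<le> Q) \<longrightarrow> (\<forall>w\<in>W. \<bar>l w\<bar> \<le> Q) \<longrightarrow>
     (\<forall>i\<in>I. (\<Sum>w\<in>W. a i w * g w) = 0) \<longrightarrow> (\<Sum>w\<in>W. l w * g w) \<noteq> 0 \<longrightarrow>
     (\<exists>h. (\<forall>w\<in>W. \<bar>h w\<bar> \<le> Q ^ c) \<and> (\<forall>i\<in>I. (\<Sum>w\<in>W. a i w * h w) = 0) \<and>
        (\<Sum>w\<in>W. l w * h w) \<noteq> 0)"
proof (induction m)
  case 0
  then show ?case by (intro exI[of _ 0]) auto
next
  case (Suc m)
  then obtain c where c0: "\<forall>(Q::int) W (I::'a set) a l g. 2 \<le> Q \<longrightarrow> finite W \<longrightarrow> card (W::'b set) = m \<longrightarrow>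
     (\<forall>i\<in>I. \<forall>w\<in>W. \<bar>a i w\<bar> \<le> Q) \<longrightarrow> (\<forall>w\<in>W. \<bar>l w\<bar> \<le> Q) \<longrightarrow>
     (\<forall>i\<in>I. (\<Sum>w\<in>W. a i w * g w) = 0) \<longrightarrow> (\<Sum>w\<in>W. l w * g w) \<noteq> 0 \<longrightarrow>
     (\<exists>h. (\<forall>w\<in>W. \<bar>h w\<bar> \<le> Q ^ c) \<and> (\<forall>i\<in>I. (\<Sum>w\<in>W. a i w * h w) = 0) \<and>
        (\<Sum>w\<in>W. l w * h w) \<noteq> 0)" ..
  note c = c0[THEN spec, THEN spec, THEN spec, THEN spec, THEN spec, THEN spec,
      THEN mp, THEN mp, THEN mp, THEN mp, THEN mp, THEN mp, THEN mp]
  show ?case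
  \<comment> \<open>Elimination raises the entries to size \<open>Q ^ 3\<close>, so the smaller
    system has a solution of size \<open>Q ^ (3 * c)\<close>. Back substitution sums
    \<open>m\<close> products with one more factor \<open>Q\<close>, and
    \<open>m \<le> Q ^ m\<close>.\<close>
  proof (intro exI[of _ "3 * c + m + 1"] allI impI)
    fix Q :: int and W :: "'b set" and I :: "'a set" and a l g
    assume Q: "2 \<le> Q" and W: "finite W" "card W = Suc m"
      and a: "\<forall>i\<in>I. \<forall>w\<in>W. \<bar>a i w\<bar> \<le> Q" and l: "\<forall>w\<in>W. \<bar>l w\<bar> \<le> Q"
      and g: "\<forall>i\<in>I. (\<Sum>w\<in>W. a i w * g w) = 0" "(\<Sum>w\<in>W. l w * g w) \<noteq> 0"
    obtain w0 where w0: "w0 \<in> W" using W by fastforce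
    define W' where "W' = W - {w0}"
    have W': "finite W'" "card W' = m" "W' \<subseteq> W" "w0 \<notin> W'" using W w0 by (auto simp: W'_def)
    have split: "(\<Sum>w\<in>W. f w) = f w0 + (\<Sum>w\<in>W'. f w)" for f :: "'b \<Rightarrow> int"
      unfolding W'_def using W(1) w0 by (rule sum.remove)
    show "\<exists>h. (\<forall>w\<in>W. \<bar>h w\<bar> \<le> Q ^ (3 * c + m + 1)) \<and> (\<forall>i\<in>I. (\<Sum>w\<in>W. a i w * h w) = 0) \<and>
        (\<Sum>w\<in>W. l w * h w) \<noteq> 0"
    proof (cases "\<forall>i\<in>I. a i w0 = 0")
      case True
      show ?thesis
      proof (cases "l w0 = 0")
        case False
        have "(\<Sum>w\<in>W'. f w * (if w = w0 then 1 else 0)) = 0" for f :: "'b \<Rightarrow> int"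
          using W'(4) by (intro sum.neutral) auto
        moreover have "1 \<le> Q ^ (3 * c + m + 1)" using Q by (intro one_le_power) auto
        ultimately show ?thesis using False True Q
          by (intro exI[of _ "\<lambda>w. if w = w0 then 1 else 0"]) (auto simp: split)
      next
        case l0: True
        have "\<exists>h. (\<forall>w\<in>W'. \<bar>h w\<bar> \<le> Q ^ c) \<and> (\<forall>i\<in>I. (\<Sum>w\<in>W'. a i w * h w) = 0) \<and>
          (\<Sum>w\<in>W'. l w * h w) \<noteq> 0"
          using W' a l g True l0 Q by (intro c[of Q W' I a l g]) (auto simp: split)
        then obtain h where h: "\<forall>w\<in>W'. \<bar>h w\<bar> \<le> Q ^ c" "\<forall>i\<in>I. (\<Sum>w\<in>W'. a i w * h w) = 0"
          "(\<Sum>w\<in>W'. l w * h w) \<noteq> 0" by blast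
        define k where "k w = (if w = w0 then 0 else h w)" for w
        have e: "(\<Sum>w\<in>W'. f w * k w) = (\<Sum>w\<in>W'. f w * h w)" for f
          using W'(4) by (intro sum.cong) (auto simp: k_def)
        have "\<bar>k w\<bar> \<le> Q ^ (3 * c + m + 1)" if "w \<in> W" for w
        proof (cases "w = w0")
          case False
          then have "\<bar>h w\<bar> \<le> Q ^ c" using h that by (auto simp: W'_def)
          also have "\<dots> \<le> Q ^ (3 * c + m + 1)" using Q by (intro power_increasing) auto
          finally show ?thesis using False by (simp add: k_def)
        qed (use Q in \<open>auto simp: k_def\<close>)
        moreover have "k w0 = 0" by (simp add: k_def)
        ultimately show ?thesis using h(2,3) True l0
          by (intro exI[of _ k]) (simp add: split e)
      qed
    next
      case False
      then obtain i0 where i0: "i0 \<in> I" "a i0 w0 \<noteq> 0" by blast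
      let ?\<alpha> = "a i0 w0"
      \<comment> \<open>Equation \<open>i0\<close> eliminates \<open>w0\<close>, cross-multiplied to
        stay integral. Reducing \<open>l\<close> in the same way multiplies its value on solutions
        by \<open>?\<alpha>\<close>, which is nonzero.\<close>
      let ?a = "\<lambda>i w. ?\<alpha> * a i w - a i w0 * a i0 w"
      let ?l = "\<lambda>w. ?\<alpha> * l w - l w0 * a i0 w"
      have Q3: "Q * Q + Q * Q \<le> Q ^ 3"
      proof -
        have "Q * Q + Q * Q = 2 * (Q * Q)" by simp
        also have "\<dots> \<le> Q * (Q * Q)" using Q by (intro mult_right_mono) auto
        finally show ?thesis by (simp add: power3_eq_cube)
      qed
      have bd: "\<bar>x * y - x' * y'\<bar> \<le> Q ^ 3" if "\<bar>x\<bar> \<le> Q" "\<bar>y\<bar> \<le> Q" "\<bar>x'\<bar> \<le> Q" "\<bar>y'\<bar> \<le> Q" for x y x' y' :: int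
      proof -
        have "\<bar>x * y\<bar> \<le> Q * Q" "\<bar>x' * y'\<bar> \<le> Q * Q"
          unfolding abs_mult using that by (auto intro!: mult_mono)
        then show ?thesis using Q3 by linarith
      qed
      have ag: "(\<Sum>w\<in>W'. a i0 w * g w) = - ?\<alpha> * g w0"
        using g(1) i0(1) by (auto simp: split)
      have lin: "(\<Sum>w\<in>W'. (?\<alpha> * f w - f w0 * a i0 w) * h w) =
          ?\<alpha> * (\<Sum>w\<in>W'. f w * h w) - f w0 * (\<Sum>w\<in>W'. a i0 w * h w)" for f h
        by (simp add: sum_distrib_left sum_subtractf algebra_simps)
      have "\<exists>h. (\<forall>w\<in>W'. \<bar>h w\<bar> \<le> (Q ^ 3) ^ c) \<and> (\<forall>i\<in>I. (\<Sum>w\<in>W'. ?a i w * h w) = 0) \<and>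
          (\<Sum>w\<in>W'. ?l w * h w) \<noteq> 0"
      proof (rule c[of "Q ^ 3" W' I ?a ?l g])
        show "2 \<le> Q ^ 3" using Q self_le_power[of Q 3] by linarith
        show "\<forall>i\<in>I. \<forall>w\<in>W'. \<bar>?a i w\<bar> \<le> Q ^ 3" using a i0 w0 W'(3) by (auto intro!: bd)
        show "\<forall>w\<in>W'. \<bar>?l w\<bar> \<le> Q ^ 3" using a l i0 w0 W'(3) by (auto intro!: bd)
        have "(\<Sum>w\<in>W'. ?a i w * g w) = ?\<alpha> * (\<Sum>w\<in>W. a i w * g w)" for i
          unfolding lin ag split by (simp add: algebra_simps)
        then show "\<forall>i\<in>I. (\<Sum>w\<in>W'. ?a i w * g w) = 0" using g(1) by simp
        have "(\<Sum>w\<in>W'. ?l w * g w) = ?\<alpha> * (\<Sum>w\<in>W. l w * g w)"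
          unfolding lin ag split by (simp add: algebra_simps)
        then show "(\<Sum>w\<in>W'. ?l w * g w) \<noteq> 0" using g(2) i0(2) by simp
      qed (use W' in auto)
      then obtain h where h: "\<And>w. w\<in>W' \<Longrightarrow> \<bar>h w\<bar> \<le> (Q ^ 3) ^ c"
        "\<And>i. i \<in> I \<Longrightarrow> (\<Sum>w\<in>W'. ?a i w * h w) = 0" "(\<Sum>w\<in>W'. ?l w * h w) \<noteq> 0" by blast
      \<comment> \<open>Back substitution: the solution is scaled by \<open>?\<alpha>\<close> so
        that equation \<open>i0\<close> can be solved for \<open>w0\<close> without
        division.\<close>
      define k where "k w = (if w = w0 then - (\<Sum>w\<in>W'. a i0 w * h w) else ?\<alpha> * h w)" for w
      have k: "(\<Sum>w\<in>W. f w * k w) = (\<Sum>w\<in>W'. (?\<alpha> * f w - f w0 * a i0 w) * h w)" for f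
      proof -
        have "(\<Sum>w\<in>W'. f w * k w) = ?\<alpha> * (\<Sum>w\<in>W'. f w * h w)"
          unfolding sum_distrib_left using W'(4) by (intro sum.cong) (auto simp: k_def)
        then show ?thesis unfolding split lin by (simp add: k_def)
      qed
      have ah: "\<bar>a i0 w' * h w\<bar> \<le> Q ^ (3 * c + 1)" if "w \<in> W'" "w' \<in> W" for w w'
      proof -
        have "\<bar>a i0 w' * h w\<bar> \<le> Q * (Q ^ 3) ^ c"
          unfolding abs_mult using a i0 that h(1) Q by (intro mult_mono) auto
        then show ?thesis by (simp add: power_mult)
      qed
      have m: "int m \<le> Q ^ m"
      proof -
        have "int m \<le> 2 ^ m" using less_exp[of m] by (simp add: of_nat_less_two_power less_imp_le)
        also have "\<dots> \<le> Q ^ m" using Q by (intro power_mono) auto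
        finally show ?thesis .
      qed
      have "\<bar>k w\<bar> \<le> Q ^ (3 * c + m + 1)" if "w \<in> W" for w
      proof (cases "w = w0")
        case True
        have "\<bar>k w\<bar> \<le> (\<Sum>w\<in>W'. \<bar>a i0 w * h w\<bar>)" unfolding k_def using True by auto
        also have "\<dots> \<le> (\<Sum>w\<in>W'. Q ^ (3 * c + 1))" using ah W'(3) by (intro sum_mono) auto
        also have "\<dots> = int m * Q ^ (3 * c + 1)" using W' by simp
        also have "\<dots> \<le> Q ^ m * Q ^ (3 * c + 1)" using m Q by (intro mult_right_mono) auto
        finally show ?thesis by (simp add: power_add mult_ac)
      next
        case False
        then have "\<bar>k w\<bar> \<le> Q ^ (3 * c + 1)" using ah[of w w0] w0 that by (auto simp: k_def W'_def)
        also have "\<dots> \<le> Q ^ (3 * c + m + 1)" using Q by (intro power_increasing) auto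
        finally show ?thesis .
      qed
      then show ?thesis using h(2,3) by (intro exI[of _ k]) (auto simp: k)
    qed
  qed
qed

text \<open>Noncommutative monomials: splitting off the first letter matches the recursion of
  \<open>hform\<close>.\<close>

definition words :: "nat \<Rightarrow> nat \<Rightarrow> nat list set" where
  "words r d = {w. set w \<subseteq> {..<r} \<and> length w = d}"

lemma finite_words: "finite (words r d)"
  unfolding words_def by (rule finite_lists_length_eq) simp

lemma sum_words_Suc: "(\<Sum>w\<in>words r (Suc d). f w) = (\<Sum>i<r. \<Sum>w\<in>words r d. f (i # w))"
proof -
  have "(\<Sum>i<r. \<Sum>w\<in>words r d. f (i # w)) = (\<Sum>(i, w)\<in>{..<r} \<times> words r d. f (i # w))"
    by (rule sum.cartesian_product)
  also have "\<dots> = (\<Sum>w\<in>words r (Suc d). f w)"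
    by (rule sum.reindex_bij_witness[of _ "\<lambda>w. (hd w, tl w)" "\<lambda>(i, w). i # w"])
      (auto simp: words_def length_Suc_conv)
  finally show ?thesis by simp
qed

lemma words_0: "words r 0 = {[]}"
  by (auto simp: words_def)

lemma hform_words:
  assumes "hform UNIV r d F"
  obtains g where "F = (\<lambda>x. \<Sum>w\<in>words r d. prod_list (map x w) * g w)"
  using assms
proof (induction d arbitrary: F thesis)
  case 0
  then obtain c where "F = (\<lambda>_. c)" by auto
  then show ?case using 0(1)[of "\<lambda>_. c"] by (simp add: words_0)
next
  case (Suc d)
  then obtain G where G: "\<forall>i<r. hform UNIV r d (G i)" "F = (\<lambda>x. \<Sum>i<r. x i * G i x)"
    by auto
  have "\<forall>i<r. \<exists>g. G i = (\<lambda>x. \<Sum>w\<in>words r d. prod_list (map x w) * g w)"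
    using Suc.IH G(1) by metis
  then obtain g where g: "\<And>i. i < r \<Longrightarrow> G i = (\<lambda>x. \<Sum>w\<in>words r d. prod_list (map x w) * g i w)"
    by metis
  have "F = (\<lambda>x. \<Sum>w\<in>words r (Suc d). prod_list (map x w) * g (hd w) (tl w))"
    unfolding G(2) sum_words_Suc using g
    by (auto simp: sum_distrib_left mult.assoc intro!: sum.cong)
  then show ?case by (rule Suc.prems(1))
qed

lemma words_hform:
  assumes "\<And>w. w \<in> words r d \<Longrightarrow> g w \<in> K"
  shows "hform K r d (\<lambda>x. \<Sum>w\<in>words r d. prod_list (map x w) * g w)"
  using assms
proof (induction d arbitrary: g)
  case 0
  then show ?case by (auto simp: words_0)
next
  case (Suc d)
  have "\<forall>i<r. hform K r d (\<lambda>x. \<Sum>w\<in>words r d. prod_list (map x w) * g (i # w))"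
  proof (intro allI impI)
    fix i assume "i < r"
    show "hform K r d (\<lambda>x. \<Sum>w\<in>words r d. prod_list (map x w) * g (i # w))"
      by (rule Suc.IH[of "\<lambda>w. g (i # w)"]) (rule Suc.prems, use \<open>i < r\<close> in \<open>auto simp: words_def\<close>)
  qed
  then show ?case unfolding sum_words_Suc hform.simps
    by (intro exI[of _ "\<lambda>i x. \<Sum>w\<in>words r d. prod_list (map x w) * g (i # w)"])
      (auto simp: sum_distrib_left mult.assoc)
qed

lemma abs_prod_list_le:
  fixes x :: "nat \<Rightarrow> int"
  assumes "set w \<subseteq> {..<r}" "\<And>i. i < r \<Longrightarrow> \<bar>x i\<bar> \<le> X"
  shows "\<bar>prod_list (map x w)\<bar> \<le> X ^ length w"
  using assms(1)
proof (induction w)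
  case (Cons i w)
  then show ?case using assms(2)[of i] by (auto simp: abs_mult intro!: mult_mono)
qed auto

text \<open>Vanishing at the points is a system of linear equations for the coefficients, solved by
  those of \<open>F\<close>. The value at \<open>z\<close> is the functional carried along through
  the elimination.\<close>

lemma small_form:
  "\<exists>c. \<forall>E I (X :: 'a \<Rightarrow> nat \<Rightarrow> int) F z. 3 \<le> E \<longrightarrow> hform UNIV r d F \<longrightarrow>
     (\<forall>a\<in>I. \<forall>i<r. \<bar>X a i\<bar> \<le> E) \<longrightarrow> (\<forall>a\<in>I. F (X a) = 0) \<longrightarrow>
     (\<forall>i<r. 0 \<le> z i \<and> z i \<le> int d) \<longrightarrow> F z \<noteq> 0 \<longrightarrow>
     (\<exists>G. hform {-(E ^ c)..E ^ c} r d G \<and> (\<forall>a\<in>I. G (X a) = 0) \<and> G z \<noteq> 0)"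
proof -
  obtain c where c0: "\<forall>(Q::int) W (I::'a set) a l g. 2 \<le> Q \<longrightarrow> finite W \<longrightarrow>
     card (W::nat list set) = card (words r d) \<longrightarrow>
     (\<forall>i\<in>I. \<forall>w\<in>W. \<bar>a i w\<bar> \<le> Q) \<longrightarrow> (\<forall>w\<in>W. \<bar>l w\<bar> \<le> Q) \<longrightarrow>
     (\<forall>i\<in>I. (\<Sum>w\<in>W. a i w * g w) = 0) \<longrightarrow> (\<Sum>w\<in>W. l w * g w) \<noteq> 0 \<longrightarrow>
     (\<exists>h. (\<forall>w\<in>W. \<bar>h w\<bar> \<le> Q ^ c) \<and> (\<forall>i\<in>I. (\<Sum>w\<in>W. a i w * h w) = 0) \<and>
        (\<Sum>w\<in>W. l w * h w) \<noteq> 0)"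
    using small_solution[of "card (words r d)", where 'a = 'a and 'b = "nat list"] ..
  note c = c0[THEN spec, THEN spec, THEN spec, THEN spec, THEN spec, THEN spec,
      THEN mp, THEN mp, THEN mp, THEN mp, THEN mp, THEN mp, THEN mp]
  show ?thesis
  \<comment> \<open>The coordinates of \<open>z\<close> are bounded by \<open>d \<le> E ^ d\<close>,
    so a word of length \<open>d\<close> has a value up to \<open>E ^ (d * d)\<close> at
    \<open>z\<close>; the extra \<open>1\<close> keeps the bound on the entries at least
    \<open>2\<close> when \<open>d = 0\<close>.\<close>
  proof (intro exI[of _ "(d * d + 1) * c"] allI impI)
    fix E I and X :: "'a \<Rightarrow> nat \<Rightarrow> int" and F z
    assume E: "3 \<le> E" and F: "hform UNIV r d F" and X: "\<forall>a\<in>I. \<forall>i<r. \<bar>X a i\<bar> \<le> E"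
      "\<forall>a\<in>I. F (X a) = 0" and z: "\<forall>i<r. 0 \<le> z i \<and> z i \<le> int d" "F z \<noteq> 0"
    obtain g where g: "F = (\<lambda>x. \<Sum>w\<in>words r d. prod_list (map x w) * g w)"
      using hform_words[OF F] .
    have d: "d \<le> d * d + 1" by (cases d) auto
    have dE: "int d \<le> E ^ d"
    proof -
      have "int d \<le> 2 ^ d" using less_exp[of d] by (simp add: of_nat_less_two_power less_imp_le)
      also have "\<dots> \<le> E ^ d" using E by (intro power_mono) auto
      finally show ?thesis .
    qed
    have "\<exists>h. (\<forall>w\<in>words r d. \<bar>h w\<bar> \<le> (E ^ (d * d + 1)) ^ c) \<and>
       (\<forall>a\<in>I. (\<Sum>w\<in>words r d. prod_list (map (X a) w) * h w) = 0) \<and>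
        (\<Sum>w\<in>words r d. prod_list (map z w) * h w) \<noteq> 0"
    proof (rule c[of "E ^ (d * d + 1)" "words r d" I "\<lambda>a w. prod_list (map (X a) w)" "\<lambda>w. prod_list (map z w)" g])
      show "2 \<le> E ^ (d * d + 1)" using E self_le_power[of E "d * d + 1"] by linarith
      show "\<forall>i\<in>I. \<forall>w\<in>words r d. \<bar>prod_list (map (X i) w)\<bar> \<le> E ^ (d * d + 1)"
      proof (intro ballI)
        fix a w assume aw: "a \<in> I" "w \<in> words r d"
        have "\<bar>prod_list (map (X a) w)\<bar> \<le> E ^ length w"
          using aw X by (intro abs_prod_list_le) (auto simp: words_def)
        also have "\<dots> \<le> E ^ (d * d + 1)"
          using aw E d by (intro power_increasing) (auto simp: words_def)
        finally show "\<bar>prod_list (map (X a) w)\<bar> \<le> E ^ (d * d + 1)" .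
      qed
      show "\<forall>w\<in>words r d. \<bar>prod_list (map z w)\<bar> \<le> E ^ (d * d + 1)"
      proof (intro ballI)
        fix w assume aw: "w \<in> words r d"
        have "\<bar>prod_list (map z w)\<bar> \<le> (E ^ d) ^ length w"
        proof (rule abs_prod_list_le[where r = r])
          show "\<bar>z i\<bar> \<le> E ^ d" if "i < r" for i using z(1) dE that by fastforce
        qed (use aw in \<open>auto simp: words_def\<close>)
        also have "\<dots> \<le> E ^ (d * d + 1)" unfolding power_mult[symmetric]
          using aw E by (intro power_increasing) (auto simp: words_def)
        finally show "\<bar>prod_list (map z w)\<bar> \<le> E ^ (d * d + 1)" .
      qed
      show "\<forall>i\<in>I. (\<Sum>w\<in>words r d. prod_list (map (X i) w) * g w) = 0" using X(2) unfolding g by auto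
      show "(\<Sum>w\<in>words r d. prod_list (map z w) * g w) \<noteq> 0" using z(2) unfolding g by auto
    qed (auto simp: finite_words)
    then obtain h where h: "\<forall>w\<in>words r d. \<bar>h w\<bar> \<le> (E ^ (d * d + 1)) ^ c"
       "\<forall>a\<in>I. (\<Sum>w\<in>words r d. prod_list (map (X a) w) * h w) = 0"
       "(\<Sum>w\<in>words r d. prod_list (map z w) * h w) \<noteq> 0" by blast
    have "hform {-(E ^ ((d * d + 1) * c))..E ^ ((d * d + 1) * c)} r d
        (\<lambda>x. \<Sum>w\<in>words r d. prod_list (map x w) * h w)"
    proof (rule words_hform)
      fix w assume "w \<in> words r d"
      then have "\<bar>h w\<bar> \<le> E ^ ((d * d + 1) * c)" using h(1) by (simp only: power_mult)
      then show "h w \<in> {-(E ^ ((d * d + 1) * c))..E ^ ((d * d + 1) * c)}"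
        unfolding atLeastAtMost_iff by linarith
    qed
    with h(2,3) show "\<exists>G. hform {-(E ^ ((d * d + 1) * c))..E ^ ((d * d + 1) * c)} r d G \<and>
        (\<forall>a\<in>I. G (X a) = 0) \<and> G z \<noteq> 0" by blast
  qed
qed

section \<open>Determinants\<close>

definition detf :: "nat \<Rightarrow> (nat \<Rightarrow> nat \<Rightarrow> int) \<Rightarrow> int" where
  "detf r v = det (mat r r (\<lambda>(i, j). v i j))"

section \<open>Leibniz formula, products and Cramer's rule\<close>

lemma detf_cong:
  assumes "\<And>i j. i < r \<Longrightarrow> j < r \<Longrightarrow> v i j = w i j"
  shows "detf r v = detf r w"
proof -
  have "mat r r (\<lambda>(i, j). v i j) = mat r r (\<lambda>(i, j). w i j)" using assms by auto
  then show ?thesis by (simp add: detf_def)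
qed

lemma detf_leibniz:
  "detf r v = (\<Sum>p | p permutes {0..<r}. signof p * (\<Prod>i = 0..<r. v i (p i)))"
proof -
  have "detf r v = (\<Sum>p | p permutes {0..<r}. signof p *
      (\<Prod>i = 0..<r. mat r r (\<lambda>(i, j). v i j) $$ (i, p i)))"
    unfolding detf_def by (rule det_def') simp
  also have "\<dots> = (\<Sum>p | p permutes {0..<r}. signof p * (\<Prod>i = 0..<r. v i (p i)))"
  proof (intro sum.cong refl arg_cong2[where f = "(*)"] prod.cong)
    fix p i assume "p \<in> {p. p permutes {0..<r}}" "i \<in> {0..<r}"
    then have "p i < r" "i < r" using permutes_in_image[of p "{0..<r}" i] by auto
    then show "mat r r (\<lambda>(i, j). v i j) $$ (i, p i) = v i (p i)" by simp
  qed
  finally show ?thesis .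
qed

lemma detf_scale:
  "detf r (\<lambda>i j. e i * v i j * f j) = (\<Prod>i<r. e i) * (\<Prod>j<r. f j) * detf r v"
proof -
  have "(\<Prod>i = 0..<r. e i * v i (p i) * f (p i)) =
      (\<Prod>i<r. e i) * (\<Prod>j<r. f j) * (\<Prod>i = 0..<r. v i (p i))" if "p permutes {0..<r}" for p
  proof -
    have "(\<Prod>i = 0..<r. f (p i)) = (\<Prod>j = 0..<r. f j)"
      using prod.permute[OF that, of f] by (simp add: comp_def)
    then show ?thesis by (simp add: prod.distrib lessThan_atLeast0 mult_ac)
  qed
  then show ?thesis unfolding detf_leibniz sum_distrib_left
    by (intro sum.cong) (auto simp: mult_ac)
qed

lemma detf_bound:
  assumes "\<And>i j. i < r \<Longrightarrow> j < r \<Longrightarrow> \<bar>real_of_int (v i j)\<bar> \<le> B j"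
  shows "\<bar>real_of_int (detf r v)\<bar> \<le> fact r * (\<Prod>j<r. B j)"
proof -
  have "\<bar>real_of_int (signof p * (\<Prod>i = 0..<r. v i (p i)))\<bar> \<le> (\<Prod>j<r. B j)" if "p permutes {0..<r}" for p
  proof -
    have "\<bar>real_of_int (signof p * (\<Prod>i = 0..<r. v i (p i)))\<bar> = (\<Prod>i = 0..<r. \<bar>real_of_int (v i (p i))\<bar>)"
      by (simp add: abs_mult abs_prod sign_def)
    also have "\<dots> \<le> (\<Prod>i = 0..<r. B (p i))"
    proof (intro prod_mono conjI)
      fix i assume "i \<in> {0..<r}"
      then have "p i < r" "i < r" using that permutes_in_image[of p "{0..<r}" i] by auto
      then show "\<bar>real_of_int (v i (p i))\<bar> \<le> B (p i)" by (rule assms[rotated])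
    qed auto
    also have "\<dots> = (\<Prod>j<r. B j)"
      using prod.permute[OF that, of B] by (simp add: comp_def lessThan_atLeast0)
    finally show ?thesis .
  qed
  then have "\<bar>real_of_int (detf r v)\<bar> \<le> (\<Sum>p | p permutes {0..<r}. (\<Prod>j<r. B j))"
    unfolding detf_leibniz of_int_sum by (intro order.trans[OF sum_abs] sum_mono) auto
  also have "\<dots> = fact r * (\<Prod>j<r. B j)" by (simp add: card_permutations)
  finally show ?thesis .
qed

lemma detf_mult:
  "detf r (\<lambda>i j. \<Sum>k<r. a i k * b k j) = detf r a * detf r b"
proof -
  have "mat r r (\<lambda>(i, j). \<Sum>k<r. a i k * b k j) =
      mat r r (\<lambda>(i, j). a i j) * mat r r (\<lambda>(i, j). b i j)"
    by (intro eq_matI) (auto simp: scalar_prod_def lessThan_atLeast0 intro!: sum.cong)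
  then show ?thesis unfolding detf_def by (simp add: det_mult[of _ r])
qed

lemma detf_transpose: "detf r (\<lambda>i j. v j i) = detf r v"
proof -
  have "mat r r (\<lambda>(i, j). v j i) = transpose_mat (mat r r (\<lambda>(i, j). v i j))"
    by (intro eq_matI) auto
  then show ?thesis unfolding detf_def by (simp add: det_transpose[of _ r])
qed

lemma detf_identical_rows:
  assumes "i < r" "j < r" "i \<noteq> j" "\<And>k. k < r \<Longrightarrow> v i k = v j k"
  shows "detf r v = 0"
  unfolding detf_def
  by (rule det_identical_rows[of _ r i j]) (use assms in \<open>auto intro!: eq_vecI\<close>)

lemma detf_swap:
  assumes "a < r" "b < r"
  shows "\<bar>detf r (\<lambda>i. v (Transposition.transpose a b i))\<bar> = \<bar>detf r v\<bar>"
proof -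
  let ?p = "Transposition.transpose a b"
  have p: "?p permutes {0..<r}" using assms by (intro permutes_swap_id) auto
  have "mat r r (\<lambda>(i, j). v (?p i) j) = mat r r (\<lambda>(i, j). mat r r (\<lambda>(i, j). v i j) $$ (?p i, j))"
    using permutes_in_image[OF p] by (intro eq_matI) auto
  then have "detf r (\<lambda>i. v (?p i)) = signof ?p * detf r v"
    unfolding detf_def using det_permute_rows[OF _ p, of "mat r r (\<lambda>(i, j). v i j)"] by simp
  then show ?thesis by (simp add: abs_mult sign_def)
qed

text \<open>The cofactors along row \<open>i\<close> do not involve that row, so one family
  \<open>c\<close> serves all replacements of it: the Cramer numerators of a vector are linear
  functions of the vector. The second claim is Cramer's rule without division, from the adjugate
  matrix.\<close>

lemma detf_cofactor:
  obtains c where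
    "\<And>i x. i < r \<Longrightarrow> detf r (v(i := x)) = (\<Sum>k<r. x k * c i k)"
    "\<And>x j. j < r \<Longrightarrow> (\<Sum>i<r. detf r (v(i := x)) * v i j) = detf r v * x j"
proof -
  let ?A = "mat r r (\<lambda>(i, j). v i j)"
  define c where "c i k = cofactor ?A i k" for i k
  have 1: "detf r (v(i := x)) = (\<Sum>k<r. x k * c i k)" if i: "i < r" for i x
  proof -
    let ?B = "mat r r (\<lambda>(a, j). (v(i := x)) a j)"
    have "detf r (v(i := x)) = (\<Sum>k<r. ?B $$ (i, k) * cofactor ?B i k)"
      unfolding detf_def by (rule laplace_expansion_row) (use i in auto)
    also have "\<dots> = (\<Sum>k<r. x k * c i k)"
    proof (intro sum.cong refl)
      fix k assume k: "k \<in> {..<r}"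
      have "mat_delete ?B i k = mat_delete ?A i k"
        unfolding mat_delete_def using i k by (intro eq_matI) auto
      then show "?B $$ (i, k) * cofactor ?B i k = x k * c i k"
        using i k by (simp add: c_def cofactor_def)
    qed
    finally show ?thesis .
  qed
  have adj: "(\<Sum>i<r. c i k * v i j) = (if k = j then detf r v else 0)" if "k < r" "j < r" for k j
  proof -
    have "(\<Sum>i<r. c i k * v i j) = (adj_mat ?A * ?A) $$ (k, j)"
      using that by (auto simp: adj_mat_def scalar_prod_def c_def lessThan_atLeast0 intro!: sum.cong)
    also have "\<dots> = (det ?A \<cdot>\<^sub>m 1\<^sub>m r) $$ (k, j)"
      by (subst adj_mat(3)[of ?A r]) auto
    finally show ?thesis using that by (simp add: detf_def)
  qed
  have "(\<Sum>i<r. detf r (v(i := x)) * v i j) = detf r v * x j" if "j < r" for x j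
  proof -
    have "(\<Sum>i<r. detf r (v(i := x)) * v i j) = (\<Sum>i<r. \<Sum>k<r. x k * (c i k * v i j))"
      by (intro sum.cong refl) (simp add: 1 sum_distrib_right mult.assoc)
    also have "\<dots> = (\<Sum>k<r. x k * (\<Sum>i<r. c i k * v i j))"
      by (subst sum.swap) (simp add: sum_distrib_left)
    also have "\<dots> = (\<Sum>k<r. if k = j then detf r v * x j else 0)"
      using that by (intro sum.cong refl) (simp add: adj)
    finally show ?thesis using that by simp
  qed
  with 1 show ?thesis by (intro that) auto
qed

lemma detf_cramer:
  assumes "j < r"
  shows "(\<Sum>i<r. detf r (v(i := x)) * v i j) = detf r v * x j"
  by (rule detf_cofactor[of r v]) (use assms in blast)

lemma detf_unit_row:
  assumes "i < r"
  shows "detf r ((\<lambda>i j. if i = j then 1 else 0)(i := q)) = q i"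
proof -
  let ?v = "\<lambda>i j. if i = j then 1 else (0 :: int)"
  have "detf r ?v = 1"
    unfolding detf_def by (subst (2) det_one[of r, symmetric], rule arg_cong[where f = det]) auto
  moreover have "(\<Sum>a<r. detf r (?v(a := q)) * ?v a i) = detf r ?v * q i"
    by (rule detf_cramer[OF assms, of ?v q])
  ultimately have "(\<Sum>a<r. detf r (?v(a := q)) * ?v a i) = q i" by (simp only: mult_1_left)
  moreover have "(\<Sum>a<r. detf r (?v(a := q)) * ?v a i) = (\<Sum>a<r. if a = i then detf r (?v(i := q)) else 0)"
    by (intro sum.cong) auto
  ultimately show ?thesis using assms by simp
qed

lemma detf_border:
  "detf (Suc s) (\<lambda>i j. if i < s then (if j < s then u i j else 0) else (if j = s then 1 else 0)) = detf s u"
proof -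
  let ?B = "mat (Suc s) (Suc s) (\<lambda>(i, j). if i < s then (if j < s then u i j else 0) else (if j = s then 1 else 0))"
  have "det ?B = (\<Sum>j<Suc s. ?B $$ (s, j) * cofactor ?B s j)"
    by (rule laplace_expansion_row) auto
  also have "\<dots> = (\<Sum>j<Suc s. if j = s then cofactor ?B s s else 0)"
    by (intro sum.cong) auto
  also have "\<dots> = cofactor ?B s s" by simp
  also have "\<dots> = det (mat_delete ?B s s)" by (simp add: cofactor_def)
  also have "mat_delete ?B s s = mat s s (\<lambda>(i, j). u i j)"
    by (intro eq_matI) (auto simp: mat_delete_def)
  finally show ?thesis by (simp add: detf_def)
qed

text \<open>Bordered by a unit row and column and multiplied by \<open>v\<close>, the matrix of
  Cramer numerators of the \<open>x l\<close> has the rows \<open>D * x l\<close> and, last,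
  \<open>v s\<close>; taking determinants gives the claim. The hypothesis on \<open>x\<close> makes
  the numerators at index \<open>s\<close> vanish, so the zeros in the border are correct.\<close>

lemma detf_coordinates:
  assumes D: "detf (Suc s) v = D" "D \<noteq> 0"
    and x: "\<And>l. l < s \<Longrightarrow> detf (Suc s) (v(s := x l)) = 0"
  shows "detf s (\<lambda>l i. detf (Suc s) (v(i := x l))) * D = D ^ s * detf (Suc s) (\<lambda>i. if i < s then x i else v s)"
proof -
  let ?r = "Suc s"
  let ?w = "\<lambda>i k. if i < s then (if k < s then detf ?r (v(k := x i)) else 0) else (if k = s then 1 else 0)"
  have "(\<Sum>k<?r. ?w i k * v k j) = (if i < s then D else 1) * (if i < s then x i else v s) j * 1"
    if "i < ?r" "j < ?r" for i j
  proof (cases "i < s")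
    case True
    then have "(\<Sum>k<?r. ?w i k * v k j) = (\<Sum>k<?r. detf ?r (v(k := x i)) * v k j)"
      using x[OF True] by (intro sum.cong) (auto simp: less_Suc_eq)
    also have "\<dots> = D * x i j" unfolding detf_cramer[OF that(2)] D(1) ..
    finally show ?thesis using True by (simp only: if_True mult_1_right)
  next
    case False
    then have "(\<Sum>k<?r. ?w i k * v k j) = (\<Sum>k<?r. if k = s then v s j else 0)"
      by (intro sum.cong) auto
    then show ?thesis using False by simp
  qed
  then have "detf ?r (\<lambda>i j. \<Sum>k<?r. ?w i k * v k j) =
      detf ?r (\<lambda>i j. (if i < s then D else 1) * (if i < s then x i else v s) j * 1)"
    by (rule detf_cong)
  then have "detf ?r ?w * D = (\<Prod>i<?r. if i < s then D else 1) * detf ?r (\<lambda>i. if i < s then x i else v s)"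
    unfolding detf_mult detf_scale D(1) by simp
  moreover have "(\<Prod>i<?r. if i < s then D else 1) = D ^ s" by simp
  ultimately show ?thesis unfolding detf_border by simp
qed

text \<open>Subtracting row \<open>0\<close> gives a factor \<open>m\<close> in each of the other
  \<open>r - 1\<close> rows. Replacing column \<open>i1\<close> by the combination with weights
  \<open>q\<close> multiplies the determinant by \<open>q i1\<close>, a unit modulo
  \<open>m\<close>, and gives one more factor: the new column is \<open>0\<close> in row
  \<open>0\<close> and divisible by \<open>m^2\<close> elsewhere.\<close>

lemma power_dvd_detf:
  fixes m :: int
  assumes i1: "i1 < r" and q: "coprime (q i1) m"
    and y: "\<And>l j. l < r \<Longrightarrow> j < r \<Longrightarrow> m dvd y l j - y 0 j"
    and y0: "(\<Sum>j<r. q j * y 0 j) = 0" and yl: "\<And>l. l < r \<Longrightarrow> m\<^sup>2 dvd (\<Sum>j<r. q j * y l j)"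
  shows "m ^ r dvd detf r y"
proof -
  have r: "0 < r" using i1 by simp
  let ?y = "\<lambda>l j. if l = 0 then y 0 j else y l j - y 0 j"
  \<comment> \<open>\<open>?L\<close> undoes the subtraction of row \<open>0\<close>;
    \<open>?C\<close> is the identity with column \<open>i1\<close> replaced by
    \<open>q\<close>.\<close>
  let ?L = "\<lambda>i k. (if k = i then 1 else 0) + (if i \<noteq> 0 \<and> k = 0 then 1 else (0::int))"
  let ?C = "\<lambda>i j. if j = i1 then q i else if i = j then 1 else (0::int)"
  let ?N = "\<lambda>l j. if j = i1 then (\<Sum>k<r. q k * ?y l k) else ?y l j"
  have "(\<Sum>k<r. ?L i k * ?y k j) = y i j" if "i < r" for i j
  proof -
    have "(\<Sum>k<r. ?L i k * ?y k j) = (\<Sum>k<r. if k = i then ?y i j else 0) +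
        (\<Sum>k<r. if k = 0 then (if i \<noteq> 0 then y 0 j else 0) else 0)"
      unfolding sum.distrib[symmetric] by (intro sum.cong) auto
    then show ?thesis using that r by simp
  qed
  then have "detf r y = detf r (\<lambda>i j. \<Sum>k<r. ?L i k * ?y k j)" by (intro detf_cong) auto
  then have 1: "detf r y = detf r ?L * detf r ?y" unfolding detf_mult .
  have "(\<Sum>k<r. ?y l k * ?C k j) = ?N l j" if "j < r" for l j
  proof (cases "j = i1")
    case False
    then have "(\<Sum>k<r. ?y l k * ?C k j) = (\<Sum>k<r. if k = j then ?y l j else 0)"
      by (intro sum.cong) auto
    then show ?thesis using False that by simp
  qed (auto simp: mult.commute intro!: sum.cong)
  then have "detf r ?N = detf r (\<lambda>l j. \<Sum>k<r. ?y l k * ?C k j)" by (intro detf_cong) auto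
  then have 2: "detf r ?N = detf r ?y * detf r ?C" unfolding detf_mult .
  have "detf r ?C = detf r ((\<lambda>i j. if i = j then 1 else 0)(i1 := q))"
    by (subst detf_transpose[symmetric]) (auto intro!: detf_cong)
  then have C: "detf r ?C = q i1" using i1 by (simp add: detf_unit_row)
  let ?e = "\<lambda>l. if l = 0 then 1 else m" and ?f = "\<lambda>j. if j = i1 then m else 1"
  have "\<exists>n. ?N l j = ?e l * n * ?f j" if "l < r" "j < r" for l j
  proof (cases "l = 0")
    case True
    then show ?thesis using y0 by (cases "j = i1") auto
  next
    case l: False
    show ?thesis
    proof (cases "j = i1")
      case True
      from yl[OF that(1)] obtain n where n: "(\<Sum>k<r. q k * y l k) = m\<^sup>2 * n" by (rule dvdE)
      have "(\<Sum>k<r. q k * ?y l k) = (\<Sum>k<r. q k * y l k)"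
        using l y0 by (simp add: right_diff_distrib sum_subtractf)
      then show ?thesis using l True n by (intro exI[of _ n]) (simp add: power2_eq_square)
    next
      case False
      then show ?thesis using l y[OF that] by (auto elim!: dvdE)
    qed
  qed
  moreover define R where "R l j n \<longleftrightarrow> ?N l j = ?e l * n * ?f j" for l j n
  ultimately have "\<exists>n. R l j n" if "l < r" "j < r" for l j using that by blast
  then obtain n where "\<And>l j. l < r \<Longrightarrow> j < r \<Longrightarrow> R l j (n l j)" by metis
  then have n: "\<And>l j. l < r \<Longrightarrow> j < r \<Longrightarrow> ?N l j = ?e l * n l j * ?f j" unfolding R_def .
  have "detf r ?N = (\<Prod>l<r. ?e l) * (\<Prod>j<r. ?f j) * detf r n"
    unfolding detf_scale[symmetric] using n by (rule detf_cong)
  also have "(\<Prod>j<r. ?f j) = m" using i1 by (simp add: prod.delta)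
  also have "(\<Prod>l<r. ?e l) * m = m ^ r"
  proof -
    obtain s where s: "r = Suc s" using r by (cases r) auto
    show ?thesis unfolding s prod.lessThan_Suc_shift by simp
  qed
  finally have "m ^ r dvd detf r ?y * q i1" using 2 C by simp
  moreover have "coprime (m ^ r) (q i1)" using q by (simp add: coprime_commute)
  ultimately have "m ^ r dvd detf r ?y" by (simp add: coprime_dvd_mult_left_iff)
  then show ?thesis using 1 by simp
qed

section \<open>Congruence classes of nonsingular points\<close>

text \<open>Vanishing of the 2 by 2 minors. The zero vector is parallel to everything, so projective
  points have to be kept nonzero separately.\<close>

definition parallel :: "nat \<Rightarrow> (nat \<Rightarrow> int) \<Rightarrow> (nat \<Rightarrow> int) \<Rightarrow> bool" where
  "parallel r x y \<longleftrightarrow> (\<forall>i<r. \<forall>j<r. x i * y j = x j * y i)"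

definition spans :: "nat \<Rightarrow> 'a set \<Rightarrow> ('a \<Rightarrow> nat \<Rightarrow> int) \<Rightarrow> bool" where
  "spans r A X \<longleftrightarrow> (\<exists>v\<in>{..<r} \<rightarrow> A. detf r (\<lambda>i. X (v i)) \<noteq> 0)"

text \<open>\<open>V\<close> plays the role of the volume of a box divided by the covolume of a lattice: only the
  determinants of points matter, and \<open>\<Delta>\<close> is a common divisor of them.\<close>

definition config ::
  "nat \<Rightarrow> 'a set \<Rightarrow> ('a \<Rightarrow> nat \<Rightarrow> int) \<Rightarrow> real \<Rightarrow> int \<Rightarrow> real \<Rightarrow> bool" where
  "config r A X E \<Delta> V \<longleftrightarrow> finite A \<and> 3 \<le> E \<and> 0 < \<Delta> \<and> spans r A X \<and>
     (\<forall>a\<in>A. \<forall>i<r. \<bar>real_of_int (X a i)\<bar> \<le> E) \<and>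
     (\<forall>v\<in>{..<r} \<rightarrow> A. \<Delta> dvd detf r (\<lambda>i. X (v i)) \<and>
        \<bar>real_of_int (detf r (\<lambda>i. X (v i)))\<bar> \<le> real_of_int \<Delta> * V)"

text \<open>Points carry labels of type \<open>'a\<close>: passing to a hyperplane changes the
  coordinates \<open>X\<close> but not the labels. The condition on \<open>y\<close> is the absence
  of lines through the point, expressed by integer values of \<open>F\<close> alone so that it
  survives substitutions. The last condition makes distinct labels distinct projective
  points.\<close>

definition zeros ::
  "nat \<Rightarrow> nat \<Rightarrow> 'a set \<Rightarrow> ('a \<Rightarrow> nat \<Rightarrow> int) \<Rightarrow> ((nat \<Rightarrow> int) \<Rightarrow> int) \<Rightarrow> bool" where
  "zeros r d S X F \<longleftrightarrow> hform UNIV r d F \<and>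
     (\<forall>a\<in>S. F (X a) = 0 \<and> (\<exists>i<r. X a i \<noteq> 0) \<and>
        (\<forall>y. \<not> parallel r (X a) y \<longrightarrow> (\<exists>s t. F (\<lambda>i. s * X a i + t * y i) \<noteq> 0))) \<and>
     (\<forall>a\<in>S. \<forall>b\<in>S. parallel r (X a) (X b) \<longrightarrow> a = b)"

text \<open>If \<open>y = x + p ^ j * h\<close> with \<open>0 < j < k\<close>, the expansion of
  \<open>H\<close> shows that \<open>p\<close> divides the sum of the \<open>h i * P i x\<close>.
  All \<open>h i\<close> with \<open>i \<noteq> i1\<close> are divisible by \<open>p\<close>, hence
  so is \<open>h i1\<close>, and \<open>j\<close> can be raised. Uniqueness is enough because the
  number of classes is only bounded from above.\<close>

lemma hensel_unique:
  fixes p :: int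
  assumes p: "prime p" and H: "hform K r e H" "H x = 0" "H y = 0"
    and T: "\<And>h s. s\<^sup>2 dvd H (\<lambda>i. x i + s * h i) - H x - s * (\<Sum>i<r. h i * P i x)"
    and i1: "i1 < r" "\<not> p dvd P i1 x" "p dvd y i1 - x i1"
    and others: "\<And>i. i < r \<Longrightarrow> i \<noteq> i1 \<Longrightarrow> p ^ k dvd y i - x i"
  shows "p ^ k dvd y i1 - x i1"
proof -
  have p0: "p \<noteq> 0" using p by auto
  have "p ^ j dvd y i1 - x i1" if "j \<le> k" for j
    using that
  proof (induction j)
    case (Suc j)
    show ?case
    \<comment> \<open>The step from \<open>j = 0\<close> is the assumed congruence modulo
      \<open>p\<close>; the expansion yields nothing modulo \<open>p ^ 0\<close>.\<close>
    proof (cases "j = 0")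
      case False
      define h where "h i = (y i - x i) div p ^ j" for i
      have h: "y i = x i + p ^ j * h i" if "i < r" for i
      proof -
        have "p ^ j dvd y i - x i"
          using others[OF that] Suc le_imp_power_dvd[of j k p] by (cases "i = i1") (auto intro: dvd_trans)
        then show ?thesis by (simp add: h_def)
      qed
      have "H (\<lambda>i. x i + p ^ j * h i) = 0"
        using hform_cong[OF H(1), of y "\<lambda>i. x i + p ^ j * h i"] h H(3) by simp
      then have "(p ^ j)\<^sup>2 dvd p ^ j * (\<Sum>i<r. h i * P i x)" using T[of "p ^ j" h] H(2) by simp
      then have "p ^ j dvd (\<Sum>i<r. h i * P i x)" using p0 by (simp add: power2_eq_square)
      then have 1: "p dvd (\<Sum>i<r. h i * P i x)" using False by (meson dvd_power dvd_trans neq0_conv)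
      have "p dvd h i" if "i < r" "i \<noteq> i1" for i
      proof -
        have "p ^ Suc j dvd y i - x i" using others[OF that] Suc.prems le_imp_power_dvd[of "Suc j" k p]
          by (auto intro: dvd_trans)
        then have "p ^ j * p dvd p ^ j * h i" using h[OF that(1)] by (simp add: mult.commute)
        then show ?thesis using p0 by simp
      qed
      then have "p dvd (\<Sum>i\<in>{..<r} - {i1}. h i * P i x)" by (intro dvd_sum) auto
      moreover have "(\<Sum>i<r. h i * P i x) = h i1 * P i1 x + (\<Sum>i\<in>{..<r} - {i1}. h i * P i x)"
        using i1(1) by (subst sum.remove[of _ i1]) auto
      ultimately have "p dvd h i1 * P i1 x" using 1 by (simp add: dvd_add_left_iff)
      then have "p dvd h i1" using p i1(2) by (simp add: prime_dvd_mult_iff)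
      then show ?thesis using h[OF i1(1)] by (simp add: mult.commute)
    qed (use i1 in auto)
  qed auto
  then show ?thesis by blast
qed

lemma detf_row_scale: "detf r (\<lambda>i j. c i * v i j) = (\<Prod>i<r. c i) * detf r v"
  using detf_scale[of r c v "\<lambda>_. 1"] by simp

text \<open>The gradient at the first rescaled point serves as \<open>q\<close> in
  \<open>power_dvd_detf\<close>: Euler's identity puts that point on its own tangent hyperplane, and
  the expansion of \<open>H\<close> puts the others there modulo \<open>p ^ (2 * k)\<close>. The
  factors \<open>c l\<close> are units modulo \<open>p\<close>, so rescaling does not affect
  divisibility.\<close>

lemma class_dvd_detf:
  fixes p :: int
  assumes p: "prime p" and H: "hform K r e H" "\<And>i. i < r \<Longrightarrow> hform K' r (e - 1) (P i)"
    and euler: "\<And>x. (\<Sum>i<r. x i * P i x) = int e * H x"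
    and T: "\<And>x h s. s\<^sup>2 dvd H (\<lambda>i. x i + s * h i) - H x - s * (\<Sum>i<r. h i * P i x)"
    and i1: "i1 < r"
    and x: "\<And>l. l < r \<Longrightarrow> H (x l) = 0 \<and> \<not> p dvd P i1 (x l) \<and> \<not> p dvd c l"
    and close: "\<And>l j. l < r \<Longrightarrow> j < r \<Longrightarrow> p ^ k dvd c l * x l j - c 0 * x 0 j"
  shows "p ^ (k * r) dvd detf r x"
proof (cases "k = 0")
  case False
  have r: "0 < r" using i1 by simp
  let ?y = "\<lambda>l j. c l * x l j"
  have Hy: "H (?y l) = 0" if "l < r" for l using hform_scale[OF H(1)] x[OF that] by simp
  have "(p ^ k) ^ r dvd detf r ?y"
  proof (rule power_dvd_detf[where q = "\<lambda>j. P j (?y 0)" and ?i1.0 = i1])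
    have "\<not> p dvd c 0 ^ (e - 1) * P i1 (x 0)"
      using x[OF r] p by (auto simp: prime_dvd_mult_iff dest: prime_dvd_power)
    then have "\<not> p dvd P i1 (?y 0)" using hform_scale[OF H(2)[OF i1]] by simp
    then show "coprime (P i1 (?y 0)) (p ^ k)"
      using p by (simp add: prime_imp_coprime coprime_commute)
    show "(\<Sum>j<r. P j (?y 0) * ?y 0 j) = 0"
      using euler[of "?y 0"] Hy[OF r] by (simp add: mult.commute)
    show "(p ^ k)\<^sup>2 dvd (\<Sum>j<r. P j (?y 0) * ?y l j)" if l: "l < r" for l
    proof -
      define h where "h j = (?y l j - ?y 0 j) div p ^ k" for j
      have h: "?y l j = ?y 0 j + p ^ k * h j" if "j < r" for j
        using close[OF l that] by (simp add: h_def)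
      have "H (\<lambda>j. ?y 0 j + p ^ k * h j) = 0"
        using hform_cong[OF H(1), of "?y l" "\<lambda>j. ?y 0 j + p ^ k * h j"] h Hy[OF l] by simp
      then have "(p ^ k)\<^sup>2 dvd p ^ k * (\<Sum>j<r. h j * P j (?y 0))"
        using T[of "p ^ k" "?y 0" h] Hy[OF r] by simp
      also have "p ^ k * (\<Sum>j<r. h j * P j (?y 0)) = (\<Sum>j<r. P j (?y 0) * (?y 0 j + p ^ k * h j))"
        using euler[of "?y 0"] Hy[OF r]
        by (simp add: distrib_left sum.distrib sum_distrib_left mult_ac)
      also have "\<dots> = (\<Sum>j<r. P j (?y 0) * ?y l j)" using h by (intro sum.cong) auto
      finally show ?thesis .
    qed
  qed (use i1 close in auto)
  then have "p ^ (k * r) dvd (\<Prod>l<r. c l) * detf r x"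
    unfolding detf_row_scale power_mult .
  moreover have "\<not> p dvd (\<Prod>l<r. c l)" using p x by (auto simp: prime_dvd_prod_iff)
  then have "coprime (p ^ (k * r)) (\<Prod>l<r. c l)" using p by (simp add: prime_imp_coprime)
  ultimately show ?thesis by (simp add: coprime_dvd_mult_right_iff)
qed auto

text \<open>A nonzero determinant is at least its divisor \<open>\<Delta>\<close> in absolute value.
  Applied with \<open>V / p ^ (k * r)\<close> for \<open>V\<close>, this yields
  \<open>p ^ (k * r) \<le> V\<close>.\<close>

lemma config_V_ge_1:
  assumes "config r A X E \<Delta> V"
  shows "1 \<le> V"
proof -
  obtain v where v: "v \<in> {..<r} \<rightarrow> A" "detf r (\<lambda>i. X (v i)) \<noteq> 0"
    using assms by (auto simp: config_def spans_def)
  then have D: "\<Delta> dvd detf r (\<lambda>i. X (v i))" "\<bar>real_of_int (detf r (\<lambda>i. X (v i)))\<bar> \<le> real_of_int \<Delta> * V" "0 < \<Delta>"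
    using assms by (auto simp: config_def)
  have "\<Delta> \<le> \<bar>detf r (\<lambda>i. X (v i))\<bar>" using dvd_imp_le_int[OF v(2) D(1)] D(3) by simp
  then have "real_of_int \<Delta> * 1 \<le> real_of_int \<Delta> * V" using D(2) by linarith
  then show ?thesis using D(3) by (subst (asm) mult_le_cancel_left_pos) auto
qed

lemma config_detf_le:
  assumes "config r A X E \<Delta> V" "v \<in> {..<r} \<rightarrow> A"
  shows "\<bar>real_of_int (detf r (\<lambda>i. X (v i)))\<bar> \<le> fact r * E ^ r"
proof -
  have "\<bar>real_of_int (detf r (\<lambda>i. X (v i)))\<bar> \<le> fact r * (\<Prod>j<r. E)"
    using assms by (intro detf_bound) (auto simp: config_def)
  then show ?thesis by simp
qed

text \<open>The points of \<open>T\<close> share one chart \<open>i0\<close>, one nonvanishing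
  derivative \<open>i1\<close> and one prime. The induction hypothesis enters as
  \<open>drop\<close>, with \<open>M\<close> absorbing its constant and logarithms; \<open>L\<close>
  bounds the number of levels \<open>k\<close>, since a class of full rank has a nonzero determinant
  divisible by \<open>p ^ (k * r)\<close>.\<close>

lemma stage_bound:
  fixes p :: int and V M :: real
  assumes r: "3 \<le> r" and cfg: "config r A X E \<Delta> V" and TA: "T \<subseteq> A"
    and p: "prime p" "\<not> p dvd \<Delta>"
    and H: "hform K r e H" "\<And>i. i < r \<Longrightarrow> hform K' r (e - 1) (P i)"
    and euler: "\<And>x. (\<Sum>i<r. x i * P i x) = int e * H x"
    and tay: "\<And>x h s. s\<^sup>2 dvd H (\<lambda>i. x i + s * h i) - H x - s * (\<Sum>i<r. h i * P i x)"
    and i: "i0 < r" "i1 < r" "i0 \<noteq> i1"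
    and T: "\<And>a. a \<in> T \<Longrightarrow> H (X a) = 0 \<and> \<not> p dvd X a i0 \<and> \<not> p dvd P i1 (X a)"
    and M: "0 \<le> M"
    and drop: "\<And>k A' S'. config r A' X E (\<Delta> * p ^ (k * r)) (V / p ^ (k * r)) \<Longrightarrow> A' \<subseteq> A \<Longrightarrow> S' \<subseteq> A' \<Longrightarrow>
        S' \<subseteq> T \<Longrightarrow> \<not> spans r S' X \<Longrightarrow>
        real (card S') \<le> M * (V / p ^ (k * r)) powr ((real r - 3) / (real r - 1))"
    and L: "fact r * E ^ r < 2 ^ L"
  shows "real (card T) \<le> real L * M * p ^ (r - 1) * V powr ((real r - 2) / real r)"
proof -
  have finA: "finite A" and E: "3 \<le> E" and \<Delta>: "0 < \<Delta>" and XE: "\<forall>a\<in>A. \<forall>i<r. \<bar>real_of_int (X a i)\<bar> \<le> E"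
    and dets: "\<And>v. v \<in> {..<r} \<rightarrow> A \<Longrightarrow> \<Delta> dvd detf r (\<lambda>i. X (v i)) \<and>
        \<bar>real_of_int (detf r (\<lambda>i. X (v i)))\<bar> \<le> real_of_int \<Delta> * V"
    using cfg by (auto simp: config_def)
  have finT: "finite T" using finA TA by (rule rev_finite_subset)
  have p2: "2 \<le> p" using p(1) by (rule prime_ge_2_int)
  have L0: "0 < L"
  proof (rule ccontr)
    assume "\<not> 0 < L"
    then have "fact r * E ^ r < 1" using L by simp
    moreover have "1 * 1 \<le> fact r * E ^ r" using E by (intro mult_mono one_le_power) (auto simp: fact_ge_1)
    ultimately show False by linarith
  qed
  \<comment> \<open>The coordinate \<open>i0\<close> is normalized to \<open>1\<close> modulo
    \<open>p ^ L\<close>, which serves all levels \<open>k \<le> L\<close> with the same factor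
    \<open>c a\<close>.\<close>
  have "\<exists>c. [c * X a i0 = 1] (mod p ^ L)" if "a \<in> T" for a
  proof -
    have "coprime (X a i0) (p ^ L)" using T[OF that] p(1) by (simp add: prime_imp_coprime coprime_commute)
    then obtain c where "[X a i0 * c = 1] (mod p ^ L)" using cong_solve_coprime_int by blast
    then show ?thesis by (auto simp: mult.commute)
  qed
  then obtain c where c: "\<And>a. a \<in> T \<Longrightarrow> [c a * X a i0 = 1] (mod p ^ L)" by metis
  have pc: "\<not> p dvd c a" if "a \<in> T" for a
  proof
    assume "p dvd c a"
    moreover have "[c a * X a i0 = 1] (mod p)" using c[OF that] L0
      by (rule_tac cong_dvd_modulus[of _ _ "p ^ L"]) (auto intro: dvd_power)
    ultimately have "p dvd 1" using cong_dvd_iff by (metis dvd_mult2)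
    then show False using p2 by auto
  qed
  define Y where "Y a i = c a * X a i" for a i
  define cls where "cls k a = {b \<in> T. \<forall>i<r. p ^ k dvd Y b i - Y a i}" for k a
  \<comment> \<open>At level \<open>0\<close> the whole of \<open>A\<close> is taken instead of
    \<open>T\<close>, which need not span; so level \<open>0\<close> always has full rank.\<close>
  define par where "par k a = (if k = 0 then A else cls k a)" for k a
  define Q where "Q k a \<longleftrightarrow> spans r (par k a) X" for k a
  have clsT: "cls k a \<subseteq> T" for k a by (auto simp: cls_def)
  have parA: "par k a \<subseteq> A" for k a using clsT TA by (auto simp: par_def)
  have cls_par: "cls (Suc k) a \<subseteq> par k a" for k a
  proof (cases "k = 0")
    case False
    have "p ^ k dvd z" if "p ^ Suc k dvd z" for z using that by (rule power_le_dvd) auto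
    then show ?thesis using False by (auto simp: par_def cls_def simp del: power_Suc)
  qed (use clsT TA in \<open>auto simp: par_def\<close>)
  have par_dvd: "\<Delta> * p ^ (k * r) dvd detf r (\<lambda>i. X (v i))" if v: "v \<in> {..<r} \<rightarrow> par k a" for k a v
  proof (cases "k = 0")
    case True
    then show ?thesis using dets v by (auto simp: par_def)
  next
    case False
    then have v': "v l \<in> cls k a" if "l < r" for l using v that by (auto simp: par_def)
    have "p ^ (k * r) dvd detf r (\<lambda>l. X (v l))"
    proof (rule class_dvd_detf[OF p(1) H euler tay i(2)])
      show "H (X (v l)) = 0 \<and> \<not> p dvd P i1 (X (v l)) \<and> \<not> p dvd c (v l)" if "l < r" for l
        using T pc v'[OF that] clsT by blast
      show "p ^ k dvd c (v l) * X (v l) j - c (v 0) * X (v 0) j" if "l < r" "j < r" for l j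
      proof -
        have "p ^ k dvd Y (v l) j - Y a j" "p ^ k dvd Y (v 0) j - Y a j"
          using v'[OF that(1)] v'[of 0] that r by (auto simp: cls_def)
        then have "p ^ k dvd (Y (v l) j - Y a j) - (Y (v 0) j - Y a j)" by (rule dvd_diff)
        then show ?thesis by (simp add: Y_def)
      qed
    qed
    moreover have "\<Delta> dvd detf r (\<lambda>l. X (v l))" using dets v parA by (meson Pi_mono subsetD)
    moreover have "coprime p \<Delta>" using p by (rule prime_imp_coprime)
    then have "coprime \<Delta> (p ^ (k * r))" by (simp add: coprime_commute)
    ultimately show ?thesis by (simp add: divides_mult)
  qed
  have par_cfg: "config r (par k a) X E (\<Delta> * p ^ (k * r)) (V / p ^ (k * r))" if "Q k a" for k a
    unfolding config_def
  proof (intro conjI ballI)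
    show "finite (par k a)" using finA parA by (rule rev_finite_subset)
    show "0 < \<Delta> * p ^ (k * r)" using \<Delta> p2 by simp
    show "\<forall>i<r. \<bar>real_of_int (X b i)\<bar> \<le> E" if "b \<in> par k a" for b using XE parA that by blast
    fix v assume v: "v \<in> {..<r} \<rightarrow> par k a"
    show "\<Delta> * p ^ (k * r) dvd detf r (\<lambda>i. X (v i))" using par_dvd[OF v] .
    have "v \<in> {..<r} \<rightarrow> A" using v parA by blast
    then show "\<bar>real_of_int (detf r (\<lambda>i. X (v i)))\<bar> \<le> real_of_int (\<Delta> * p ^ (k * r)) * (V / p ^ (k * r))"
      using dets p2 by simp
  qed (use that E in \<open>auto simp: Q_def\<close>)
  have Q_less: "k < L" if "Q k a" for k a
  proof -
    from that obtain v where v: "v \<in> {..<r} \<rightarrow> par k a" "detf r (\<lambda>i. X (v i)) \<noteq> 0"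
      by (auto simp: Q_def spans_def)
    have "p ^ (k * r) \<le> \<bar>detf r (\<lambda>i. X (v i))\<bar>"
      using dvd_imp_le_int[OF v(2) dvd_mult_right[OF par_dvd[OF v(1)]]] p2 by simp
    moreover have "v \<in> {..<r} \<rightarrow> A" using v parA by blast
    then have "\<bar>real_of_int (detf r (\<lambda>i. X (v i)))\<bar> \<le> fact r * E ^ r" by (rule config_detf_le[OF cfg])
    ultimately have "real_of_int (p ^ (k * r)) < 2 ^ L" using L by linarith
    moreover have "(2::real) ^ k \<le> real_of_int p ^ k" using p2 by (intro power_mono) auto
    moreover have "real_of_int p ^ k \<le> real_of_int p ^ (k * r)" using p2 r by (intro power_increasing) auto
    ultimately have "(2::real) ^ k < 2 ^ L" unfolding of_int_power by linarith
    then show "k < L" by simp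
  qed
  have "\<exists>k. Q k a \<and> \<not> Q (Suc k) a" for a
  proof (rule ccontr)
    assume no: "\<not> ?thesis"
    have "Q k a" for k
    proof (induction k)
      case 0
      then show ?case using cfg by (simp add: Q_def par_def config_def)
    next
      case (Suc k)
      then show ?case using no by blast
    qed
    then show False using Q_less by blast
  qed
  \<comment> \<open>The rank has to drop between two consecutive levels, since level
    \<open>0\<close> has full rank and no level from \<open>L\<close> on has.\<close>
  then obtain lev where lev: "\<And>a. Q (lev a) a" "\<And>a. \<not> Q (Suc (lev a)) a" by metis
  \<comment> \<open>The residues that determine a class: coordinate \<open>i0\<close> is
    \<open>1\<close> after normalization, so a dummy \<open>0\<close> is stored, and coordinate
    \<open>i1\<close> is needed only modulo \<open>p\<close> by
    \<open>hensel_unique\<close>.\<close>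
  define key where "key k a = (\<lambda>i\<in>{..<r}. if i = i0 then 0 else if i = i1 then Y a i mod p else Y a i mod p ^ k)" for k a
  define keys where "keys k = (\<Pi>\<^sub>E i\<in>{..<r}. if i = i0 then {0} else if i = i1 then {0..<p} else {0..<p ^ k})" for k
  have key: "key k a \<in> keys k" for k a using p2 by (auto simp: key_def keys_def)
  have fin_keys: "finite (keys k)" for k unfolding keys_def by (intro finite_PiE) auto
  have card_keys: "real (card (keys k)) = real_of_int p * real_of_int p ^ (k * (r - 2))" for k
  proof -
    have "card (keys k) = (\<Prod>j<r. if j = i0 then 1 else if j = i1 then nat p else nat (p ^ k))"
      unfolding keys_def by (subst card_PiE) (auto intro!: prod.cong)
    also have "\<dots> = nat p * nat (p ^ k) ^ (r - 2)"
    proof -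
      let ?f = "\<lambda>j. if j = i0 then 1 else if j = i1 then nat p else nat (p ^ k)"
      have "(\<Prod>j<r. ?f j) = ?f i0 * (\<Prod>j\<in>{..<r} - {i0}. ?f j)"
        using i by (intro prod.remove) auto
      also have "(\<Prod>j\<in>{..<r} - {i0}. ?f j) = ?f i1 * (\<Prod>j\<in>{..<r} - {i0} - {i1}. ?f j)"
        using i by (intro prod.remove) auto
      also have "(\<Prod>j\<in>{..<r} - {i0} - {i1}. ?f j) = (\<Prod>j\<in>{..<r} - {i0} - {i1}. nat (p ^ k))"
        by (intro prod.cong) auto
      also have "\<dots> = nat (p ^ k) ^ (r - 2)"
      proof -
        have "card ({..<r} - {i0} - {i1}) = r - 2" using i by (simp add: card_Diff_singleton_if)
        then show ?thesis by simp
      qed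
      finally show ?thesis using i by simp
    qed
    finally show ?thesis using p2 by (simp add: power_mult)
  qed
  have key_eq: "b \<in> cls k a" if ab: "a \<in> T" "b \<in> T" and k: "0 < k" "k \<le> L" and eq: "key k b = key k a" for a b k
  proof -
    have eqi: "key k b j = key k a j" for j using eq by simp
    have oth: "p ^ k dvd Y b j - Y a j" if "j < r" "j \<noteq> i1" for j
    proof (cases "j = i0")
      case True
      have "p ^ k dvd p ^ L" using k(2) by (rule le_imp_power_dvd)
      then have "[Y b i0 = 1] (mod p ^ k)" "[Y a i0 = 1] (mod p ^ k)"
        unfolding Y_def using c[OF ab(1)] c[OF ab(2)] by (auto intro: cong_dvd_modulus)
      then have "[Y b i0 = Y a i0] (mod p ^ k)" using cong_sym cong_trans by blast
      then show ?thesis using True by (simp add: cong_iff_dvd_diff)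
    next
      case False
      then show ?thesis using eqi[of j] that by (simp add: key_def mod_eq_dvd_iff)
    qed
    have "p ^ k dvd Y b i1 - Y a i1"
    proof (rule hensel_unique[of p K r e H "Y a" "Y b" P i1 k])
      show "H (Y a) = 0" "H (Y b) = 0"
        unfolding Y_def using T ab hform_scale[OF H(1)] by auto
      have "P i1 (Y a) = c a ^ (e - 1) * P i1 (X a)"
        unfolding Y_def by (rule hform_scale[OF H(2)[OF i(2)]])
      then show "\<not> p dvd P i1 (Y a)"
        using T[OF ab(1)] pc[OF ab(1)] p(1) by (auto simp: prime_dvd_mult_iff dest: prime_dvd_power)
      show "p dvd Y b i1 - Y a i1" using eqi[of i1] i by (simp add: key_def mod_eq_dvd_iff)
    qed (use p(1) H(1) tay i(2) oth in auto)
    then show ?thesis using oth ab by (auto simp: cls_def)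
  qed
  define \<alpha> where "\<alpha> = (real r - 3) / (real r - 1)"
  \<comment> \<open>The key is taken at \<open>k + 1\<close>, the level after the last full rank: a
    fibre then lies in one degenerate class, to which \<open>drop\<close> applies.\<close>
  define fib where "fib k \<kappa> = {a \<in> T. lev a = k \<and> key (Suc k) a = \<kappa>}" for k \<kappa>
  have V1: "1 \<le> V" by (rule config_V_ge_1[OF cfg])
  \<comment> \<open>Stated with the number of keys multiplied in, so that the sum over all keys of a
    level is bounded by the right-hand side.\<close>
  have fib_card: "real (card (fib k \<kappa>)) * (real_of_int p * real_of_int p ^ (Suc k * (r - 2)))
      \<le> M * p ^ (r - 1) * V powr ((real r - 2) / real r)" for k \<kappa>
  proof (cases "fib k \<kappa> = {}")
    case True
    then show ?thesis using M p2 by simp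
  next
    case False
    then obtain a where a: "a \<in> T" "lev a = k" "key (Suc k) a = \<kappa>" by (auto simp: fib_def)
    have kL: "k < L" using Q_less[OF lev(1)[of a]] a by simp
    have sub: "fib k \<kappa> \<subseteq> cls (Suc k) a"
      using key_eq[OF a(1), of _ "Suc k"] a(3) kL by (auto simp: fib_def)
    have cfg': "config r (par k a) X E (\<Delta> * p ^ (k * r)) (V / p ^ (k * r))"
      using par_cfg[OF lev(1)[of a]] a(2) by simp
    have "finite (cls (Suc k) a)" using finT clsT by (rule rev_finite_subset)
    then have "real (card (fib k \<kappa>)) \<le> real (card (cls (Suc k) a))" using sub by (simp add: card_mono)
    also have "\<dots> \<le> M * (V / p ^ (k * r)) powr \<alpha>"
      unfolding \<alpha>_def
    proof (rule drop[OF cfg'])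
      show "\<not> spans r (cls (Suc k) a) X" using lev(2)[of a] a(2) by (simp add: Q_def par_def)
    qed (use parA cls_par clsT in auto)
    finally have 1: "real (card (fib k \<kappa>)) \<le> M * (V / p ^ (k * r)) powr \<alpha>" .
    define q where "q = real_of_int p ^ (k * r)"
    have q0: "0 < q" using p2 by (simp add: q_def)
    have qV: "q \<le> V" using config_V_ge_1[OF cfg'] q0 by (simp add: q_def)
    have r1: "real r - 1 > 0" "real r > 0" using r by auto
    have "real_of_int p ^ (Suc k * (r - 2)) = real_of_int p ^ (r - 2) * q powr ((real r - 2) / real r)"
    proof -
      have "q powr ((real r - 2) / real r) = (real_of_int p powr (real k * real r)) powr ((real r - 2) / real r)"
        using p2 by (simp add: q_def flip: powr_realpow)
      also have "\<dots> = real_of_int p powr (real k * (real r - 2))"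
        using r1 by (simp add: powr_powr)
      also have "\<dots> = real_of_int p ^ (k * (r - 2))"
        using p2 r by (simp flip: powr_realpow add: of_nat_diff)
      finally show ?thesis by (simp add: power_add)
    qed
    then have "real (card (fib k \<kappa>)) * (real_of_int p * real_of_int p ^ (Suc k * (r - 2)))
        \<le> (M * (V / q) powr \<alpha>) * (real_of_int p * (real_of_int p ^ (r - 2) * q powr ((real r - 2) / real r)))"
      using 1 p2 by (intro mult_mono) (auto simp: q_def)
    also have "\<dots> = M * real_of_int p ^ (r - 1) * ((V / q) powr \<alpha> * q powr ((real r - 2) / real r))"
    proof -
      have "r - 1 = Suc (r - 2)" using r by simp
      then show ?thesis by (simp add: mult_ac)
    qed
    also have "(V / q) powr \<alpha> * q powr ((real r - 2) / real r) \<le> V powr ((real r - 2) / real r)"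
    proof -
      \<comment> \<open>The exponents differ by \<open>2 / (r * (r - 1))\<close>, so the remaining
        power of \<open>q\<close> has a nonnegative exponent and \<open>q\<close> may be replaced by
        \<open>V\<close>.\<close>
      have le: "\<alpha> \<le> (real r - 2) / real r"
        unfolding \<alpha>_def using r1 by (simp add: divide_simps) (simp add: algebra_simps)
      have "(V / q) powr \<alpha> * q powr ((real r - 2) / real r) = V powr \<alpha> * q powr ((real r - 2) / real r - \<alpha>)"
        using q0 V1 by (simp add: powr_divide powr_diff)
      also have "\<dots> \<le> V powr \<alpha> * V powr ((real r - 2) / real r - \<alpha>)"
        using le qV q0 by (intro mult_left_mono powr_mono2) auto
      also have "\<dots> = V powr ((real r - 2) / real r)" using V1 by (simp flip: powr_add)
      finally show ?thesis .
    qed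
    finally show ?thesis using M p2 by (simp add: mult_left_mono)
  qed
  have "T \<subseteq> (\<Union>k<L. \<Union>\<kappa>\<in>keys (Suc k). fib k \<kappa>)"
  proof
    fix a assume "a \<in> T"
    then show "a \<in> (\<Union>k<L. \<Union>\<kappa>\<in>keys (Suc k). fib k \<kappa>)"
      using Q_less[OF lev(1)[of a]] key by (auto simp: fib_def)
  qed
  moreover have finfib: "finite (fib k \<kappa>)" for k \<kappa> using finT by (auto simp: fib_def)
  ultimately have "card T \<le> card (\<Union>k<L. \<Union>\<kappa>\<in>keys (Suc k). fib k \<kappa>)"
    using fin_keys by (intro card_mono) auto
  also have "\<dots> \<le> (\<Sum>k<L. card (\<Union>\<kappa>\<in>keys (Suc k). fib k \<kappa>))" by (rule card_UN_le) simp
  also have "\<dots> \<le> (\<Sum>k<L. \<Sum>\<kappa>\<in>keys (Suc k). card (fib k \<kappa>))"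
    using fin_keys by (intro sum_mono card_UN_le)
  finally have "real (card T) \<le> (\<Sum>k<L. \<Sum>\<kappa>\<in>keys (Suc k). real (card (fib k \<kappa>)))"
    by (metis (mono_tags, lifting) of_nat_le_iff of_nat_sum sum.cong)
  also have "\<dots> \<le> (\<Sum>k<L. M * p ^ (r - 1) * V powr ((real r - 2) / real r))"
  proof (rule sum_mono)
    fix k
    let ?B = "M * p ^ (r - 1) * V powr ((real r - 2) / real r)"
    let ?n = "real_of_int p * real_of_int p ^ (Suc k * (r - 2))"
    have n: "0 < ?n" using p2 by simp
    have "(\<Sum>\<kappa>\<in>keys (Suc k). real (card (fib k \<kappa>))) \<le> (\<Sum>\<kappa>\<in>keys (Suc k). ?B / ?n)"
      using fib_card n by (intro sum_mono) (simp add: pos_le_divide_eq)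
    also have "\<dots> = ?n * (?B / ?n)" by (simp only: sum_constant card_keys)
    also have "\<dots> = ?B"
    proof -
      have "x * (y / x) = y" if "0 < x" for x y :: real using that by simp
      then show ?thesis using n by blast
    qed
    finally show "(\<Sum>\<kappa>\<in>keys (Suc k). real (card (fib k \<kappa>))) \<le> ?B" .
  qed
  also have "\<dots> = real L * M * p ^ (r - 1) * V powr ((real r - 2) / real r)" by simp
  finally show ?thesis .
qed

section \<open>Restriction to a hyperplane\<close>

text \<open>The 2 by 2 minors of linear images are combinations of the original minors. This carries
  \<open>parallel\<close> both ways through the change of coordinates on a hyperplane.\<close>

lemma parallel_sums:
  assumes "parallel n x y"
  shows "(\<Sum>k<n. x k * f k) * (\<Sum>l<n. y l * g l) = (\<Sum>k<n. x k * g k) * (\<Sum>l<n. y l * f l)"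
proof -
  have "(\<Sum>k<n. x k * f k) * (\<Sum>l<n. y l * g l) = (\<Sum>k<n. \<Sum>l<n. (x k * y l) * (f k * g l))"
    unfolding sum_product by (simp add: mult_ac)
  also have "\<dots> = (\<Sum>k<n. \<Sum>l<n. (x l * y k) * (f k * g l))"
  proof (intro sum.cong refl)
    fix k l assume "k \<in> {..<n}" "l \<in> {..<n}"
    then have "x k * y l = x l * y k" using assms unfolding parallel_def by blast
    then show "(x k * y l) * (f k * g l) = (x l * y k) * (f k * g l)" by (rule arg_cong)
  qed
  also have "\<dots> = (\<Sum>l<n. \<Sum>k<n. (x l * g l) * (y k * f k))"
    by (subst sum.swap) (simp add: mult_ac)
  finally show ?thesis unfolding sum_product .
qed

text \<open>In rank at least 2 some unit vector is not parallel to a given point, and the absence of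
  lines in that direction provides a nonzero value.\<close>

lemma zeros_nonzero:
  assumes "zeros r d S X F" "2 \<le> r" "S \<noteq> {}"
  obtains w where "F w \<noteq> 0"
proof -
  from assms(3) obtain a where a: "a \<in> S" by blast
  then obtain i where i: "i < r" "X a i \<noteq> 0" using assms(1) unfolding zeros_def by blast
  define j where "j = (if i = 0 then 1 else 0 :: nat)"
  have j: "j < r" "j \<noteq> i" using assms(2) by (auto simp: j_def)
  have "\<not> parallel r (X a) (\<lambda>k. if k = j then 1 else 0)"
  proof
    assume "parallel r (X a) (\<lambda>k. if k = j then 1 else 0)"
    then have "X a i * (if j = j then 1 else 0) = X a j * (if i = j then 1 else 0)"
      unfolding parallel_def using i j by blast
    then show False using i j by simp
  qed
  with a assms(1) show ?thesis using that unfolding zeros_def by blast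
qed

text \<open>No zero is parallel to a vector \<open>w\<close> with \<open>F w \<noteq> 0\<close>. In
  the basis \<open>X a0\<close>, \<open>w\<close> every point thus has a finite ratio of
  coordinates, and this ratio is a root of a polynomial of degree \<open>d\<close> with leading
  coefficient \<open>F w\<close>.\<close>

lemma card_binary_zeros:
  assumes Z: "zeros 2 d S X F" and fin: "finite S"
  shows "card S \<le> d"
proof (cases "S = {}")
  case False
  obtain w where w: "F w \<noteq> 0" using zeros_nonzero[OF Z _ False] by auto
  from False obtain a0 where a0: "a0 \<in> S" by blast
  have F: "hform UNIV 2 d F" and FX: "\<And>a. a \<in> S \<Longrightarrow> F (X a) = 0"
    and X0: "\<And>a. a \<in> S \<Longrightarrow> \<exists>i<2. X a i \<noteq> 0"
    and inj: "\<And>a b. a \<in> S \<Longrightarrow> b \<in> S \<Longrightarrow> parallel 2 (X a) (X b) \<Longrightarrow> a = b"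
    using Z unfolding zeros_def by blast+
  let ?det = "\<lambda>x y :: nat \<Rightarrow> int. x 0 * y 1 - x 1 * y 0"
  have lt2: "i < 2 \<longleftrightarrow> i = 0 \<or> i = 1" for i :: nat by auto
  have nz: "?det (X a) w \<noteq> 0" if a: "a \<in> S" for a
  proof
    assume *: "?det (X a) w = 0"
    obtain i where i: "i < 2" "X a i \<noteq> 0" using X0[OF a] by blast
    have "X a i * w j = w i * X a j" if "j < 2" for j
      using * i(1) that by (auto simp: lt2 algebra_simps)
    then have "F (\<lambda>j. X a i * w j) = F (\<lambda>j. w i * X a j)" by (intro hform_cong[OF F])
    then have "X a i ^ d * F w = w i ^ d * F (X a)" by (simp only: hform_scale[OF F])
    then show False using FX[OF a] w i(2) by simp
  qed
  obtain c where c: "\<And>s t. F (\<lambda>i. s * X a0 i + t * w i) = (\<Sum>j\<le>d. c j * s ^ (d - j) * t ^ j)" "c d = F w"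
    using hform_binary[OF F] by blast
  define q where "q = (\<Sum>j\<le>d. monom (rat_of_int (c j)) j)"
  have "coeff q d = rat_of_int (c d)" by (simp add: q_def coeff_sum)
  then have q0: "q \<noteq> 0" using c(2) w by auto
  have deg: "degree q \<le> d"
    unfolding q_def by (intro degree_sum_le) (auto intro: order.trans[OF degree_monom_le])
  \<comment> \<open>The ratio comes from
    \<open>det(a0, w) * a = det(a, w) * a0 + det(a0, a) * w\<close>, writing labels for their
    coordinate vectors.\<close>
  define \<tau> where "\<tau> a = rat_of_int (?det (X a0) (X a)) / rat_of_int (?det (X a) w)" for a
  have root: "poly q (\<tau> a) = 0" if a: "a \<in> S" for a
  proof -
    define s where "s = ?det (X a) w"
    define t where "t = ?det (X a0) (X a)"
    have s0: "s \<noteq> 0" using nz[OF a] by (simp only: s_def not_False_eq_True)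
    have \<tau>: "\<tau> a = rat_of_int t / rat_of_int s" by (simp only: \<tau>_def s_def t_def)
    have "F (\<lambda>i. ?det (X a0) w * X a i) = F (\<lambda>i. s * X a0 i + t * w i)"
      by (intro hform_cong[OF F]) (auto simp: lt2 algebra_simps s_def t_def)
    then have "(\<Sum>j\<le>d. c j * s ^ (d - j) * t ^ j) = 0"
      using FX[OF a] by (simp only: hform_scale[OF F] c(1) mult_zero_right)
    then have "rat_of_int (\<Sum>j\<le>d. c j * s ^ (d - j) * t ^ j) = 0" by (simp only: of_int_0)
    moreover have "rat_of_int (\<Sum>j\<le>d. c j * s ^ (d - j) * t ^ j) = rat_of_int s ^ d * poly q (\<tau> a)"
    proof -
      have "rat_of_int (c j * s ^ (d - j) * t ^ j) = rat_of_int s ^ d * (rat_of_int (c j) * \<tau> a ^ j)"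
        if "j \<le> d" for j
      proof -
        have "rat_of_int s ^ d = rat_of_int s ^ (d - j) * rat_of_int s ^ j"
          using that by (simp flip: power_add)
        then show ?thesis using s0 by (simp add: \<tau> power_divide)
      qed
      then have "(\<Sum>j\<le>d. rat_of_int (c j * s ^ (d - j) * t ^ j)) =
          (\<Sum>j\<le>d. rat_of_int s ^ d * (rat_of_int (c j) * \<tau> a ^ j))" by (intro sum.cong) auto
      then show ?thesis by (simp only: of_int_sum q_def poly_sum poly_monom sum_distrib_left)
    qed
    ultimately show ?thesis using s0 by simp
  qed
  have "inj_on \<tau> S"
  proof (rule inj_onI)
    fix a b assume ab: "a \<in> S" "b \<in> S" and eq: "\<tau> a = \<tau> b"
    have "rat_of_int (?det (X a0) (X a) * ?det (X b) w) = rat_of_int (?det (X a0) (X b) * ?det (X a) w)"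
      using eq nz[OF ab(1)] nz[OF ab(2)] unfolding \<tau>_def of_int_mult
      by (subst (asm) frac_eq_eq) (simp_all only: of_int_eq_0_iff not_False_eq_True)
    then have "?det (X a0) (X a) * ?det (X b) w = ?det (X a0) (X b) * ?det (X a) w"
      by (simp only: of_int_eq_iff)
    \<comment> \<open>The Pluecker relation between \<open>X a0\<close>, \<open>X a\<close>,
      \<open>X b\<close> and \<open>w\<close>.\<close>
    then have "?det (X a0) w * ?det (X a) (X b) = 0" by (simp add: algebra_simps)
    then have "?det (X a) (X b) = 0" using nz[OF a0] by simp
    then have "parallel 2 (X a) (X b)" by (auto simp: parallel_def lt2 algebra_simps)
    then show "a = b" using inj ab by blast
  qed
  then have "card S = card (\<tau> ` S)" by (simp add: card_image)
  also have "\<dots> \<le> card {t. poly q t = 0}"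
    using root poly_roots_finite[OF q0] by (intro card_mono) auto
  also have "\<dots> \<le> degree q" by (rule card_poly_roots_bound[OF q0])
  finally show ?thesis using deg by linarith
qed auto

text \<open>The constant and the exponent are uniform in the configuration, including
  \<open>F\<close>. The type argument fixes the type of the labels, which stays the same throughout
  the induction.\<close>

definition counted :: "'a itself \<Rightarrow> nat \<Rightarrow> nat \<Rightarrow> nat \<Rightarrow> real \<Rightarrow> bool" where
  "counted _ r d e C \<longleftrightarrow> 0 \<le> C \<and> (\<forall>(A :: 'a set) S X F E \<Delta> V.
     config r A X E \<Delta> V \<longrightarrow> S \<subseteq> A \<longrightarrow> zeros r d S X F \<longrightarrow>
     real (card S) \<le> C * V powr ((real r - 2) / real r) * ln E ^ e)"

lemma counted_2: "counted TYPE('a) 2 d 0 (real d)"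
  unfolding counted_def
proof (intro conjI allI impI)
  fix A S :: "'a set" and X F E \<Delta> V
  assume "config 2 A X E \<Delta> V" "S \<subseteq> A" "zeros 2 d S X F"
  moreover from this have "finite S" by (auto simp: config_def intro: finite_subset)
  \<comment> \<open>\<open>V powr 0\<close> equals \<open>1\<close> only for
    \<open>V \<noteq> 0\<close>.\<close>
  moreover have "1 \<le> V" using calculation(1) by (rule config_V_ge_1)
  ultimately show "real (card S) \<le> real d * V powr ((real 2 - 2) / real 2) * ln E ^ 0"
    using card_binary_zeros[of d S X F] by simp
qed auto

text \<open>Take a spanning tuple with as many entries from \<open>S\<close> as possible. Some entry
  lies outside \<open>S\<close>, since \<open>S\<close> does not span; it is moved to position
  \<open>s\<close>. If an element of \<open>S\<close> could replace it with nonzero determinant, the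
  number of entries from \<open>S\<close> would grow.\<close>

lemma spanning_exchange:
  assumes A: "spans r A X" and S: "S \<subseteq> A" "\<not> spans r S X" and r: "s < r"
  obtains v where "v \<in> {..<r} \<rightarrow> A" "detf r (\<lambda>i. X (v i)) \<noteq> 0"
    "\<And>x. x \<in> S \<Longrightarrow> detf r ((\<lambda>i. X (v i))(s := X x)) = 0"
proof -
  define P where "P v \<longleftrightarrow> v \<in> {..<r} \<rightarrow> A \<and> detf r (\<lambda>i. X (v i)) \<noteq> 0" for v
  define f where "f v = card {i. i < r \<and> v i \<in> S}" for v
  have fb: "f v < Suc r" for v
    unfolding f_def by (rule le_less_trans[OF card_mono[of "{..<r}"]]) auto
  have "\<exists>v. P v" using A by (auto simp: spans_def P_def)
  then obtain v0 where v0: "P v0" "\<And>v. P v \<Longrightarrow> f v \<le> f v0"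
    using ex_has_greatest_nat[of P _ f "Suc r"] fb by blast
  have "\<not> (\<forall>i<r. v0 i \<in> S)"
  proof
    assume "\<forall>i<r. v0 i \<in> S"
    then have "v0 \<in> {..<r} \<rightarrow> S" by auto
    then show False using v0(1) S(2) by (auto simp: spans_def P_def)
  qed
  then obtain i where i: "i < r" "v0 i \<notin> S" by blast
  let ?\<tau> = "Transposition.transpose i s"
  have \<tau>: "?\<tau> l < r \<longleftrightarrow> l < r" for l using i r by (auto simp: Transposition.transpose_def)
  define v where "v l = v0 (?\<tau> l)" for l
  have "\<bar>detf r (\<lambda>l. X (v l))\<bar> = \<bar>detf r (\<lambda>l. X (v0 l))\<bar>"
    unfolding v_def using detf_swap[OF i(1) r, of "\<lambda>l. X (v0 l)"] .
  then have Pv: "P v" using v0(1) \<tau> by (auto simp: P_def v_def Pi_iff)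
  have "{l. l < r \<and> v l \<in> S} = ?\<tau> ` {l. l < r \<and> v0 l \<in> S}"
  proof (intro equalityI subsetI)
    fix l assume "l \<in> {l. l < r \<and> v l \<in> S}"
    then show "l \<in> ?\<tau> ` {l. l < r \<and> v0 l \<in> S}"
      using \<tau> by (intro image_eqI[of _ _ "?\<tau> l"]) (auto simp: v_def)
  next
    fix l assume "l \<in> ?\<tau> ` {l. l < r \<and> v0 l \<in> S}"
    then obtain m where "m < r" "v0 m \<in> S" "l = ?\<tau> m" by blast
    then show "l \<in> {l. l < r \<and> v l \<in> S}" using \<tau>[of m] by (simp add: v_def)
  qed
  then have fv: "f v = f v0"
    unfolding f_def by (simp only: card_image[OF inj_on_transpose])
  have vs: "v s \<notin> S" using i(2) by (simp add: v_def)
  have "detf r ((\<lambda>i. X (v i))(s := X x)) = 0" if x: "x \<in> S" for x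
  proof (rule ccontr)
    assume *: "detf r ((\<lambda>i. X (v i))(s := X x)) \<noteq> 0"
    have "(\<lambda>i. X ((v(s := x)) i)) = (\<lambda>i. X (v i))(s := X x)" by auto
    then have "P (v(s := x))" using * Pv x S(1) by (auto simp: P_def)
    then have "f (v(s := x)) \<le> f v" using v0(2) fv by simp
    moreover have "{l. l < r \<and> (v(s := x)) l \<in> S} = insert s {l. l < r \<and> v l \<in> S}"
      using vs x r by auto
    then have "f (v(s := x)) = Suc (f v)" unfolding f_def using vs by (simp add: card_insert_if)
    ultimately show False by simp
  qed
  with Pv show ?thesis using that unfolding P_def by blast
qed

text \<open>Coordinates on the hyperplane spanned by \<open>v\<^sub>0, \<dots>, v\<^bsub>s-1\<^esub>\<close> are the numerators in Cramer's rule. They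
  multiply all determinants by \<open>D\<^bsup>s-1\<^esup>\<close>, which is absorbed into \<open>\<Delta>\<close>, so \<open>V\<close> does not grow.\<close>

lemma drop_bound:
  assumes s: "2 \<le> s" and cnt: "counted TYPE('a) s d e C"
    and cfg: "config (Suc s) A X E \<Delta> V" and SA: "(S :: 'a set) \<subseteq> A"
    and Z: "zeros (Suc s) d S X F" and ns: "\<not> spans (Suc s) S X"
  shows "real (card S) \<le> C * V powr ((real s - 2) / real s) * ln (fact (Suc s) * E ^ Suc s) ^ e"
proof -
  let ?r = "Suc s"
  have sp: "spans ?r A X" and finA: "finite A" and E: "3 \<le> E" and \<Delta>: "0 < \<Delta>"
    and dets: "\<And>v. v \<in> {..<?r} \<rightarrow> A \<Longrightarrow> \<Delta> dvd detf ?r (\<lambda>i. X (v i)) \<and>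
        \<bar>real_of_int (detf ?r (\<lambda>i. X (v i)))\<bar> \<le> real_of_int \<Delta> * V"
    using cfg by (auto simp: config_def)
  obtain v where v: "v \<in> {..<?r} \<rightarrow> A" "detf ?r (\<lambda>i. X (v i)) \<noteq> 0"
    "\<And>x. x \<in> S \<Longrightarrow> detf ?r ((\<lambda>i. X (v i))(s := X x)) = 0"
    using spanning_exchange[OF sp SA ns] by blast
  define w where "w i = X (v i)" for i
  define D where "D = detf ?r w"
  have D0: "D \<noteq> 0" using v(2) by (simp add: D_def w_def[abs_def])
  define u where "u a i = detf ?r (w(i := X a))" for a i
  \<comment> \<open>All points of \<open>A\<close> on the hyperplane, not just those of
    \<open>S\<close>: the \<open>v i\<close> with \<open>i < s\<close> are among them, so
    \<open>A'\<close> spans in rank \<open>s\<close>.\<close>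
  define A' where "A' = {a \<in> A. u a s = 0}"
  define \<Delta>' where "\<Delta>' = \<bar>D\<bar> ^ (s - 1) * \<Delta>"
  have s1: "s = Suc (s - 1)" using s by simp
  have SA': "S \<subseteq> A'" using SA v(3) by (auto simp: A'_def u_def w_def[abs_def])
  have coords: "(\<Sum>j<s. u a j * w j i) = D * X a i" if "u a s = 0" "i < ?r" for a i
    using detf_cramer[OF that(2), of w "X a"] that(1) by (simp add: u_def D_def)
  have vA': "v i \<in> A'" if "i < s" for i
  proof -
    have "u (v i) s = 0"
      unfolding u_def by (rule detf_identical_rows[of i _ s]) (use that in \<open>auto simp: w_def\<close>)
    then show ?thesis using v(1) that by (auto simp: A'_def)
  qed
  \<comment> \<open>Rank \<open>s\<close> determinants are reduced to rank \<open>s + 1\<close>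
    determinants of points of \<open>A\<close>, completed by the fixed last row \<open>w s\<close>;
    so divisibility and size are inherited from \<open>cfg\<close>.\<close>
  have det': "detf s (\<lambda>l. u (v' l)) = D ^ (s - 1) * detf ?r (\<lambda>i. if i < s then X (v' i) else w s)"
    if v': "v' \<in> {..<s} \<rightarrow> A'" for v'
  proof -
    have "detf s (\<lambda>l i. detf ?r (w(i := X (v' l)))) * D =
        D ^ s * detf ?r (\<lambda>i. if i < s then X (v' i) else w s)"
      using v' D0 by (intro detf_coordinates) (auto simp: D_def A'_def u_def Pi_iff)
    also have "D ^ s = D ^ (s - 1) * D" by (subst s1) simp
    finally have "detf s (\<lambda>l i. detf ?r (w(i := X (v' l)))) * D =
        D ^ (s - 1) * detf ?r (\<lambda>i. if i < s then X (v' i) else w s) * D"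
      by (simp only: mult_ac)
    then have "detf s (\<lambda>l i. detf ?r (w(i := X (v' l)))) =
        D ^ (s - 1) * detf ?r (\<lambda>i. if i < s then X (v' i) else w s)"
      by (subst (asm) mult_right_cancel[OF D0])
    then show ?thesis unfolding u_def[abs_def] .
  qed
  have cfg': "config s A' u (fact ?r * E ^ ?r) \<Delta>' V"
    unfolding config_def
  proof (intro conjI ballI allI impI)
    show "finite A'" using finA by (simp add: A'_def)
    have "3 \<le> 1 * E ^ 1" using E by simp
    also have "\<dots> \<le> fact ?r * E ^ ?r"
      using E by (intro mult_mono power_increasing) (auto simp: fact_ge_1 simp del: fact_Suc)
    finally show "3 \<le> fact ?r * E ^ ?r" .
    show "0 < \<Delta>'" using \<Delta> D0 by (simp add: \<Delta>'_def)
    have "detf ?r (\<lambda>i. if i < s then X (v i) else w s) = D"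
      unfolding D_def by (rule detf_cong) (auto simp: w_def less_Suc_eq)
    then have "detf s (\<lambda>l. u (v l)) \<noteq> 0" using det'[of v] vA' D0 by auto
    then show "spans s A' u" unfolding spans_def using vA' by blast
    show "\<bar>real_of_int (u a i)\<bar> \<le> fact ?r * E ^ ?r" if "a \<in> A'" "i < s" for a i
    proof -
      have "v(i := a) \<in> {..<?r} \<rightarrow> A" using v(1) that by (auto simp: A'_def)
      moreover have "(\<lambda>l. X ((v(i := a)) l)) = w(i := X a)" by (auto simp: w_def)
      ultimately show ?thesis unfolding u_def using config_detf_le[OF cfg, of "v(i := a)"] by simp
    qed
    fix v' assume v': "v' \<in> {..<s} \<rightarrow> A'"
    let ?v = "\<lambda>i. if i < s then v' i else v s"
    have "?v \<in> {..<?r} \<rightarrow> A" using v' v(1) by (auto simp: A'_def)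
    then have d: "\<Delta> dvd detf ?r (\<lambda>i. X (?v i))"
        "\<bar>real_of_int (detf ?r (\<lambda>i. X (?v i)))\<bar> \<le> real_of_int \<Delta> * V" using dets by blast+
    have e: "detf s (\<lambda>l. u (v' l)) = D ^ (s - 1) * detf ?r (\<lambda>i. X (?v i))"
      unfolding det'[OF v'] by (intro arg_cong2[where f = "(*)"] refl detf_cong) (auto simp: w_def)
    show "\<Delta>' dvd detf s (\<lambda>i. u (v' i))"
      unfolding e \<Delta>'_def using d(1) by (intro mult_dvd_mono) (simp_all flip: power_abs)
    show "\<bar>real_of_int (detf s (\<lambda>i. u (v' i)))\<bar> \<le> real_of_int \<Delta>' * V"
      unfolding e \<Delta>'_def using d(2)
      by (simp add: abs_mult power_abs mult.assoc mult_left_mono del: of_int_abs flip: of_int_abs)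
  qed
  define F' where "F' c = F (\<lambda>i. \<Sum>j<s. c j * w j i)" for c
  have F: "hform UNIV ?r d F" and FX: "\<And>a. a \<in> S \<Longrightarrow> F (X a) = 0"
    and X0: "\<And>a. a \<in> S \<Longrightarrow> \<exists>i<?r. X a i \<noteq> 0"
    and lines: "\<And>a y. a \<in> S \<Longrightarrow> \<not> parallel ?r (X a) y \<Longrightarrow> \<exists>s t. F (\<lambda>i. s * X a i + t * y i) \<noteq> 0"
    and inj: "\<And>a b. a \<in> S \<Longrightarrow> b \<in> S \<Longrightarrow> parallel ?r (X a) (X b) \<Longrightarrow> a = b"
    using Z unfolding zeros_def by blast+
  have us: "u a s = 0" if "a \<in> S" for a using that SA' by (auto simp: A'_def)
  have "zeros s d S u F'"
    unfolding zeros_def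
  proof (intro conjI ballI allI impI)
    show "hform UNIV s d F'" unfolding F'_def using F by (rule hform_subst)
    fix a assume a: "a \<in> S"
    have "F' (u a) = F (\<lambda>i. D * X a i)"
      unfolding F'_def using coords[OF us[OF a]] by (intro hform_cong[OF F]) auto
    then show "F' (u a) = 0" using FX[OF a] hform_scale[OF F] by simp
    obtain i where i: "i < ?r" "X a i \<noteq> 0" using X0[OF a] by blast
    show "\<exists>i<s. u a i \<noteq> 0"
    proof (rule ccontr)
      assume "\<not> ?thesis"
      then have "(\<Sum>j<s. u a j * w j i) = 0" by (intro sum.neutral) auto
      then show False using coords[OF us[OF a] i(1)] D0 i(2) by simp
    qed
    show "a = b" if b: "b \<in> S" and par: "parallel s (u a) (u b)" for b
    proof -
      have "(D * X a i) * (D * X b j) = (D * X a j) * (D * X b i)" if "i < ?r" "j < ?r" for i j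
        using parallel_sums[OF par, of "\<lambda>k. w k i" "\<lambda>k. w k j"] coords[OF us[OF a]] coords[OF us[OF b]] that
        by simp
      then have "D * D * (X a i * X b j) = D * D * (X a j * X b i)" if "i < ?r" "j < ?r" for i j
        using that by (simp add: mult_ac)
      then have "parallel ?r (X a) (X b)" using D0 by (auto simp: parallel_def)
      then show ?thesis using inj a b by blast
    qed
    fix y assume np: "\<not> parallel s (u a) y"
    \<comment> \<open>The vector on the hyperplane with coordinates \<open>y\<close>. The
      functionals \<open>c\<close> recover \<open>D * y\<close> from \<open>z\<close>, so
      \<open>z\<close> parallel to \<open>X a\<close> would force \<open>y\<close> parallel to
      \<open>u a\<close>.\<close>
    define z where "z i = (\<Sum>j<s. y j * w j i)" for i
    obtain c where c: "\<And>j x. j < ?r \<Longrightarrow> detf ?r (w(j := x)) = (\<Sum>k<?r. x k * c j k)"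
    proof (rule detf_cofactor[of ?r w])
      fix c assume "\<And>j x. j < ?r \<Longrightarrow> detf ?r (w(j := x)) = (\<Sum>k<?r. x k * c j k)"
      then show thesis by (rule that)
    qed
    have zc: "(\<Sum>k<?r. z k * c j k) = D * y j" if "j < s" for j
    proof -
      have "(\<Sum>k<?r. z k * c j k) = (\<Sum>k<?r. \<Sum>l<s. y l * (w l k * c j k))"
        by (intro sum.cong refl) (simp add: z_def sum_distrib_right mult.assoc)
      also have "\<dots> = (\<Sum>l<s. y l * (\<Sum>k<?r. w l k * c j k))"
        by (subst sum.swap) (simp only: sum_distrib_left)
      also have "\<dots> = (\<Sum>l<s. if l = j then y j * D else 0)"
      proof (intro sum.cong refl)
        fix l assume l: "l \<in> {..<s}"
        have "(\<Sum>k<?r. w l k * c j k) = detf ?r (w(j := w l))" using c that by simp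
        also have "\<dots> = (if l = j then D else 0)"
          using detf_identical_rows[of l ?r j "w(j := w l)"] that l by (auto simp: D_def)
        finally show "y l * (\<Sum>k<?r. w l k * c j k) = (if l = j then y j * D else 0)" by simp
      qed
      also have "\<dots> = D * y j" using that by simp
      finally show ?thesis .
    qed
    have "\<not> parallel ?r (X a) z"
    proof
      assume par: "parallel ?r (X a) z"
      have "u a i * (D * y j) = u a j * (D * y i)" if "i < s" "j < s" for i j
        using parallel_sums[OF par, of "c i" "c j"] c zc that by (simp add: u_def)
      then have "D * (u a i * y j) = D * (u a j * y i)" if "i < s" "j < s" for i j
        using that by (simp add: mult_ac)
      then have "parallel s (u a) y" using D0 by (auto simp: parallel_def)
      then show False using np by blast
    qed
    then obtain s0 t0 where st: "F (\<lambda>i. s0 * X a i + t0 * z i) \<noteq> 0" using lines[OF a] by blast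
    \<comment> \<open>The coordinates \<open>u a\<close> describe \<open>D * X a\<close>, whereas
      \<open>y\<close> describes \<open>z\<close> itself; hence the factor \<open>D\<close> at
      \<open>t0\<close>.\<close>
    have "F' (\<lambda>i. s0 * u a i + (t0 * D) * y i) = F (\<lambda>i. D * (s0 * X a i + t0 * z i))"
      unfolding F'_def
    proof (rule hform_cong[OF F])
      fix i assume i: "i < ?r"
      have "(\<Sum>j<s. (s0 * u a j + t0 * D * y j) * w j i) =
          s0 * (\<Sum>j<s. u a j * w j i) + t0 * D * z i"
        by (simp add: z_def sum_distrib_left sum.distrib algebra_simps)
      then show "(\<Sum>j<s. (s0 * u a j + t0 * D * y j) * w j i) = D * (s0 * X a i + t0 * z i)"
        using coords[OF us[OF a] i] by (simp add: algebra_simps)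
    qed
    then have "F' (\<lambda>i. s0 * u a i + (t0 * D) * y i) \<noteq> 0" using st D0 hform_scale[OF F] by simp
    then show "\<exists>s t. F' (\<lambda>i. s * u a i + t * y i) \<noteq> 0" by blast
  qed
  then show ?thesis using cnt cfg' SA' unfolding counted_def by blast
qed

section \<open>Induction on the rank\<close>

lemma hform_mono: "hform K r d F \<Longrightarrow> K \<subseteq> K' \<Longrightarrow> hform K' r d F"
  using hform_cmult[of K r d F 1 K'] by auto

text \<open>The hypotheses of \<open>stage_bound\<close> on a form and its gradient, with
  coefficient sets and degree quantified away because the estimate there is uniform in them.\<close>

definition jet :: "nat \<Rightarrow> ((nat \<Rightarrow> int) \<Rightarrow> int) \<Rightarrow> (nat \<Rightarrow> (nat \<Rightarrow> int) \<Rightarrow> int) \<Rightarrow> bool" where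
  "jet r H P \<longleftrightarrow> (\<exists>K K' e. hform K r e H \<and> (\<forall>i<r. hform K' r (e - 1) (P i)) \<and>
     (\<forall>x. (\<Sum>i<r. x i * P i x) = int e * H x) \<and>
     (\<forall>x h s. s\<^sup>2 dvd H (\<lambda>i. x i + s * h i) - H x - s * (\<Sum>i<r. h i * P i x)))"

lemma hform_weighted_sum:
  fixes P :: "nat \<Rightarrow> (nat \<Rightarrow> int) \<Rightarrow> int"
  assumes "\<And>i. i < r \<Longrightarrow> hform {-K..K} r e (P i)" "\<And>i. i < r \<Longrightarrow> 0 \<le> z i \<and> z i \<le> int m" "0 \<le> K"
  shows "hform {-(int (r * m) * K)..int (r * m) * K} r e (\<lambda>x. \<Sum>i<r. z i * P i x)"
proof -
  have "hform {-(int (n * m) * K)..int (n * m) * K} r e (\<lambda>x. \<Sum>i<n. z i * P i x)" if "n \<le> r" for n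
    using that
  proof (induction n)
    case 0
    then show ?case by (simp add: hform_zero)
  next
    case (Suc n)
    have "hform {-(int m * K)..int m * K} r e (\<lambda>x. z n * P n x)"
    proof (rule hform_cmult)
      show "hform {-K..K} r e (P n)" using assms(1) Suc.prems by simp
      fix a assume "a \<in> {-K..K}"
      then have "\<bar>z n * a\<bar> \<le> int m * K"
        unfolding abs_mult using assms(2)[of n] Suc.prems by (intro mult_mono) auto
      then show "z n * a \<in> {-(int m * K)..int m * K}" by (simp add: abs_le_iff)
    qed
    then have "hform {-(int (Suc n * m) * K)..int (Suc n * m) * K} r e
        (\<lambda>x. (\<Sum>i<n. z i * P i x) + z n * P n x)"
      using Suc by (intro hform_add[where K = "{-(int (n * m) * K)..int (n * m) * K}"
            and K' = "{-(int m * K)..int m * K}"]) (auto simp: algebra_simps)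
    then show ?case by simp
  qed
  then show ?thesis by blast
qed

text \<open>A stratification of the zeros of \<open>G\<close> into nonsingular zeros of at most
  \<open>d\<close> forms, nonsingularity being witnessed in the fixed direction \<open>z\<close>.
  The bound \<open>N\<close> concerns the directional derivatives because the prime has to avoid
  their values.\<close>

definition derivative_cover where
  "derivative_cover r z d N G \<F> \<longleftrightarrow> finite \<F> \<and> card \<F> \<le> d \<and>
    (\<forall>HP\<in>\<F>. jet r (fst HP) (snd HP) \<and>
       (\<exists>e\<le>d. hform {-N..N} r e (\<lambda>x. \<Sum>i<r. z i * snd HP i x))) \<and>
    (\<forall>x. G x = 0 \<longrightarrow> (\<exists>HP\<in>\<F>. fst HP x = 0 \<and> (\<Sum>i<r. z i * snd HP i x) \<noteq> 0))"

text \<open>A zero of \<open>G\<close> at which the derivative \<open>G'\<close> in direction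
  \<open>z\<close> vanishes is a zero of \<open>G'\<close>, which has lower degree. By Euler's
  identity \<open>G' z\<close> is the degree times \<open>G z\<close> and stays nonzero, so the
  process ends with a nonzero constant, for which the empty cover suffices.\<close>

lemma derivative_cover_exists:
  fixes G :: "(nat \<Rightarrow> int) \<Rightarrow> int"
  assumes "hform {-K..K} r d G" "0 \<le> K" "d \<le> D" "\<And>i. i < r \<Longrightarrow> 0 \<le> z i \<and> z i \<le> int m" "G z \<noteq> 0"
  shows "\<exists>\<F>. derivative_cover r z d (int (r * m * D + 1) ^ d * K) G \<F>"
  using assms(1,2,3,5)
proof (induction d arbitrary: G K)
  case 0
  then show ?case by (intro exI[of _ "{}"]) (auto simp: derivative_cover_def)
next
  case (Suc d)
  let ?b = "int (r * m * D + 1)"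
  obtain P where P: "\<And>i. i < r \<Longrightarrow> hform {-(int (Suc d) * K)..int (Suc d) * K} r (Suc d - 1) (P i)"
    "\<And>x. (\<Sum>i<r. x i * P i x) = int (Suc d) * G x"
    "\<And>x h s. s\<^sup>2 dvd G (\<lambda>i. x i + s * h i) - G x - s * (\<Sum>i<r. h i * P i x)"
  proof (rule hform_derivative[OF Suc.prems(1,2)])
    fix P assume "\<And>i. i < r \<Longrightarrow> hform {-(int (Suc d) * K)..int (Suc d) * K} r (Suc d - 1) (P i)"
      "\<And>x. (\<Sum>i<r. x i * P i x) = int (Suc d) * G x"
      "\<And>x h s. s\<^sup>2 dvd G (\<lambda>i. x i + s * h i) - G x - s * (\<Sum>i<r. h i * P i x)"
    then show thesis by (rule that)
  qed
  define G' where "G' x = (\<Sum>i<r. z i * P i x)" for x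
  have jet: "jet r G P" unfolding jet_def using Suc.prems(1) P by blast
  have g: "hform {-(int (r * m) * (int (Suc d) * K))..int (r * m) * (int (Suc d) * K)} r d G'"
    unfolding G'_def using P(1) assms(4) Suc.prems(2) by (intro hform_weighted_sum) auto
  have le: "int (r * m) * (int (Suc d) * K) \<le> ?b * K"
  proof -
    have "int (r * m) * int (Suc d) \<le> int (r * m) * int D" using Suc.prems(3) by (intro mult_left_mono) auto
    also have "\<dots> \<le> ?b" by simp
    finally have "int (r * m) * int (Suc d) * K \<le> ?b * K" using Suc.prems(2) by (intro mult_right_mono)
    then show ?thesis by (simp only: mult.assoc)
  qed
  have G': "hform {-(?b * K)..?b * K} r d G'"
    by (rule hform_mono[OF g]) (use le in \<open>simp only: atLeastatMost_subset_iff neg_le_iff_le simp_thms\<close>)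
  have "G' z = int (Suc d) * G z" unfolding G'_def by (rule P(2))
  then have "G' z \<noteq> 0" using Suc.prems(4) by simp
  then have "\<exists>\<F>. derivative_cover r z d (?b ^ d * (?b * K)) G' \<F>"
    using Suc.prems(2,3) G' by (intro Suc.IH) auto
  moreover have bb: "?b ^ d * (?b * K) = ?b ^ Suc d * K" by simp
  ultimately obtain \<F> where "derivative_cover r z d (?b ^ Suc d * K) G' \<F>" by (metis (no_types))
  then have \<F>: "finite \<F>" "card \<F> \<le> d"
    "\<forall>HP\<in>\<F>. jet r (fst HP) (snd HP) \<and>
       (\<exists>e\<le>d. hform {-(?b ^ Suc d * K)..?b ^ Suc d * K} r e (\<lambda>x. \<Sum>i<r. z i * snd HP i x))"
    "\<forall>x. G' x = 0 \<longrightarrow> (\<exists>HP\<in>\<F>. fst HP x = 0 \<and> (\<Sum>i<r. z i * snd HP i x) \<noteq> 0)"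
    unfolding derivative_cover_def by - (elim conjE, assumption)+
  have "?b * K \<le> ?b ^ Suc d * K"
    using Suc.prems(2) self_le_power[of ?b "Suc d"] by (intro mult_right_mono) auto
  then have G'': "hform {-(?b ^ Suc d * K)..?b ^ Suc d * K} r d G'"
    by (intro hform_mono[OF G']) (simp only: atLeastatMost_subset_iff neg_le_iff_le simp_thms)
  show ?case
    unfolding derivative_cover_def
  proof (intro exI[of _ "insert (G, P) \<F>"] conjI ballI allI impI)
    show "finite (insert (G, P) \<F>)" using \<F>(1) by simp
    show "card (insert (G, P) \<F>) \<le> Suc d" using \<F>(1,2) by (simp add: card_insert_if)
    fix HP assume HP: "HP \<in> insert (G, P) \<F>"
    then show "jet r (fst HP) (snd HP)" using jet \<F>(3) by auto
    show "\<exists>e\<le>Suc d. hform {-(?b ^ Suc d * K)..?b ^ Suc d * K} r e (\<lambda>x. \<Sum>i<r. z i * snd HP i x)"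
    proof (cases "HP = (G, P)")
      case True
      then show ?thesis using G'' unfolding G'_def by (intro exI[of _ d]) simp
    next
      case False
      then obtain e where "e \<le> d"
        "hform {-(?b ^ Suc d * K)..?b ^ Suc d * K} r e (\<lambda>x. \<Sum>i<r. z i * snd HP i x)"
        using \<F>(3) HP by blast
      then show ?thesis by (intro exI[of _ e]) simp
    qed
  next
    fix x assume x: "G x = 0"
    show "\<exists>HP\<in>insert (G, P) \<F>. fst HP x = 0 \<and> (\<Sum>i<r. z i * snd HP i x) \<noteq> 0"
    proof (cases "G' x = 0")
      case True
      then show ?thesis using \<F>(4) by blast
    next
      case False
      then show ?thesis using x by (auto simp: G'_def)
    qed
  qed
qed

lemma zeros_subset:
  assumes "zeros r d S X F" "T \<subseteq> S"
  shows "zeros r d T X F"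
proof -
  have 1: "\<forall>a\<in>T. P a" if "\<forall>a\<in>S. P a" for P using that assms(2) by blast
  have 2: "\<forall>a\<in>T. \<forall>b\<in>T. Q a b" if "\<forall>a\<in>S. \<forall>b\<in>S. Q a b" for Q using that assms(2) by blast
  show ?thesis
    using assms(1) unfolding zeros_def by (elim conjE, intro conjI) (assumption, erule 1, erule 2)
qed

text \<open>The exponent of the logarithm would only have to grow by \<open>2s + 3\<close>: two for the choice of \<open>p\<close>, one for
  the choice of \<open>k\<close>, and \<open>2s\<close> from the factor \<open>p\<^bsup>r-1\<^esup>\<close>.\<close>

lemma counted_step:
  assumes s: "2 \<le> s" and cnt: "counted TYPE('a) s d e C"
  shows "\<exists>C'. counted TYPE('a) (Suc s) d (e + 2 * s\<^sup>2) C'"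
proof -
  define r where "r = Suc s"
  have r: "3 \<le> r" using s by (simp add: r_def)
  have C: "0 \<le> C" using cnt by (simp add: counted_def)
  obtain c1 where c1: "\<forall>E I (X :: 'a \<Rightarrow> nat \<Rightarrow> int) F z. 3 \<le> E \<longrightarrow> hform UNIV r d F \<longrightarrow>
     (\<forall>a\<in>I. \<forall>i<r. \<bar>X a i\<bar> \<le> E) \<longrightarrow> (\<forall>a\<in>I. F (X a) = 0) \<longrightarrow>
     (\<forall>i<r. 0 \<le> z i \<and> z i \<le> int d) \<longrightarrow> F z \<noteq> 0 \<longrightarrow>
     (\<exists>G. hform {-(E ^ c1)..E ^ c1} r d G \<and> (\<forall>a\<in>I. G (X a) = 0) \<and> G z \<noteq> 0)"
    using small_form[of r d, where 'a = 'a] ..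
  \<comment> \<open>\<open>b\<close> is the factor lost per differentiation in
    \<open>derivative_cover_exists\<close>. The constants in \<open>k0\<close> come from the bound
    on \<open>\<Delta>\<close>, from \<open>hform_bound\<close> and from the \<open>d\<close>
    differentiations; \<open>c2\<close> turns them and \<open>E1 \<le> E^2\<close> into a single
    power of \<open>E\<close>.\<close>
  define b where "b = r * d * d + 1"
  define k0 where "k0 = fact r * r ^ d * b ^ d"
  define c2 where "c2 = k0 + r + 2 * (c1 + d + 1)"
  obtain C3 where C3: "0 \<le> C3" "\<forall>E\<ge>3. \<forall>M::nat. 0 < M \<longrightarrow> real M \<le> E ^ c2 \<longrightarrow>
     (\<exists>p. prime p \<and> \<not> p dvd M \<and> real p \<le> C3 * (ln E)\<^sup>2)"
    using small_prime_not_dvd[of c2] by blast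
  define C4 where "C4 = real (fact r + r)"
  define C' where "C' = real d * (C3 * real r * real r) * ((2 * C4 + 1) * (C * C4 ^ e) * C3 ^ s)"
  have C'0: "0 \<le> C'" unfolding C'_def C4_def using C C3(1) by simp
  have "real (card S) \<le> C' * V powr ((real r - 2) / real r) * ln E ^ (e + 2 * s\<^sup>2)"
    if cfg: "config r A X E \<Delta> V" and SA: "S \<subseteq> A" and Z: "zeros r d S X F" for A S :: "'a set" and X F E \<Delta> V
  proof (cases "S = {}")
    case True
    have "1 \<le> E" using cfg by (simp add: config_def)
    then show ?thesis using True C'0 by simp
  next
    case False
    have E: "3 \<le> E" and finA: "finite A" and \<Delta>: "0 < \<Delta>"
      and XE: "\<And>a i. a \<in> A \<Longrightarrow> i < r \<Longrightarrow> \<bar>real_of_int (X a i)\<bar> \<le> E"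
      using cfg by (auto simp: config_def)
    have finS: "finite S" using finA SA by (rule rev_finite_subset)
    have lnE: "1 \<le> ln E" using E exp_le by (subst ln_ge_iff) auto
    obtain w where w: "F w \<noteq> 0" using zeros_nonzero[OF Z _ False] r by auto
    have F: "hform UNIV r d F" and FX: "\<forall>a\<in>S. F (X a) = 0" and X0: "\<forall>a\<in>S. \<exists>i<r. X a i \<noteq> 0"
      using Z unfolding zeros_def by blast+
    obtain z where z: "F z \<noteq> 0" "\<And>i. i < r \<Longrightarrow> 0 \<le> z i \<and> z i \<le> int d"
      using hform_grid[OF F w] by blast
    \<comment> \<open>\<open>small_form\<close> needs an integral bound.\<close>
    define E1 where "E1 = \<lceil>E\<rceil>"
    have E1: "3 \<le> E1" "E \<le> real_of_int E1" "real_of_int E1 \<le> E\<^sup>2"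
    proof -
      show "3 \<le> E1" "E \<le> real_of_int E1" using E unfolding E1_def by linarith+
      have "real_of_int E1 \<le> E + 1" unfolding E1_def by linarith
      also have "\<dots> \<le> 3 * E" using E by simp
      also have "\<dots> \<le> E\<^sup>2" unfolding power2_eq_square using E by (intro mult_right_mono) auto
      finally show "real_of_int E1 \<le> E\<^sup>2" .
    qed
    have XE1: "\<bar>X a i\<bar> \<le> E1" if "a \<in> A" "i < r" for a i
    proof -
      have "real_of_int \<bar>X a i\<bar> \<le> real_of_int E1" using XE[OF that] E1(2) by simp
      then show ?thesis by (simp only: of_int_le_iff)
    qed
    have "\<forall>a\<in>S. \<forall>i<r. \<bar>X a i\<bar> \<le> E1" using XE1 SA by blast
    moreover have "\<forall>i<r. 0 \<le> z i \<and> z i \<le> int d" using z(2) by blast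
    ultimately have "\<exists>G. hform {-(E1 ^ c1)..E1 ^ c1} r d G \<and> (\<forall>a\<in>S. G (X a) = 0) \<and> G z \<noteq> 0"
      by (rule c1[THEN spec[of _ E1], THEN spec[of _ S], THEN spec[of _ X], THEN spec[of _ F],
            THEN spec[of _ z], THEN mp, THEN mp, THEN mp, THEN mp, THEN mp, THEN mp, OF E1(1) F _ FX _ z(1)])
    then obtain G where G: "hform {-(E1 ^ c1)..E1 ^ c1} r d G" "\<And>a. a \<in> S \<Longrightarrow> G (X a) = 0" "G z \<noteq> 0"
      by blast
    let ?N = "int b ^ d * E1 ^ c1"
    obtain \<F> where "derivative_cover r z d ?N G \<F>"
      using derivative_cover_exists[OF G(1) _ order.refl z(2) G(3)] E1(1) unfolding b_def by auto
    then have \<F>: "finite \<F>" "card \<F> \<le> d" "\<forall>HP\<in>\<F>. jet r (fst HP) (snd HP) \<and>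
         (\<exists>e\<le>d. hform {-?N..?N} r e (\<lambda>x. \<Sum>i<r. z i * snd HP i x))"
      "\<forall>x. G x = 0 \<longrightarrow> (\<exists>HP\<in>\<F>. fst HP x = 0 \<and> (\<Sum>i<r. z i * snd HP i x) \<noteq> 0)"
      unfolding derivative_cover_def by - (elim conjE, assumption)+
    define T where "T HP p i j = {a \<in> S. fst HP (X a) = 0 \<and> \<not> int p dvd X a i \<and> \<not> int p dvd snd HP j (X a)}"
      for HP :: "((nat \<Rightarrow> int) \<Rightarrow> int) \<times> (nat \<Rightarrow> (nat \<Rightarrow> int) \<Rightarrow> int)" and p i j
    define x where "x = C3 * (ln E)\<^sup>2"
    have x0: "0 \<le> x" using C3(1) by (simp add: x_def)
    define primes where "primes = {p :: nat. prime p \<and> \<not> int p dvd \<Delta> \<and> real p \<le> x}"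
    define pairs where "pairs = {(i, j). i < r \<and> j < r \<and> i \<noteq> j}"
    have covered: "\<exists>HP\<in>\<F>. \<exists>p\<in>primes. \<exists>ij\<in>pairs. a \<in> T HP p (fst ij) (snd ij)" if a: "a \<in> S" for a
    proof -
      obtain HP where "HP \<in> \<F>" "fst HP (X a) = 0" "(\<Sum>i<r. z i * snd HP i (X a)) \<noteq> 0"
        using \<F>(4) G(2)[OF a] by blast
      then obtain H P where HP: "(H, P) \<in> \<F>" "H (X a) = 0" "(\<Sum>i<r. z i * P i (X a)) \<noteq> 0"
        by (cases HP) auto
      define val where "val = (\<Sum>i<r. z i * P i (X a))"
      have aA: "a \<in> A" using a SA by blast
      obtain e' where e': "e' \<le> d" "hform {-?N..?N} r e' (\<lambda>x. \<Sum>i<r. z i * P i x)"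
        using \<F>(3) HP(1) by fastforce
      have "\<bar>val\<bar> \<le> int r ^ e' * ?N * E1 ^ e'"
        unfolding val_def using XE1[OF aA] by (intro hform_bound[OF e'(2)])
      also have "\<dots> \<le> int r ^ d * ?N * E1 ^ d"
        using e'(1) r E1(1) by (intro mult_mono power_increasing) (auto simp: b_def)
      finally have val: "\<bar>val\<bar> \<le> int r ^ d * ?N * E1 ^ d" .
      obtain i where i: "i < r" "X a i \<noteq> 0" using X0 a by blast
      \<comment> \<open>One prime has to avoid three numbers at once: \<open>\<Delta>\<close>, to
        which the new factor \<open>p ^ (k * r)\<close> must be coprime, the directional derivative,
        for nonsingularity, and a nonzero coordinate, which provides the chart.\<close>
      define M where "M = nat (\<Delta> * \<bar>val\<bar> * \<bar>X a i\<bar>)"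
      have Mpos: "0 < \<Delta> * \<bar>val\<bar> * \<bar>X a i\<bar>" using \<Delta> HP(3) i(2) by (simp add: val_def)
      have "real M \<le> E ^ c2"
      proof -
        have \<Delta>_le: "real_of_int \<Delta> \<le> fact r * E ^ r"
        proof -
          obtain v where v: "v \<in> {..<r} \<rightarrow> A" "detf r (\<lambda>i. X (v i)) \<noteq> 0"
            using cfg by (auto simp: config_def spans_def)
          have "\<Delta> dvd detf r (\<lambda>i. X (v i))" using cfg v by (auto simp: config_def)
          then have "\<Delta> \<le> \<bar>detf r (\<lambda>i. X (v i))\<bar>" using dvd_imp_le_int[OF v(2)] \<Delta> by fastforce
          moreover have "\<bar>real_of_int (detf r (\<lambda>i. X (v i)))\<bar> \<le> fact r * E ^ r"
            by (rule config_detf_le[OF cfg v(1)])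
          ultimately show ?thesis by linarith
        qed
        have "real M = real_of_int \<Delta> * real_of_int \<bar>val\<bar> * real_of_int \<bar>X a i\<bar>"
          using Mpos by (simp add: M_def)
        also have "\<dots> \<le> (fact r * E ^ r) * real_of_int (int r ^ d * ?N * E1 ^ d) * real_of_int E1"
          using \<Delta>_le val XE1[OF aA i(1)] E E1(1) by (intro mult_mono) (simp_all only: of_int_le_iff, auto)
        also have "\<dots> = real k0 * E ^ r * real_of_int E1 ^ (c1 + d + 1)"
          by (simp add: k0_def power_add)
        also have "\<dots> \<le> E ^ k0 * E ^ r * (E\<^sup>2) ^ (c1 + d + 1)"
        proof -
          have "real k0 \<le> 2 ^ k0" by (rule less_imp_le[OF of_nat_less_two_power])
          also have "\<dots> \<le> E ^ k0" using E by (intro power_mono) auto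
          finally show ?thesis using E E1 by (intro mult_mono power_mono) auto
        qed
        also have "\<dots> = E ^ c2" by (simp only: c2_def power_add power_mult)
        finally show ?thesis .
      qed
      then obtain p where p: "prime p" "\<not> p dvd M" "real p \<le> x"
        using C3(2) E Mpos unfolding x_def M_def by (meson zero_less_nat_eq)
      have "\<not> int p dvd \<Delta> * \<bar>val\<bar> * \<bar>X a i\<bar>"
        using p(2) Mpos unfolding M_def by (metis int_dvd_int_iff int_nat_eq less_imp_le)
      then have pn: "\<not> int p dvd \<Delta>" "\<not> int p dvd val" "\<not> int p dvd X a i" by (auto intro: dvd_mult dvd_mult2)
      have pp: "prime (int p)" using p(1) by simp
      \<comment> \<open>The derivative has to belong to a coordinate other than that of the chart.
        Euler's identity eliminates \<open>P i\<close> from the directional derivative: if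
        \<open>p\<close> divided all other \<open>P j (X a)\<close>, it would divide
        \<open>X a i * val\<close>.\<close>
      have "\<exists>j<r. j \<noteq> i \<and> \<not> int p dvd P j (X a)"
      proof (rule ccontr)
        assume no: "\<not> ?thesis"
        have "jet r H P" using \<F>(3) HP(1) by fastforce
        then obtain e'' where "\<forall>x. (\<Sum>i<r. x i * P i x) = int e'' * H x"
          unfolding jet_def by (elim exE conjE)
        then have eul: "(\<Sum>j<r. X a j * P j (X a)) = 0" using HP(2) by simp
        have "(\<Sum>j<r. (X a i * z j - z i * X a j) * P j (X a)) =
            X a i * val - z i * (\<Sum>j<r. X a j * P j (X a))"
          by (simp add: val_def sum_distrib_left sum_subtractf algebra_simps)
        moreover have "int p dvd (\<Sum>j<r. (X a i * z j - z i * X a j) * P j (X a))"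
        proof (rule dvd_sum)
          fix j assume "j \<in> {..<r}"
          then show "int p dvd (X a i * z j - z i * X a j) * P j (X a)"
            using no by (cases "j = i") (auto simp: mult.commute)
        qed
        ultimately have "int p dvd X a i * val" using eul by simp
        then show False using pn pp by (simp add: prime_dvd_mult_iff)
      qed
      then obtain j where j: "j < r" "j \<noteq> i" "\<not> int p dvd P j (X a)" by blast
      have "a \<in> T (H, P) p (fst (i, j)) (snd (i, j))" using a HP(2) pn(3) j(3) by (simp add: T_def)
      moreover have "p \<in> primes" "(i, j) \<in> pairs" using p pn i j by (auto simp: primes_def pairs_def)
      ultimately show ?thesis using HP(1) by blast
    qed
    let ?Z = "fact r * E ^ r"
    have lnZ: "0 \<le> ln ?Z" "ln ?Z \<le> C4 * ln E"
    proof -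
      have "(1::real) * 1 \<le> ?Z" using E by (intro mult_mono one_le_power) (auto simp: fact_ge_1)
      then show "0 \<le> ln ?Z" by simp
      have "(fact r :: real) \<le> 2 ^ fact r" using of_nat_less_two_power[of "fact r", where 'a = real] by simp
      also have "\<dots> \<le> E ^ fact r" using E by (intro power_mono) auto
      finally have "?Z \<le> E ^ fact r * E ^ r" using E by (intro mult_right_mono) auto
      then have "ln ?Z \<le> ln (E ^ (fact r + r))" using E by (subst ln_le_cancel_iff) (auto simp: power_add)
      also have "\<dots> = C4 * ln E" using E by (subst ln_realpow) (auto simp: C4_def)
      finally show "ln ?Z \<le> C4 * ln E" .
    qed
    \<comment> \<open>The factor \<open>2\<close> suffices because
      \<open>ln 2 \<ge> 1/2\<close>.\<close>
    define L where "L = nat \<lfloor>2 * ln ?Z\<rfloor> + 1"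
    have L: "?Z < 2 ^ L" "real L \<le> (2 * C4 + 1) * ln E"
    proof -
      have Lgt: "2 * ln ?Z < real L" unfolding L_def using lnZ(1) by linarith
      have "ln (1 / 2 :: real) \<le> 1 / 2 - 1" by (rule ln_le_minus_one) simp
      then have "1 / 2 \<le> ln (2 :: real)" by (simp add: ln_div)
      then have "ln ?Z \<le> 2 * ln ?Z * ln 2"
        using mult_left_mono[of "1 / 2" "ln 2" "2 * ln ?Z"] lnZ(1) by linarith
      also have "\<dots> < real L * ln 2" using Lgt by (intro mult_strict_right_mono) auto
      also have "\<dots> = ln (2 ^ L)" by (simp add: ln_realpow)
      finally show "?Z < 2 ^ L" using E by (subst (asm) ln_less_cancel_iff) auto
      have "real L \<le> 2 * ln ?Z + 1" unfolding L_def using lnZ(1) by linarith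
      then show "real L \<le> (2 * C4 + 1) * ln E" using lnZ(2) lnE by (simp add: algebra_simps)
    qed
    define B where "B = ((2 * C4 + 1) * ln E) * (C * (C4 * ln E) ^ e) * x ^ s * V powr ((real r - 2) / real r)"
    have T_card: "real (card (T HP p i j)) \<le> B"
      if HP: "HP \<in> \<F>" and p: "p \<in> primes" and ij: "(i, j) \<in> pairs" for HP p i j
    proof -
      obtain H P where HP': "HP = (H, P)" by (cases HP)
      have "jet r H P" using \<F>(3) HP HP' by fastforce
      then obtain K K' e' where J0: "hform K r e' H" "\<forall>i<r. hform K' r (e' - 1) (P i)"
        "\<forall>x. (\<Sum>i<r. x i * P i x) = int e' * H x"
        "\<forall>x h s. s\<^sup>2 dvd H (\<lambda>i. x i + s * h i) - H x - s * (\<Sum>i<r. h i * P i x)"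
        unfolding jet_def by (elim exE conjE)
      note J = J0(1) J0(2)[rule_format] J0(3)[rule_format] J0(4)[rule_format]
      have TS: "T HP p i j \<subseteq> S" by (auto simp: T_def)
      have "real (card (T HP p i j)) \<le> real L * (C * ln ?Z ^ e) * (int p) ^ (r - 1) * V powr ((real r - 2) / real r)"
      proof (rule stage_bound[of r A X E \<Delta> V _ "int p" K e' H K' P i j])
        show "T HP p i j \<subseteq> A" using TS SA by blast
        show "prime (int p)" "\<not> int p dvd \<Delta>" using p by (auto simp: primes_def)
        show "i < r" "j < r" "i \<noteq> j" using ij by (auto simp: pairs_def)
        show "H (X a) = 0 \<and> \<not> int p dvd X a i \<and> \<not> int p dvd P j (X a)" if "a \<in> T HP p i j" for a
          using that by (simp add: T_def HP')
        show "0 \<le> C * ln ?Z ^ e" using C lnZ(1) by simp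
        show "?Z < 2 ^ L" by (rule L(1))
        fix k A' S'
        assume "config r A' X E (\<Delta> * int p ^ (k * r)) (V / real_of_int (int p ^ (k * r)))" "A' \<subseteq> A" "S' \<subseteq> A'"
          "S' \<subseteq> T HP p i j" "\<not> spans r S' X"
        moreover have "zeros r d S' X F" using zeros_subset[OF Z] TS calculation(4) by blast
        ultimately have "real (card S') \<le> C * (V / real_of_int (int p ^ (k * r))) powr ((real s - 2) / real s) * ln ?Z ^ e"
          using drop_bound[OF s cnt] unfolding r_def by blast
        then show "real (card S') \<le> C * ln ?Z ^ e * (V / real_of_int (int p ^ (k * r))) powr ((real r - 3) / (real r - 1))"
          by (simp add: r_def mult_ac)
      qed (fact r cfg J)+
      also have "\<dots> \<le> ((2 * C4 + 1) * ln E) * (C * (C4 * ln E) ^ e) * x ^ s * V powr ((real r - 2) / real r)"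
      proof -
        have "real_of_int (int p ^ (r - 1)) = real p ^ s" by (simp add: r_def)
        also have "\<dots> \<le> x ^ s" using p by (intro power_mono) (auto simp: primes_def)
        finally have *: "real_of_int (int p ^ (r - 1)) \<le> x ^ s" .
        have C4: "0 \<le> C4" by (simp add: C4_def)
        have nonneg: "0 \<le> (2 * C4 + 1) * ln E" "0 \<le> C * (C4 * ln E) ^ e" "0 \<le> C * ln ?Z ^ e"
          using C C4 lnE lnZ(1) by simp_all
        have "C * ln ?Z ^ e \<le> C * (C4 * ln E) ^ e"
          using C lnZ by (intro mult_left_mono power_mono)
        then have "real L * (C * ln ?Z ^ e) \<le> ((2 * C4 + 1) * ln E) * (C * (C4 * ln E) ^ e)"
          by (rule mult_mono[OF L(2)]) (fact nonneg)+
        then have "real L * (C * ln ?Z ^ e) * real_of_int (int p ^ (r - 1)) \<le>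
            ((2 * C4 + 1) * ln E) * (C * (C4 * ln E) ^ e) * x ^ s"
          using * by (rule mult_mono) (use nonneg in simp_all)
        then show ?thesis by (rule mult_right_mono) simp
      qed
      finally show ?thesis by (simp add: B_def)
    qed
    have B0: "0 \<le> B" unfolding B_def using C lnE x0 by (auto simp: C4_def intro!: mult_nonneg_nonneg zero_le_power)
    have primes_sub: "primes \<subseteq> {1..nat \<lfloor>x\<rfloor>}"
      using x0 by (auto simp: primes_def Suc_le_eq prime_gt_0_nat le_nat_iff le_floor_iff)
    then have fin_primes: "finite primes" by (rule finite_subset) simp
    have "card primes \<le> card {1..nat \<lfloor>x\<rfloor>}" using primes_sub by (intro card_mono) auto
    then have card_primes: "real (card primes) \<le> x" using x0 by simp linarith
    have pairs_sub: "pairs \<subseteq> {..<r} \<times> {..<r}" by (auto simp: pairs_def)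
    then have fin_pairs: "finite pairs" by (rule finite_subset) simp
    have "card pairs \<le> card ({..<r} \<times> {..<r})" using pairs_sub by (intro card_mono) auto
    then have card_pairs: "real (card pairs) \<le> real r * real r" by (simp flip: of_nat_mult)
    let ?J = "\<F> \<times> primes \<times> pairs"
    let ?T = "\<lambda>(HP, p, ij). T HP p (fst ij) (snd ij)"
    have finJ: "finite ?J" using \<F>(1) fin_primes fin_pairs by simp
    have finT: "finite (?T y)" for y using finS by (cases y) (auto simp: T_def)
    have "S \<subseteq> (\<Union>y\<in>?J. ?T y)" using covered by fastforce
    then have "card S \<le> card (\<Union>y\<in>?J. ?T y)" using finJ finT by (intro card_mono finite_UN_I) auto
    also have "\<dots> \<le> (\<Sum>y\<in>?J. card (?T y))" using finJ by (rule card_UN_le)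
    finally have "real (card S) \<le> (\<Sum>y\<in>?J. real (card (?T y)))"
      by (simp only: of_nat_le_iff flip: of_nat_sum)
    also have "\<dots> \<le> (\<Sum>y\<in>?J. B)" using T_card by (intro sum_mono) auto
    also have "\<dots> = real (card \<F>) * (real (card primes) * real (card pairs)) * B"
      by (simp add: card_cartesian_product)
    also have "\<dots> \<le> real d * (x * (real r * real r)) * B"
      using \<F>(2) card_primes card_pairs B0 x0 by (intro mult_mono) auto
    also have "\<dots> = C' * V powr ((real r - 2) / real r) * ln E ^ (e + 2 * s + 3)"
    proof -
      have "ln E ^ (s * 2) = ln E ^ s * ln E ^ s" by (simp add: power_mult power2_eq_square)
      then show ?thesis
        unfolding B_def x_def C'_def
        by (simp add: power_mult_distrib power_add power2_eq_square power3_eq_cube mult_2 mult_ac flip: power_mult)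
    qed
    \<comment> \<open>The cruder increments add up to the exponent of the theorem;
      \<open>s \<ge> 2\<close> leaves room for them.\<close>
    also have "\<dots> \<le> C' * V powr ((real r - 2) / real r) * ln E ^ (e + 2 * s\<^sup>2)"
    proof -
      have "2 * s + 3 \<le> 2 * s\<^sup>2"
      proof -
        obtain t where t: "s = t + 2" using s by (metis add.commute le_Suc_ex)
        show ?thesis unfolding t by (simp add: power2_eq_square algebra_simps)
      qed
      then show ?thesis using C'0 lnE by (intro mult_left_mono power_increasing) auto
    qed
    finally show ?thesis .
  qed
  then have "counted TYPE('a) r d (e + 2 * s\<^sup>2) C'" using C'0 unfolding counted_def by blast
  then show ?thesis unfolding r_def by blast
qed

lemma counted_exists:
  assumes "2 \<le> r"
  shows "\<exists>C. counted TYPE('a) r d (\<Sum>k = 2..<r. 2 * k\<^sup>2) C"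
  using assms
proof (induction r rule: dec_induct)
  case base
  show ?case using counted_2[where 'a = 'a, of d] by auto
next
  case (step s)
  then obtain C where C: "counted TYPE('a) s d (\<Sum>k = 2..<s. 2 * k\<^sup>2) C" by blast
  have "(\<Sum>k = 2..<Suc s. 2 * k\<^sup>2) = (\<Sum>k = 2..<s. 2 * k\<^sup>2) + 2 * s\<^sup>2" using step(1) by simp
  with counted_step[OF step(1) C] show ?case by simp
qed

section \<open>Counting points on the hypersurface\<close>

text \<open>Taking the gcd over \<open>i\<close> in \<open>x i * y j = x j * y i\<close> gives
  \<open>\<bar>y j\<bar> = \<bar>x j\<bar>\<close>, as both vectors have gcd \<open>1\<close>. A
  single nonzero coordinate then fixes the sign for all of them.\<close>

lemma primitive_parallel:
  assumes x: "x \<in> primitive_vectors n" and y: "y \<in> primitive_vectors n" and par: "parallel n x y"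
  shows "y = x \<or> y = (\<lambda>i\<in>{..<n}. - x i)"
proof -
  have gx: "Gcd (x ` {..<n}) = 1" "Gcd (y ` {..<n}) = 1"
    and ext: "x \<in> {..<n} \<rightarrow>\<^sub>E UNIV" "y \<in> {..<n} \<rightarrow>\<^sub>E UNIV"
    using x y by (auto simp: primitive_vectors_def vectors_def)
  have p: "x i * y j = x j * y i" if "i < n" "j < n" for i j
    using par that unfolding parallel_def by blast
  have abs_eq: "\<bar>y j\<bar> = \<bar>x j\<bar>" if j: "j < n" for j
  proof -
    have "(*) (y j) ` x ` {..<n} = (*) (x j) ` y ` {..<n}"
      unfolding image_image using p[OF _ j] by (intro image_cong) (auto simp: mult.commute)
    then have "Gcd ((*) (y j) ` x ` {..<n}) = Gcd ((*) (x j) ` y ` {..<n})" by (rule arg_cong)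
    then show ?thesis unfolding Gcd_mult gx by simp
  qed
  have "\<exists>i<n. x i \<noteq> 0"
  proof (rule ccontr)
    assume "\<not> ?thesis"
    then have "x ` {..<n} \<subseteq> {0}" by auto
    then have "Gcd (x ` {..<n}) = 0" by (simp add: Gcd_0_iff)
    then show False using gx by simp
  qed
  then obtain i where i: "i < n" "x i \<noteq> 0" by blast
  consider "y i = x i" | "y i = - x i" using abs_eq[OF i(1)] by (auto simp: abs_if split: if_splits)
  then show ?thesis
  proof cases
    case 1
    then have "y j = x j" if "j < n" for j using p[OF i(1) that] i(2) by simp
    then have "y = x" using ext by (intro PiE_ext[of _ "{..<n}" "\<lambda>_. UNIV"]) auto
    then show ?thesis ..
  next
    case 2
    then have "y j = - x j" if "j < n" for j
    proof -
      have "x i * y j = x i * (- x j)" using p[OF i(1) that] 2 by simp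
      then show ?thesis using i(2) by (simp only: mult_cancel_left) simp
    qed
    then have "y = (\<lambda>i\<in>{..<n}. - x i)"
      using ext by (intro PiE_ext[of _ "{..<n}" "\<lambda>_. UNIV"]) auto
    then show ?thesis ..
  qed
qed

text \<open>\<open>N1\<close> counts \<open>x\<close> and \<open>-x\<close> separately, whereas
  \<open>zeros\<close> demands distinct projective points; hence the factor
  \<open>2\<close>.\<close>

lemma card_representatives:
  assumes fin: "finite S0" and S0: "S0 \<subseteq> primitive_vectors n"
  obtains S where "S \<subseteq> S0" "card S0 \<le> 2 * card S" "\<And>a b. a \<in> S \<Longrightarrow> b \<in> S \<Longrightarrow> parallel n a b \<Longrightarrow> a = b"
proof -
  define neg where "neg x = (\<lambda>i\<in>{..<n}. - x i)" for x :: "nat \<Rightarrow> int"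
  \<comment> \<open>The chosen element depends only on the set of \<open>x\<close> and
    \<open>neg x\<close> within \<open>S0\<close>, so parallel values of \<open>f\<close> arise from
    the same predicate and coincide.\<close>
  define f where "f x = (SOME y. y \<in> S0 \<and> (y = x \<or> y = neg x))" for x
  have f: "f x \<in> S0 \<and> (f x = x \<or> f x = neg x)" if "x \<in> S0" for x
    unfolding f_def by (rule someI[of _ x]) (use that in simp)
  have negneg: "neg (neg x) = x" if "x \<in> S0" for x
  proof
    fix i
    have "x \<in> extensional {..<n}"
      using that S0 by (auto simp: primitive_vectors_def vectors_def PiE_iff)
    then show "neg (neg x) i = x i" by (simp add: neg_def extensional_def)
  qed
  have fib: "{x \<in> S0. f x = y} \<subseteq> {y, neg y}" for y
  proof
    fix x assume "x \<in> {x \<in> S0. f x = y}"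
    then show "x \<in> {y, neg y}" using f[of x] negneg[of x] by auto
  qed
  have "card S0 = (\<Sum>y\<in>f ` S0. card {x \<in> S0. f x = y})"
    using sum.image_gen[OF fin, of "\<lambda>_. 1 :: nat" f] by simp
  also have "\<dots> \<le> (\<Sum>y\<in>f ` S0. 2)"
  proof (rule sum_mono)
    fix y
    have "card {x \<in> S0. f x = y} \<le> card {y, neg y}" using fib by (intro card_mono) auto
    also have "\<dots> \<le> 2" by (simp add: card_insert_if)
    finally show "card {x \<in> S0. f x = y} \<le> 2" .
  qed
  finally have "card S0 \<le> 2 * card (f ` S0)" by simp
  moreover have "a = b" if ab: "a \<in> f ` S0" "b \<in> f ` S0" and par: "parallel n a b" for a b
  proof -
    obtain x y where xy: "x \<in> S0" "a = f x" "y \<in> S0" "b = f y" using ab by blast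
    have aS: "a \<in> S0" "b \<in> S0" using xy f by auto
    have "b = a \<or> b = neg a"
      unfolding neg_def using primitive_parallel[OF _ _ par] aS S0 by blast
    moreover have nn: "neg (neg a) = a" by (rule negneg[OF aS(1)])
    moreover have x: "x = a \<or> x = neg a" using f[OF xy(1)] negneg[OF xy(1)] xy(2) by metis
    moreover have "y = b \<or> y = neg b" using f[OF xy(3)] negneg[OF xy(3)] xy(4) by metis
    ultimately have y: "y = a \<or> y = neg a" by metis
    have cl: "{u, neg u} = {a, neg a}" if "u = a \<or> u = neg a" for u
      using that nn by (elim disjE) (simp_all add: insert_commute)
    have "{y, neg y} = {x, neg x}" unfolding cl[OF x] cl[OF y] ..
    then have "(\<lambda>z. z \<in> S0 \<and> (z = x \<or> z = neg x)) = (\<lambda>z. z \<in> S0 \<and> (z = y \<or> z = neg y))" by auto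
    then show ?thesis unfolding xy f_def by (rule arg_cong)
  qed
  ultimately show ?thesis using f by (intro that[of "f ` S0"]) auto
qed

section \<open>Lines over the integers and over the complex numbers\<close>

lemma lookup_complex_mpol: "Poly_Mapping.lookup (complex_mpol F) m = of_int (Poly_Mapping.lookup F m)"
  by (simp add: complex_mpol_def map.rep_eq when_def)

lemma keys_complex_mpol: "Poly_Mapping.keys (complex_mpol F) = Poly_Mapping.keys F"
  by (auto simp: in_keys_iff lookup_complex_mpol)

lemma mpol_eval_complex_mpol:
  "mpol_eval (complex_mpol F) (\<lambda>i. of_int (x i)) = of_int (mpol_eval F x)"
  by (simp add: mpol_eval_def keys_complex_mpol lookup_complex_mpol)

text \<open>On the plane spanned by \<open>x\<close> and \<open>y\<close> the form is binary, and
  with \<open>s = 1\<close> it has all integers as roots. So its coefficients vanish, and it is zero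
  for all complex \<open>s\<close> and \<open>t\<close>. The contrapositive turns the condition on
  complex lines in \<open>N1\<close> into the integral one in \<open>zeros\<close>.\<close>

lemma line_in_hypersurface:
  assumes F: "form n d F" and x: "x \<in> vectors n" and np: "\<not> parallel n x y"
    and zero: "\<And>s t. mpol_eval F (\<lambda>i. s * x i + t * y i) = 0"
  shows "\<exists>L. is_line n L \<and> L \<subseteq> hypersurface n F \<and> complex_vector n x \<in> L"
proof -
  let ?x = "\<lambda>i. complex_of_int (x i)" and ?y = "\<lambda>i. complex_of_int (y i)"
  let ?u = "complex_vector n x" and ?v = "complex_vector n y"
  define L where "L = {z \<in> vectors n. \<exists>s t. \<forall>i<n. z i = s * ?u i + t * ?v i}"
  have uv: "?u \<in> vectors n" "?v \<in> vectors n" by (auto simp: complex_vector_def vectors_def)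
  have uvi: "?u i = ?x i" "?v i = ?y i" if "i < n" for i using that by (simp_all add: complex_vector_def)
  obtain i j where ij: "i < n" "j < n" "x i * y j \<noteq> x j * y i" using np unfolding parallel_def by blast
  have indep: "s = 0 \<and> t = 0" if st: "\<forall>i<n. s * ?u i + t * ?v i = 0" for s t
  proof -
    have e: "s * ?x i + t * ?y i = 0" "s * ?x j + t * ?y j = 0" using st ij uvi by metis+
    have "?x i * ?y j - ?x j * ?y i = of_int (x i * y j - x j * y i)" by simp
    then have D: "?x i * ?y j - ?x j * ?y i \<noteq> 0" using ij(3) by (simp only: of_int_eq_0_iff)
    have "s * (?x i * ?y j - ?x j * ?y i) = (s * ?x i + t * ?y i) * ?y j - (s * ?x j + t * ?y j) * ?y i"
      by (simp add: algebra_simps)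
    moreover have "t * (?x i * ?y j - ?x j * ?y i) = (s * ?x j + t * ?y j) * ?x i - (s * ?x i + t * ?y i) * ?x j"
      by (simp add: algebra_simps)
    ultimately show ?thesis using D unfolding e by simp
  qed
  then have line: "is_line n L" unfolding is_line_def L_def using uv by blast
  have FC: "hform UNIV n d (mpol_eval (complex_mpol F))"
    using F by (intro hform_mpol_eval) (simp add: form_def keys_complex_mpol)
  obtain c where c: "\<And>s t. mpol_eval (complex_mpol F) (\<lambda>i. s * ?x i + t * ?y i) =
      (\<Sum>j\<le>d. c j * s ^ (d - j) * t ^ j)"
  proof (rule hform_binary[OF FC, of ?x ?y])
    fix c assume "\<And>s t. mpol_eval (complex_mpol F) (\<lambda>i. s * ?x i + t * ?y i) =
      (\<Sum>j\<le>d. c j * s ^ (d - j) * t ^ j)"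
    then show thesis by (rule that)
  qed
  define q where "q = (\<Sum>j\<le>d. monom (c j) j)"
  have "poly q (of_int k) = 0" for k :: int
  proof -
    have "poly q (of_int k) = mpol_eval (complex_mpol F) (\<lambda>i. 1 * ?x i + of_int k * ?y i)"
      unfolding c q_def by (simp add: poly_sum poly_monom)
    also have "(\<lambda>i. 1 * ?x i + of_int k * ?y i) = (\<lambda>i. of_int (1 * x i + k * y i))" by auto
    also have "mpol_eval (complex_mpol F) (\<lambda>i. of_int (1 * x i + k * y i)) = 0"
      unfolding mpol_eval_complex_mpol zero by simp
    finally show ?thesis .
  qed
  then have sub: "range complex_of_int \<subseteq> {t. poly q t = 0}" by auto
  have "infinite (range complex_of_int)"
    using infinite_UNIV_int by (auto dest!: finite_imageD simp: inj_on_def)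
  then have q0: "q = 0" using poly_roots_finite[of q] finite_subset[OF sub] by blast
  have c0: "c j = 0" if "j \<le> d" for j
  proof -
    have "coeff q j = c j" using that by (simp add: q_def coeff_sum)
    then show ?thesis using q0 by simp
  qed
  have "L \<subseteq> hypersurface n F"
  proof
    fix z assume "z \<in> L"
    then obtain s t where z: "z \<in> vectors n" "\<And>i. i < n \<Longrightarrow> z i = s * ?u i + t * ?v i" by (auto simp: L_def)
    have "mpol_eval (complex_mpol F) z = mpol_eval (complex_mpol F) (\<lambda>i. s * ?x i + t * ?y i)"
      using z(2) uvi by (intro hform_cong[OF FC]) simp
    also have "\<dots> = 0" unfolding c using c0 by simp
    finally show "z \<in> hypersurface n F" using z(1) by (simp add: hypersurface_def)
  qed
  moreover have "?u \<in> L"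
    unfolding L_def using uv(1) by (intro CollectI conjI exI[of _ 1] exI[of _ 0]) auto
  ultimately show ?thesis using line by blast
qed

lemma finite_integer_box: "finite {x \<in> vectors n. \<forall>i<n. \<bar>real_of_int (x i)\<bar> \<le> B i}"
proof (rule finite_subset)
  show "{x \<in> vectors n. \<forall>i<n. \<bar>real_of_int (x i)\<bar> \<le> B i} \<subseteq> {..<n} \<rightarrow>\<^sub>E {- \<lceil>Max (B ` {..<n})\<rceil>..\<lceil>Max (B ` {..<n})\<rceil>}"
  proof
    fix x assume x: "x \<in> {x \<in> vectors n. \<forall>i<n. \<bar>real_of_int (x i)\<bar> \<le> B i}"
    have "x i \<in> {- \<lceil>Max (B ` {..<n})\<rceil>..\<lceil>Max (B ` {..<n})\<rceil>}" if "i < n" for i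
    proof -
      have "B i \<le> Max (B ` {..<n})" using that by (intro Max_ge) auto
      moreover have "\<bar>real_of_int (x i)\<bar> \<le> B i" using x that by blast
      ultimately have "\<bar>real_of_int (x i)\<bar> \<le> of_int \<lceil>Max (B ` {..<n})\<rceil>" by linarith
      then have "\<bar>x i\<bar> \<le> \<lceil>Max (B ` {..<n})\<rceil>" by (simp only: of_int_le_iff flip: of_int_abs)
      then show ?thesis by (simp add: abs_le_iff)
    qed
    then show "x \<in> {..<n} \<rightarrow>\<^sub>E {- \<lceil>Max (B ` {..<n})\<rceil>..\<lceil>Max (B ` {..<n})\<rceil>}"
      using x by (auto simp: vectors_def PiE_iff)
  qed
qed (auto intro: finite_PiE)

text \<open>The points label themselves, with \<open>\<Delta> = 1\<close>. The factor
  \<open>fact n\<close> comes from the Leibniz formula. As all \<open>B i\<close> are at least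
  \<open>1\<close>, each is at most \<open>V\<close>, so \<open>E = 3 * V\<close> bounds the
  coordinates and is at least \<open>3\<close>.\<close>

lemma N1_log_bound:
  assumes n: "2 \<le> n"
  shows "\<exists>C\<ge>0. \<forall>(F::int mpol) B. form n d F \<longrightarrow> (\<forall>i<n. 1 \<le> B i) \<longrightarrow>
    real (N1 n F B) \<le> C * (\<Prod>i<n. B i) powr ((real n - 2) / real n) *
      log1 (\<Prod>i<n. B i) ^ (\<Sum>k = 2..<n. 2 * k\<^sup>2)"
proof -
  define e where "e = (\<Sum>k = 2..<n. 2 * k\<^sup>2)"
  obtain C where "counted TYPE(nat \<Rightarrow> int) n d e C"
    using counted_exists[OF n, where 'a = "nat \<Rightarrow> int"] unfolding e_def by blast
  then have C: "0 \<le> C" and bound: "\<And>(A :: (nat \<Rightarrow> int) set) S X F E \<Delta> V.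
      config n A X E \<Delta> V \<Longrightarrow> S \<subseteq> A \<Longrightarrow> zeros n d S X F \<Longrightarrow>
      real (card S) \<le> C * V powr ((real n - 2) / real n) * ln E ^ e"
    unfolding counted_def by blast+
  define C' where "C' = 2 * (C * fact n powr ((real n - 2) / real n) * 3 ^ e)"
  have "real (N1 n F B) \<le> C' * (\<Prod>i<n. B i) powr ((real n - 2) / real n) * log1 (\<Prod>i<n. B i) ^ e"
    if F: "form n d F" and B: "\<forall>i<n. 1 \<le> B i" for F B
  proof -
    define V where "V = (\<Prod>i<n. B i)"
    have BV: "B i \<le> V" if "i < n" for i
    proof -
      have "V = B i * (\<Prod>j\<in>{..<n} - {i}. B j)" unfolding V_def using that by (intro prod.remove) auto
      moreover have "1 \<le> (\<Prod>j\<in>{..<n} - {i}. B j)" using B by (intro prod_ge_1) auto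
      ultimately show ?thesis using B that mult_left_mono[of 1 _ "B i"] by fastforce
    qed
    have V1: "1 \<le> V" unfolding V_def using B by (intro prod_ge_1) auto
    define S0 where "S0 = {x \<in> primitive_vectors n.
       mpol_eval F x = 0 \<and> (\<forall>i<n. \<bar>real_of_int (x i)\<bar> \<le> B i) \<and>
       \<not> (\<exists>L. is_line n L \<and> L \<subseteq> hypersurface n F \<and> complex_vector n x \<in> L)}"
    have N1: "N1 n F B = card S0" by (simp add: N1_def S0_def)
    have "finite S0"
      by (rule finite_subset[OF _ finite_integer_box[of n B]]) (auto simp: S0_def primitive_vectors_def)
    moreover have "S0 \<subseteq> primitive_vectors n" by (auto simp: S0_def)
    ultimately obtain S where S: "S \<subseteq> S0" "card S0 \<le> 2 * card S"
      "\<And>a b. a \<in> S \<Longrightarrow> b \<in> S \<Longrightarrow> parallel n a b \<Longrightarrow> a = b"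
      using card_representatives[of S0 n thesis] by blast
    have finS: "finite S" using S(1) \<open>finite S0\<close> by (rule finite_subset)
    define unit :: "nat \<Rightarrow> nat \<Rightarrow> int" where "unit k i = (if k = i then 1 else 0)" for k i
    \<comment> \<open>\<open>S\<close> need not span; the unit vectors lie in the box because \<open>B i \<ge> 1\<close>.\<close>
    define A where "A = S \<union> unit ` {..<n}"
    have AB: "\<bar>real_of_int (a i)\<bar> \<le> B i" if "a \<in> A" "i < n" for a i
      using that S(1) B by (auto simp: A_def S0_def unit_def)
    have cfg: "config n A (\<lambda>a. a) (3 * V) 1 (fact n * V)"
      unfolding config_def
    proof (intro conjI ballI allI impI)
      show "finite A" using finS by (simp add: A_def)
      show "3 \<le> 3 * V" using V1 by simp
      have "detf n unit = 1"
        unfolding detf_def unit_def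
        by (subst det_one[of n, symmetric], rule arg_cong[where f = det]) auto
      then show "spans n A (\<lambda>a. a)" unfolding spans_def by (intro bexI[of _ unit]) (auto simp: A_def)
      show "\<bar>real_of_int (a i)\<bar> \<le> 3 * V" if "a \<in> A" "i < n" for a i
        using AB[OF that] BV[OF that(2)] V1 by linarith
      show "\<bar>real_of_int (detf n (\<lambda>i. v i))\<bar> \<le> real_of_int 1 * (fact n * V)" if "v \<in> {..<n} \<rightarrow> A" for v
        unfolding V_def using AB that by (simp, intro detf_bound) auto
    qed auto
    have Z: "zeros n d S (\<lambda>a. a) (mpol_eval F)"
      unfolding zeros_def
    proof (intro conjI ballI allI impI)
      show "hform UNIV n d (mpol_eval F)" using F by (rule hform_mpol_eval)
      fix a assume a: "a \<in> S"
      then have aS0: "a \<in> S0" using S(1) by blast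
      show "mpol_eval F a = 0" using aS0 by (simp add: S0_def)
      show "\<exists>i<n. a i \<noteq> 0"
      proof (rule ccontr)
        assume "\<not> ?thesis"
        then have "a ` {..<n} \<subseteq> {0}" by auto
        then have "Gcd (a ` {..<n}) = 0" by (simp add: Gcd_0_iff)
        moreover have "Gcd (a ` {..<n}) = 1" using aS0 by (simp add: S0_def primitive_vectors_def)
        ultimately show False by (simp only: zero_neq_one)
      qed
      show "a = b" if "b \<in> S" "parallel n a b" for b using S(3) a that by blast
      fix y assume np: "\<not> parallel n a y"
      show "\<exists>s t. mpol_eval F (\<lambda>i. s * a i + t * y i) \<noteq> 0"
      proof (rule ccontr)
        assume no: "\<not> ?thesis"
        have "a \<in> vectors n" using aS0 by (simp add: S0_def primitive_vectors_def)
        then have "\<exists>L. is_line n L \<and> L \<subseteq> hypersurface n F \<and> complex_vector n a \<in> L"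
          using no by (intro line_in_hypersurface[OF F _ np]) auto
        moreover have "\<not> (\<exists>L. is_line n L \<and> L \<subseteq> hypersurface n F \<and> complex_vector n a \<in> L)"
          using aS0 unfolding S0_def mem_Collect_eq by (elim conjE)
        ultimately show False by (rule rev_notE)
      qed
    qed
    have "real (card S) \<le> C * (fact n * V) powr ((real n - 2) / real n) * ln (3 * V) ^ e"
      using bound[OF cfg _ Z] by (auto simp: A_def)
    also have "\<dots> \<le> C * (fact n powr ((real n - 2) / real n) * V powr ((real n - 2) / real n)) * (3 * log1 V) ^ e"
    proof -
      \<comment> \<open>As \<open>ln 3 \<le> 2\<close>, the shift is absorbed into
        \<open>3 * log1 V\<close>.\<close>
      have "ln (3 * V) = ln 3 + ln V" using V1 by (simp add: ln_mult)
      moreover have "ln 3 \<le> (3 - 1 :: real)" by (rule ln_le_minus_one) simp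
      ultimately have "ln (3 * V) \<le> 3 * log1 V" unfolding log1_def by linarith
      moreover have "0 \<le> ln (3 * V)" using V1 by simp
      ultimately have "ln (3 * V) ^ e \<le> (3 * log1 V) ^ e" by (intro power_mono)
      moreover have "(fact n * V) powr a = fact n powr a * V powr a" for a
        using V1 by (simp add: powr_mult)
      ultimately show ?thesis using C by (simp only:) (intro mult_left_mono mult_nonneg_nonneg powr_ge_zero)
    qed
    finally have "2 * real (card S) \<le> C' * V powr ((real n - 2) / real n) * log1 V ^ e"
      by (simp add: C'_def power_mult_distrib mult_ac)
    moreover have "real (card S0) \<le> 2 * real (card S)" using S(2) by linarith
    ultimately show ?thesis unfolding N1 V_def by linarith
  qed
  moreover have "0 \<le> C'" using C by (simp add: C'_def)
  ultimately show ?thesis unfolding e_def by blast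
qed

text \<open>The origin of the exponent of the logarithm: passing from rank \<open>k\<close> to rank
  \<open>k + 1\<close> costs \<open>2 * k^2\<close>, starting from \<open>0\<close> in rank
  2.\<close>

lemma sum_exponents:
  assumes "2 \<le> n"
  shows "real (\<Sum>k = 2..<n. 2 * k\<^sup>2) = (real n - 2) * (2 * real n ^ 2 + real n + 3) / 3"
  using assms
proof (induction n rule: dec_induct)
  case (step n)
  have "(\<Sum>k = 2..<Suc n. 2 * k\<^sup>2) = (\<Sum>k = 2..<n. 2 * k\<^sup>2) + 2 * n\<^sup>2" using step(1) by simp
  then show ?case using step(3) by (simp add: power2_eq_square field_simps)
qed auto

lemma log1_power_le:
  fixes \<epsilon> :: real
  assumes \<epsilon>: "0 < \<epsilon>"
  shows "\<exists>C\<ge>0. \<forall>B\<ge>1. log1 (B ^ n) ^ e \<le> C * B powr \<epsilon>"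
proof -
  \<comment> \<open>Each of the \<open>e\<close> logarithms may cost \<open>B powr \<delta>\<close>;
    the \<open>+ 1\<close> avoids a division by zero when \<open>e = 0\<close>.\<close>
  define \<delta> where "\<delta> = \<epsilon> / (real e + 1)"
  have \<delta>: "0 < \<delta>" using \<epsilon> by (simp add: \<delta>_def)
  have "log1 (B ^ n) ^ e \<le> (1 + real n / \<delta>) ^ e * B powr \<epsilon>" if B: "1 \<le> B" for B :: real
  proof -
    have p1: "1 \<le> B powr \<delta>" using B \<delta> by (simp add: ge_one_powr_ge_zero)
    have "ln (B ^ n) = real n * ln B" using B by (simp add: ln_realpow)
    also have "\<dots> \<le> real n * (B powr \<delta> / \<delta>)" using ln_powr_bound[OF B \<delta>] by (intro mult_left_mono) auto
    finally have "ln (B ^ n) \<le> real n / \<delta> * B powr \<delta>" by simp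
    moreover have "0 \<le> real n / \<delta> * B powr \<delta>" using \<delta> by simp
    ultimately have "log1 (B ^ n) \<le> (1 + real n / \<delta>) * B powr \<delta>"
      unfolding log1_def distrib_right using p1 by linarith
    moreover have "0 \<le> log1 (B ^ n)" by (simp add: log1_def)
    ultimately have "log1 (B ^ n) ^ e \<le> ((1 + real n / \<delta>) * B powr \<delta>) ^ e" by (intro power_mono)
    also have "\<dots> = (1 + real n / \<delta>) ^ e * B powr (\<delta> * real e)"
      using B by (simp add: power_mult_distrib powr_powr flip: powr_realpow)
    also have "\<dots> \<le> (1 + real n / \<delta>) ^ e * B powr \<epsilon>"
    proof -
      have "\<delta> * real e \<le> \<delta> * (real e + 1)" using \<delta> by (intro mult_left_mono) auto
      also have "\<dots> = \<epsilon>" by (simp add: \<delta>_def)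
      finally show ?thesis using B \<delta> by (intro mult_left_mono powr_mono) auto
    qed
    finally show ?thesis .
  qed
  moreover have "0 \<le> (1 + real n / \<delta>) ^ e" using \<delta> by simp
  ultimately show ?thesis by blast
qed

lemma height_ge_1:
  assumes "F \<noteq> 0"
  shows "1 \<le> height F"
proof -
  obtain m where m: "m \<in> Poly_Mapping.keys F" using assms by fastforce
  then have "1 \<le> \<bar>Poly_Mapping.lookup F m\<bar>" by (simp add: in_keys_iff)
  also have "\<dots> \<le> height F" unfolding height_def using m by (intro Max_ge) auto
  finally show ?thesis .
qed

theorem theorem2:
  fixes n d :: nat
  assumes "n \<ge> 2"
  shows
    "(\<exists>C::real. \<forall>(F::int mpol) (B::nat \<Rightarrow> real).
        form n d F \<and> absolutely_irreducible F \<and> (\<forall>i<n. B i \<ge> 1) \<longrightarrow>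
        (let V = (\<Prod>i<n. B i) in
          real (N1 n F B) \<le>
            C * V powr ((real n - 2) / real n) *
            log1 (real_of_int (height F) * V)
              powr ((real n - 2) * (2 * real n ^ 2 + real n + 3) / 3))) \<and>
     (\<forall>\<epsilon>::real. \<epsilon> > 0 \<longrightarrow> (\<exists>C::real. \<forall>(F::int mpol) (B::real).
        form n d F \<and> absolutely_irreducible F \<and> B \<ge> 1 \<longrightarrow>
        real (N1 n F (\<lambda>i. B)) \<le> C * B powr (real n - 2 + \<epsilon>)))"
proof -
  define e where "e = (\<Sum>k = 2..<n. 2 * k\<^sup>2)"
  obtain C where C: "0 \<le> C" and bound: "\<And>(F::int mpol) B. form n d F \<Longrightarrow> (\<forall>i<n. 1 \<le> B i) \<Longrightarrow>
      real (N1 n F B) \<le> C * (\<Prod>i<n. B i) powr ((real n - 2) / real n) * log1 (\<Prod>i<n. B i) ^ e"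
    using N1_log_bound[OF assms, of d] unfolding e_def by blast
  show ?thesis
  proof (intro conjI allI impI)
    show "\<exists>C::real. \<forall>(F::int mpol) (B::nat \<Rightarrow> real).
        form n d F \<and> absolutely_irreducible F \<and> (\<forall>i<n. B i \<ge> 1) \<longrightarrow>
        (let V = (\<Prod>i<n. B i) in
          real (N1 n F B) \<le>
            C * V powr ((real n - 2) / real n) *
            log1 (real_of_int (height F) * V)
              powr ((real n - 2) * (2 * real n ^ 2 + real n + 3) / 3))"
    proof (intro exI[of _ C] allI impI)
      fix F :: "int mpol" and B :: "nat \<Rightarrow> real"
      assume *: "form n d F \<and> absolutely_irreducible F \<and> (\<forall>i<n. B i \<ge> 1)"
      define V where "V = (\<Prod>i<n. B i)"
      have V1: "1 \<le> V" unfolding V_def using * by (intro prod_ge_1) auto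
      have "F \<noteq> 0"
      proof
        assume "F = 0"
        then have "complex_mpol F = 0" by (intro poly_mapping_eqI) (simp add: lookup_complex_mpol)
        moreover have "irreducible (complex_mpol F)" using * unfolding absolutely_irreducible_def by (elim conjE)
        ultimately show False by simp
      qed
      \<comment> \<open>A nonzero integral form has height at least \<open>1\<close>, so the
        logarithm of \<open>V\<close> is at most the one in the statement.\<close>
      then have "1 * V \<le> real_of_int (height F) * V" using height_ge_1[of F] V1 by (intro mult_right_mono) auto
      then have "ln V \<le> ln (real_of_int (height F) * V)" using V1 by (subst ln_le_cancel_iff) auto
      then have le: "log1 V \<le> log1 (real_of_int (height F) * V)" unfolding log1_def by linarith
      have pos: "1 \<le> log1 V" by (simp add: log1_def)
      have "real (N1 n F B) \<le> C * V powr ((real n - 2) / real n) * log1 V ^ e"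
        unfolding V_def using * by (intro bound) auto
      also have "\<dots> \<le> C * V powr ((real n - 2) / real n) * log1 (real_of_int (height F) * V) ^ e"
        using le pos C by (intro mult_left_mono power_mono) auto
      also have "log1 (real_of_int (height F) * V) ^ e = log1 (real_of_int (height F) * V) powr real e"
        using le pos by (subst powr_realpow) auto
      also have "real e = (real n - 2) * (2 * real n ^ 2 + real n + 3) / 3"
        unfolding e_def by (rule sum_exponents[OF assms])
      finally show "let V = (\<Prod>i<n. B i) in
          real (N1 n F B) \<le>
            C * V powr ((real n - 2) / real n) *
            log1 (real_of_int (height F) * V)
              powr ((real n - 2) * (2 * real n ^ 2 + real n + 3) / 3)"
        unfolding Let_def V_def .
    qed
    fix \<epsilon> :: real assume \<epsilon>: "\<epsilon> > 0"
    obtain C2 where C2: "\<forall>B\<ge>1. log1 (B ^ n) ^ e \<le> C2 * B powr \<epsilon>"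
      using log1_power_le[OF \<epsilon>, of n e] by blast
    show "\<exists>C::real. \<forall>(F::int mpol) (B::real).
        form n d F \<and> absolutely_irreducible F \<and> B \<ge> 1 \<longrightarrow>
        real (N1 n F (\<lambda>i. B)) \<le> C * B powr (real n - 2 + \<epsilon>)"
    proof (intro exI[of _ "C * C2"] allI impI)
      fix F :: "int mpol" and B :: real
      assume *: "form n d F \<and> absolutely_irreducible F \<and> B \<ge> 1"
      have "real (N1 n F (\<lambda>i. B)) \<le> C * (B ^ n) powr ((real n - 2) / real n) * log1 (B ^ n) ^ e"
        using bound[of F "\<lambda>i. B"] * by simp
      also have "\<dots> \<le> C * (B ^ n) powr ((real n - 2) / real n) * (C2 * B powr \<epsilon>)"
        using C C2 * by (intro mult_left_mono) auto
      also have "(B ^ n) powr ((real n - 2) / real n) = B powr (real n - 2)"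
        using * assms by (simp add: powr_powr flip: powr_realpow)
      also have "C * B powr (real n - 2) * (C2 * B powr \<epsilon>) = C * C2 * B powr (real n - 2 + \<epsilon>)"
        by (simp add: powr_add mult_ac)
      finally show "real (N1 n F (\<lambda>i. B)) \<le> C * C2 * B powr (real n - 2 + \<epsilon>)" .
    qed
  qed
qed

end
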